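(* Let $K,E\subseteq\mathbb{R}^n$ be convex bodies with nonempty interior and let $\Omega\subseteq\mathbb{S}^{n-1}$ determine $K$. For $\lambda\ge-\mathrm{r}(K;E)$ let $$K(\Omega,\lambda)=\{x\in\mathbb{R}^n:\langle x,u\rangle\le h_K(u)+\lambda h_E(u)\text{ for all }u\in\Omega\}.$$ Then the relative isoperimetric quotient function $$\mathrm{I}^\Omega(\lambda)=\frac{\mathrm{S}(K(\Omega,\lambda);E)^n}{\mathrm{vol}(K(\Omega,\lambda))^{n-1}}$$ is monotonically decreasing on $(-\mathrm{r}(K;E),\infty)$. Moreover, the following are equivalent for all $-\mathrm{r}(K;E)<\lambda_0<\lambda_1<\infty$: (i) $\mathrm{I}^\Omega(\lambda_0)=\mathrm{I}^\Omega(\lambda_1)$; (ii) $K(\Omega,\lambda_0)$ is homothetic to $K(\Omega,\lambda_1)$; (iii) $K(\Omega,\lambda_1)$ is homothetic to a tangential body of $E$; (iv) $\mathrm{I}^\Omega(\lambda)$ is constant on $(-\mathrm{r}(K;E),\lambda_1]$. If $\lambda_1>0$, the equivalent conditions (i)-(iv) are satisfied if and only if $K$ is homothetic to $E^\Omega$ and, consequently, if and only if $\mathrm{I}^\Omega(\lambda)=\mathrm{I}(E^\Omega;E)=n^n\,\mathrm{vol}(E^\Omega)$ for all $\lambda\in(-\mathrm{r}(K;E),\infty)$.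
   Context: A convex body is a nonempty compact convex subset of $\mathbb{R}^n$; $\mathbb{S}^{n-1}$ is the Euclidean unit sphere; $\mathrm{vol}$ is $n$-dimensional Lebesgue measure. $h_K(u)=\sup\{\langle x,u\rangle:x\in K\}$ is the support function of $K$. A set $\Omega\subseteq\mathbb{S}^{n-1}$ determines $K$ if $K=\{x\in\mathbb{R}^n:\langle x,u\rangle\le h_K(u)\text{ for all }u\in\Omega\}$. For such $\Omega$, $E^\Omega=\{x\in\mathbb{R}^n:\langle x,u\rangle\le h_E(u)\text{ for all }u\in\Omega\}$. The inradius of $K$ relative to $E$ is $\mathrm{r}(K;E)=\sup\{r\ge 0:\text{there is }x\in\mathbb{R}^n\text{ with }x+rE\subseteq K\}$. The relative quermassintegrals $\mathrm{W}_i(K;E)$ are the coefficients in the relative Steiner formula $\mathrm{vol}(K+\lambda E)=\sum_{i=0}^n\binom{n}{i}\mathrm{W}_i(K;E)\lambda^i$, $\lambda\ge 0$; the surface area of $K$ relative to $E$ is $\mathrm{S}(K;E)=n\mathrm{W}_1(K;E)$, and the isoperimetric quotient of $K$ relative to $E$ is $\mathrm{I}(K;E)=\mathrm{S}(K;E)^n/\mathrm{vol}(K)^{n-1}$. Two convex bodies $K,L$ are homothetic if $L=\alpha K+x$ for some $\alpha>0$ and $x\in\mathbb{R}^n$. For convex bodies $L,E$ with nonempty interior and $E\subseteq L$, $L$ is a tangential body of $E$ if through each boundary point of $L$ there is a supporting hyperplane of $L$ that also supports $E$. "Monotonically decreasing" is meant in the weak sense (non-increasing). *)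

theory Defs
  imports "HOL-Analysis.Analysis"
begin

definition convex_body :: "(real^'n) set \<Rightarrow> bool" where
  "convex_body K \<longleftrightarrow> K \<noteq> {} \<and> compact K \<and> convex K"

definition support_fun :: "(real^'n) set \<Rightarrow> real^'n \<Rightarrow> real" where
  "support_fun K u = (SUP x\<in>K. x \<bullet> u)"

definition determines :: "(real^'n) set \<Rightarrow> (real^'n) set \<Rightarrow> bool" where
  "determines \<Omega> K \<longleftrightarrow> K = {x. \<forall>u\<in>\<Omega>. x \<bullet> u \<le> support_fun K u}"

definition form_body :: "(real^'n) set \<Rightarrow> (real^'n) set \<Rightarrow> (real^'n) set" where
  "form_body E \<Omega> = {x. \<forall>u\<in>\<Omega>. x \<bullet> u \<le> support_fun E u}"

definition parallel_body ::
  "(real^'n) set \<Rightarrow> (real^'n) set \<Rightarrow> (real^'n) set \<Rightarrow> real \<Rightarrow> (real^'n) set" where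
  "parallel_body K E \<Omega> lam =
     {x. \<forall>u\<in>\<Omega>. x \<bullet> u \<le> support_fun K u + lam * support_fun E u}"

definition inradius :: "(real^'n) set \<Rightarrow> (real^'n) set \<Rightarrow> real" where
  "inradius K E = Sup {r. r \<ge> 0 \<and> (\<exists>x. (\<lambda>y. x + r *\<^sub>R y) ` E \<subseteq> K)}"

definition steiner_coeffs ::
  "(real^'n) set \<Rightarrow> (real^'n) set \<Rightarrow> (nat \<Rightarrow> real) \<Rightarrow> bool" where
  "steiner_coeffs K E W \<longleftrightarrow>
     (\<forall>lam\<ge>0. measure lebesgue {x + lam *\<^sub>R y |x y. x \<in> K \<and> y \<in> E} =
        (\<Sum>i\<le>CARD('n). real (CARD('n) choose i) * W i * lam ^ i))"

text \<open>
  The Steiner formula constrains only the coefficients with index at most the dimension;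
  the others are set to zero so that the sequence is unique (see \<open>quermassintegral_eqI\<close>).
  For convex bodies it exists by Minkowski's theorem on mixed volumes.
\<close>

definition quermassintegral :: "nat \<Rightarrow> (real^'n) set \<Rightarrow> (real^'n) set \<Rightarrow> real" where
  "quermassintegral i K E =
     (THE W. steiner_coeffs K E W \<and> (\<forall>j>CARD('n). W j = 0)) i"

lemma steiner_coeffs_unique:
  fixes K E :: "(real^'n) set"
  assumes V: "steiner_coeffs K E V" and W: "steiner_coeffs K E W" and i: "i \<le> CARD('n)"
  shows "V i = W i"
proof -
  define c where "c = (\<lambda>j. real (CARD('n) choose j) * (V j - W j))"
  have zero: "(\<Sum>j\<le>CARD('n). c j * x ^ j) = 0" if "x \<ge> 0" for x
    using V W that unfolding steiner_coeffs_def c_def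
    by (simp add: algebra_simps sum_subtractf)
  have "c i = 0"
  proof (rule ccontr)
    assume "c i \<noteq> 0"
    then have "finite {x. (\<Sum>j\<le>CARD('n). c j * x ^ j) = 0}"
      using polyfun_rootbound[of "CARD('n)" c] i by blast
    moreover have "{0::real..} \<subseteq> {x. (\<Sum>j\<le>CARD('n). c j * x ^ j) = 0}"
      using zero by auto
    ultimately show False
      using finite_subset infinite_Ici by blast
  qed
  with i show ?thesis
    unfolding c_def by simp
qed

lemma quermassintegral_eqI:
  fixes K E :: "(real^'n) set"
  assumes W: "steiner_coeffs K E W" and i: "i \<le> CARD('n)"
  shows "quermassintegral i K E = W i"
proof -
  define V where "V = (\<lambda>j. if j \<le> CARD('n) then W j else 0)"
  have V: "steiner_coeffs K E V"
    using W unfolding steiner_coeffs_def V_def by simp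
  have "(THE W. steiner_coeffs K E W \<and> (\<forall>j>CARD('n). W j = 0)) = V"
  proof (rule the_equality)
    show "steiner_coeffs K E V \<and> (\<forall>j>CARD('n). V j = 0)"
      using V by (simp add: V_def)
  next
    fix U assume U: "steiner_coeffs K E U \<and> (\<forall>j>CARD('n). U j = 0)"
    show "U = V"
    proof
      fix j show "U j = V j"
        using U steiner_coeffs_unique[of K E U V j] V
        by (cases "j \<le> CARD('n)") (auto simp: V_def)
    qed
  qed
  then show ?thesis
    using i by (simp add: quermassintegral_def V_def)
qed

definition surface_area :: "(real^'n) set \<Rightarrow> (real^'n) set \<Rightarrow> real" where
  "surface_area K E = real CARD('n) * quermassintegral 1 K E"

definition isoperimetric_quotient :: "(real^'n) set \<Rightarrow> (real^'n) set \<Rightarrow> real" where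
  "isoperimetric_quotient K E =
     surface_area K E ^ CARD('n) / measure lebesgue K ^ (CARD('n) - 1)"

definition homothetic :: "(real^'n) set \<Rightarrow> (real^'n) set \<Rightarrow> bool" where
  "homothetic K L \<longleftrightarrow> (\<exists>\<alpha>>0. \<exists>x. L = (\<lambda>y. \<alpha> *\<^sub>R y + x) ` K)"

definition supporting_hyperplane :: "(real^'n) set \<Rightarrow> (real^'n) set \<Rightarrow> bool" where
  "supporting_hyperplane H K \<longleftrightarrow>
     (\<exists>u c. u \<noteq> 0 \<and> H = {x. x \<bullet> u = c} \<and> H \<inter> K \<noteq> {} \<and> (\<forall>y\<in>K. y \<bullet> u \<le> c))"

definition tangential_body :: "(real^'n) set \<Rightarrow> (real^'n) set \<Rightarrow> bool" where
  "tangential_body L E \<longleftrightarrow>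
     convex_body L \<and> interior L \<noteq> {} \<and> convex_body E \<and> interior E \<noteq> {} \<and> E \<subseteq> L \<and>
     (\<forall>x\<in>frontier L. \<exists>H. x \<in> H \<and> supporting_hyperplane H L \<and> supporting_hyperplane H E)"

end

theory Submission
  imports Defs "HOL-Computational_Algebra.Polynomial"
begin

text \<open>
  Write \<open>V \<lambda>\<close> for the volume of \<open>K(\<Omega>, \<lambda>)\<close> and \<open>f\<close> for its \<open>n\<close>-th root. Convex combinations of the bodies
  \<open>K(\<Omega>, \<lambda>)\<close> lie inside the body of the averaged parameter, so \<open>f\<close> is concave by Brunn--Minkowski. By
  Aleksandrov's variational lemma the right derivative of \<open>V\<close> is the relative surface area, which makes the
  isoperimetric quotient \<open>(n g)^n\<close> with \<open>g\<close> the right derivative of \<open>f\<close>, hence decreasing. If it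
  takes the same value twice, \<open>f\<close> is affine in between, and the equality case of Brunn--Minkowski
  makes the bodies homothetic. A homothety between two bodies of the family contracts the larger one by a multiple of
  \<open>E\<close>, so that, normalized about the fixed point, it is tangential to \<open>E\<close>; conversely the smaller
  parallel bodies of a tangential body are its homothets.

  Brunn--Minkowski is obtained by the cuts of Hadwiger and Ohmann, its equality case by comparing the
  volume quantiles of both bodies in every direction. The Steiner polynomial comes from Gromov's argument: the sum of the gradients of the
  log-Laplace transforms of \<open>K\<close> and \<open>t E\<close> maps the whole space onto the interior of \<open>K + t E\<close> and has a
  Jacobian polynomial in \<open>t\<close>.\<close>

section \<open>The Brunn--Minkowski inequality\<close>

text \<open>The variational lemma carries most of the weight. The right derivative of
  \<open>V\<close> splits into the growth of the volume of \<open>P lam + t E\<close>, which the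
  Steiner polynomial gives, and the excess of \<open>P (lam + t)\<close> over
  \<open>P lam + t E\<close>, which has to be o(t). The excess is estimated along rays: after
  averaging over dilations, for almost every x the ray through x meets it in a set of length o(t),
  because the gauge of the body is differentiable almost everywhere. That differentiability is
  extracted from convexity by bounding a weighted integral of second differences by a multiple of
  t^2. Derivatives are formed only from the right and only along the sequence 1 / (k + 1). This
  suffices because f is concave: such a limit is a supergradient, and monotonicity as well as
  rigidity follow from supergradient inequalities. In the equality case of Brunn--Minkowski the
  obstacle is that each direction yields its own shift between the two bodies; comparing first
  moments shows that the shift is linear in the direction.\<close>

lemma measure_Int_halfspaces:
  fixes S :: "'a::euclidean_space set"
  assumes S: "S \<in> lmeasurable" and u: "u \<noteq> 0"
  shows "measure lebesgue (S \<inter> {x. x \<bullet> u \<le> s}) + measure lebesgue (S \<inter> {x. s \<le> x \<bullet> u}) =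
    measure lebesgue S"
proof -
  have [measurable]: "{x. x \<bullet> u \<le> s} \<in> sets lebesgue" "{x. s \<le> x \<bullet> u} \<in> sets lebesgue"
    by (auto intro!: lebesgue_closedin[of UNIV] closed_halfspace_le closed_Collect_le continuous_intros)
  have m: "S \<inter> {x. x \<bullet> u \<le> s} \<in> lmeasurable" "S \<inter> {x. s \<le> x \<bullet> u} \<in> lmeasurable"
    using S by (auto intro: fmeasurable_Int_fmeasurable)
  have "negligible {x. x \<bullet> u = s}"
    using negligible_hyperplane[of u s] u by (simp add: inner_commute)
  then have "negligible ((S \<inter> {x. x \<bullet> u \<le> s}) \<inter> (S \<inter> {x. s \<le> x \<bullet> u}))"
    by (rule negligible_subset) auto
  then have "measure lebesgue ((S \<inter> {x. x \<bullet> u \<le> s}) \<inter> (S \<inter> {x. s \<le> x \<bullet> u})) = 0"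
    using negligible_imp_measure0 by blast
  moreover have "(S \<inter> {x. x \<bullet> u \<le> s}) \<union> (S \<inter> {x. s \<le> x \<bullet> u}) = S"
    by auto
  ultimately show ?thesis
    using measure_Un3[OF m] by simp
qed

text \<open>Dominated convergence: the indicators converge off the hyperplane at height
  \<open>s\<close>, which is null since \<open>u\<close> is nonzero.\<close>

lemma continuous_on_measure_halfspace:
  fixes S :: "'a::euclidean_space set"
  assumes S: "S \<in> lmeasurable" and u: "u \<noteq> 0"
  shows "continuous_on UNIV (\<lambda>s. measure lebesgue (S \<inter> {x. x \<bullet> u \<le> s}))"
proof -
  have [measurable]: "S \<in> sets lebesgue" "\<And>s. {x. x \<bullet> u \<le> s} \<in> sets lebesgue"
    using S by (auto intro!: lebesgue_closedin[of UNIV] closed_Collect_le continuous_intros)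
  have lim: "(\<lambda>j. measure lebesgue (S \<inter> {x. x \<bullet> u \<le> X j})) \<longlonglongrightarrow> measure lebesgue (S \<inter> {x. x \<bullet> u \<le> s})"
    if X: "X \<longlonglongrightarrow> s" for X s
  proof -
    have eq: "measure lebesgue (S \<inter> {x. x \<bullet> u \<le> t}) = integral\<^sup>L lebesgue (indicat_real (S \<inter> {x. x \<bullet> u \<le> t}))" for t
      by simp
    have "AE x in lebesgue. x \<notin> {x. x \<bullet> u = s}"
      using negligible_hyperplane[of u s] u 
      by (intro AE_not_in) (simp add: inner_commute negligible_iff_null_sets)
    then have ae: "AE x in lebesgue. (\<lambda>j. indicat_real (S \<inter> {x. x \<bullet> u \<le> X j}) x) \<longlonglongrightarrow> indicat_real (S \<inter> {x. x \<bullet> u \<le> s}) x"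
    proof eventually_elim
      case (elim x)
      then consider "x \<bullet> u < s" | "x \<bullet> u > s" by fastforce
      then show ?case
      proof cases
        case 1
        then have "\<forall>\<^sub>F j in sequentially. x \<bullet> u < X j" using X order_tendstoD(1) by blast
        then have "\<forall>\<^sub>F j in sequentially. indicat_real (S \<inter> {x. x \<bullet> u \<le> X j}) x = indicat_real (S \<inter> {x. x \<bullet> u \<le> s}) x"
          by eventually_elim (use 1 in \<open>auto simp: indicator_def\<close>)
        then show ?thesis by (rule tendsto_eventually)
      next
        case 2
        then have "\<forall>\<^sub>F j in sequentially. x \<bullet> u > X j" using X order_tendstoD(2) by blast
        then have "\<forall>\<^sub>F j in sequentially. indicat_real (S \<inter> {x. x \<bullet> u \<le> X j}) x = indicat_real (S \<inter> {x. x \<bullet> u \<le> s}) x"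
          by eventually_elim (use 2 in \<open>auto simp: indicator_def\<close>)
        then show ?thesis by (rule tendsto_eventually)
      qed
    qed
    have "(\<lambda>j. integral\<^sup>L lebesgue (indicat_real (S \<inter> {x. x \<bullet> u \<le> X j}))) \<longlonglongrightarrow> integral\<^sup>L lebesgue (indicat_real (S \<inter> {x. x \<bullet> u \<le> s}))"
    proof (rule integral_dominated_convergence[where w="indicat_real S"])
      show "integrable lebesgue (indicat_real S)"
        using S by (simp add: fmeasurable_def)
    qed (use ae in \<open>auto simp: indicator_def\<close>)
    then show ?thesis by simp
  qed
  show ?thesis
    unfolding continuous_on_sequentially using lim by (auto simp: o_def)
qed

lemma measure_halfspace_IVT:
  fixes S :: "'a::euclidean_space set"
  assumes S: "S \<in> lmeasurable" "bounded S" and u: "u \<noteq> 0" and y: "0 \<le> y" "y \<le> measure lebesgue S"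
  obtains s where "measure lebesgue (S \<inter> {x. x \<bullet> u \<le> s}) = y"
proof -
  obtain B where B: "\<And>x. x \<in> S \<Longrightarrow> norm x \<le> B" using S(2) by (auto simp: bounded_iff)
  have b: "\<bar>x \<bullet> u\<bar> < \<bar>B\<bar> * norm u + 1" if "x \<in> S" for x
  proof -
    have "\<bar>x \<bullet> u\<bar> \<le> norm x * norm u" by (rule Cauchy_Schwarz_ineq2)
    also have "\<dots> \<le> \<bar>B\<bar> * norm u" using B[OF that] by (intro mult_right_mono) auto
    finally show ?thesis by simp
  qed
  define m where "m = \<bar>B\<bar> * norm u + 1"
  have m: "m \<ge> 0" by (simp add: m_def)
  have 1: "S \<inter> {x. x \<bullet> u \<le> m} = S" using b unfolding m_def by (fastforce simp: abs_less_iff)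
  have 2: "S \<inter> {x. x \<bullet> u \<le> - m} = {}" using b unfolding m_def by (fastforce simp: abs_less_iff)
  have "\<exists>s. - m \<le> s \<and> s \<le> m \<and> measure lebesgue (S \<inter> {x. x \<bullet> u \<le> s}) = y"
    using m y by (intro IVT') (auto simp: 1 2 continuous_on_subset[OF continuous_on_measure_halfspace[OF S(1) u]])
  then show ?thesis using that by blast
qed

lemma compact_set_plus:
  fixes A B :: "'a::real_normed_vector set"
  assumes "compact A" "compact B"
  shows "compact (A + B)"
proof -
  have "A + B = {x + y |x y. x \<in> A \<and> y \<in> B}"
    by (auto simp: set_plus_def)
  then show ?thesis using compact_sums[OF assms] by simp
qed

text \<open>Apply the inequality of arithmetic and geometric means to the ratios
  \<open>x i / z i\<close> and to the ratios \<open>y i / z i\<close>, where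
  \<open>z i = x i + y i\<close>. For each index the two ratios add up to 1, so the two normalized
  geometric means add up to at most 1.\<close>

lemma root_sum_prod_le:
  fixes x y :: "'i \<Rightarrow> real"
  assumes I: "finite I" "I \<noteq> {}" and x: "\<And>i. i \<in> I \<Longrightarrow> x i > 0" and y: "\<And>i. i \<in> I \<Longrightarrow> y i > 0"
  shows "(root (card I) (prod x I) + root (card I) (prod y I)) ^ card I \<le> (\<Prod>i\<in>I. x i + y i)"
proof -
  define n where "n = card I"
  have n: "n > 0" using I by (simp add: n_def card_gt_0_iff)
  define z where "z = (\<lambda>i. x i + y i)"
  have z: "z i > 0" if "i \<in> I" for i using x y that by (simp add: z_def add_pos_pos)
  have amgm: "root n (prod w I) / root n (prod z I) \<le> (\<Sum>i\<in>I. w i / z i / n)" if w: "\<And>i. i \<in> I \<Longrightarrow> w i > 0" for w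
  proof -
    have p: "(\<Prod>i\<in>I. w i / z i) > 0" using w z by (intro prod_pos) auto
    have "root n (prod w I) / root n (prod z I) = root n (\<Prod>i\<in>I. w i / z i)"
      by (simp add: prod_dividef real_root_divide)
    also have "\<dots> = (\<Prod>i\<in>I. w i / z i) powr (1 / n)"
      using n p by (simp add: root_powr_inverse)
    also have "\<dots> \<le> (\<Sum>i\<in>I. w i / z i / n)"
      unfolding n_def using w z by (intro arith_geom_mean I) (auto intro: less_imp_le)
    finally show ?thesis .
  qed
  have "root n (prod x I) / root n (prod z I) + root n (prod y I) / root n (prod z I) \<le> (\<Sum>i\<in>I. x i / z i / n) + (\<Sum>i\<in>I. y i / z i / n)"
    using amgm x y by (intro add_mono) auto
  also have "\<dots> = (\<Sum>i\<in>I. z i / z i / n)"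
    unfolding sum.distrib[symmetric] by (intro sum.cong refl) (simp only: z_def add_divide_distrib)
  also have "\<dots> = (\<Sum>i\<in>I. 1 / n)"
  proof (intro sum.cong refl)
    fix i assume "i \<in> I"
    then have "z i \<noteq> 0" using z by (simp add: less_imp_neq[symmetric])
    then show "z i / z i / n = 1 / n" by (simp del: divide_divide_eq_left)
  qed
  also have "\<dots> = 1" using n by (simp add: n_def)
  finally have *: "(root n (prod x I) + root n (prod y I)) / root n (prod z I) \<le> 1"
    by (simp add: add_divide_distrib)
  have pz: "prod z I > 0" using z by (intro prod_pos)
  then have rz: "root n (prod z I) > 0" using n by simp
  from * rz have "root n (prod x I) + root n (prod y I) \<le> root n (prod z I)" by (simp add: divide_le_eq)
  moreover have "0 \<le> root n (prod x I) + root n (prod y I)"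
    using x y n by (intro add_nonneg_nonneg) (auto intro!: prod_nonneg simp: less_imp_le)
  ultimately have "(root n (prod x I) + root n (prod y I)) ^ n \<le> root n (prod z I) ^ n"
    by (rule power_mono)
  also have "\<dots> = prod z I" using n pz by simp
  finally show ?thesis by (simp add: n_def z_def)
qed

text \<open>The sum of the boxes contains the box with the added corners, and for its edge lengths
  the claim is the superadditivity of geometric means.\<close>

lemma Brunn_Minkowski_cbox:
  fixes a b c d :: "'a::euclidean_space"
  assumes ab: "box a b \<noteq> {}" and cd: "box c d \<noteq> {}"
  shows "(root DIM('a) (measure lebesgue (cbox a b)) + root DIM('a) (measure lebesgue (cbox c d))) ^ DIM('a)
    \<le> measure lebesgue (cbox a b + cbox c d)"
proof -
  have ab': "a \<bullet> i < b \<bullet> i" "c \<bullet> i < d \<bullet> i" if "i \<in> Basis" for i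
    using ab cd that by (auto simp: box_ne_empty)
  have sub: "cbox (a + c) (b + d) \<subseteq> cbox a b + cbox c d"
  proof
    fix z assume z: "z \<in> cbox (a + c) (b + d)"
    \<comment> \<open>\<open>t i\<close> is the relative position of \<open>z\<close> between the
      two faces orthogonal to \<open>i\<close>; taking the same relative position in each summand
      splits \<open>z\<close>.\<close>
    define t where "t = (\<lambda>i. (z \<bullet> i - a \<bullet> i - c \<bullet> i) / ((b \<bullet> i - a \<bullet> i) + (d \<bullet> i - c \<bullet> i)))"
    have t: "0 \<le> t i" "t i \<le> 1" "t i * ((b \<bullet> i - a \<bullet> i) + (d \<bullet> i - c \<bullet> i)) = z \<bullet> i - a \<bullet> i - c \<bullet> i" if "i \<in> Basis" for i
      using ab'[OF that] z that by (auto simp: t_def mem_box inner_simps divide_le_eq intro!: divide_nonneg_nonneg)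
    define x where "x = (\<Sum>i\<in>Basis. (a \<bullet> i + t i * (b \<bullet> i - a \<bullet> i)) *\<^sub>R i)"
    have xi: "x \<bullet> i = a \<bullet> i + t i * (b \<bullet> i - a \<bullet> i)" if "i \<in> Basis" for i
      using that by (simp add: x_def inner_sum_left inner_Basis if_distrib sum.If_cases cong: if_cong)
    have "x \<in> cbox a b"
      unfolding mem_box
    proof
      fix i :: 'a assume i: "i \<in> Basis"
      have "t i * (b \<bullet> i - a \<bullet> i) \<le> 1 * (b \<bullet> i - a \<bullet> i)" "0 \<le> t i * (b \<bullet> i - a \<bullet> i)"
        using t[OF i] ab'[OF i] by (intro mult_right_mono mult_nonneg_nonneg; simp)+
      then show "a \<bullet> i \<le> x \<bullet> i \<and> x \<bullet> i \<le> b \<bullet> i" using xi[OF i] by simp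
    qed
    moreover have "z - x \<in> cbox c d"
      unfolding mem_box
    proof
      fix i :: 'a assume i: "i \<in> Basis"
      have "(z - x) \<bullet> i = c \<bullet> i + t i * (d \<bullet> i - c \<bullet> i)"
        using xi[OF i] t(3)[OF i] by (simp add: inner_simps algebra_simps)
      moreover have "t i * (d \<bullet> i - c \<bullet> i) \<le> 1 * (d \<bullet> i - c \<bullet> i)" "0 \<le> t i * (d \<bullet> i - c \<bullet> i)"
        using t[OF i] ab'[OF i] by (intro mult_right_mono mult_nonneg_nonneg; simp)+
      ultimately show "c \<bullet> i \<le> (z - x) \<bullet> i \<and> (z - x) \<bullet> i \<le> d \<bullet> i" by simp
    qed
    ultimately show "z \<in> cbox a b + cbox c d"
      by (metis add_diff_cancel_left' diff_add_cancel add.commute set_plus_intro)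
  qed
  have m: "measure lebesgue (cbox p q) = (\<Prod>i\<in>Basis. q \<bullet> i - p \<bullet> i)" if "\<And>i. i \<in> Basis \<Longrightarrow> p \<bullet> i < q \<bullet> i" for p q :: 'a
  proof -
    have "cbox p q \<noteq> {}" using that by (simp add: box_ne_empty less_imp_le)
    then show ?thesis by (simp add: content_cbox_if)
  qed
  have "(root DIM('a) (measure lebesgue (cbox a b)) + root DIM('a) (measure lebesgue (cbox c d))) ^ DIM('a)
    \<le> (\<Prod>i\<in>Basis. (b \<bullet> i - a \<bullet> i) + (d \<bullet> i - c \<bullet> i))"
    using ab' by (subst m; (subst m)?) (auto intro!: root_sum_prod_le)
  also have "\<dots> = measure lebesgue (cbox (a + c) (b + d))"
    using ab' by (subst m) (auto simp: inner_simps algebra_simps add_strict_mono intro!: prod.cong)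
  also have "\<dots> \<le> measure lebesgue (cbox a b + cbox c d)"
    using sub by (intro measure_mono_fmeasurable) (auto intro!: lmeasurable_compact compact_set_plus)
  finally show ?thesis .
qed


lemma set_plus_mono_subset:
  fixes A B C D :: "'a::plus set"
  assumes "A \<subseteq> C" "B \<subseteq> D"
  shows "A + B \<subseteq> C + D"
  using assms by (auto simp: set_plus_def)

text \<open>The cardinality of such a family is what the cuts reduce. Boxes with empty interior are
  excluded so that every member has positive volume.\<close>

definition box_family :: "'a::euclidean_space set set \<Rightarrow> bool" where
  "box_family D \<longleftrightarrow> finite D \<and> D \<noteq> {} \<and> (\<forall>k\<in>D. \<exists>a b. k = cbox a b \<and> box a b \<noteq> {}) \<and>
     pairwise (\<lambda>A B. interior A \<inter> interior B = {}) D"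

lemma box_family_compact: "box_family D \<Longrightarrow> compact (\<Union>D)"
  by (auto simp: box_family_def intro!: compact_Union)

lemma box_family_measure_ge:
  assumes "box_family D" "k \<in> D"
  shows "0 < measure lebesgue k" "measure lebesgue k \<le> measure lebesgue (\<Union>D)"
proof -
  obtain a b where k: "k = cbox a b" "box a b \<noteq> {}" using assms unfolding box_family_def by blast
  then show "0 < measure lebesgue k"
    by (simp add: content_pos_lt_eq box_ne_empty)
  show "measure lebesgue k \<le> measure lebesgue (\<Union>D)"
    using assms k lmeasurable_compact[OF box_family_compact[OF assms(1)]] 
    by (intro measure_mono_fmeasurable) auto
qed

text \<open>A cut may flatten a box on the wrong side of \<open>H\<close> to a null set. Dropping
  such boxes keeps the volume and the nondegeneracy, and it makes the family smaller. The price is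
  that the new union is only contained in \<open>\<Union>D \<inter> H\<close>, with the same
  volume.\<close>

lemma box_family_split:
  fixes D :: "'a::euclidean_space set set"
  assumes D: "box_family D" and H: "\<And>a b. \<exists>c d. cbox a b \<inter> H = cbox c d"
    and pos: "measure lebesgue (\<Union>D \<inter> H) > 0" and "H \<in> sets lebesgue"
  shows "\<exists>D'. box_family D' \<and> \<Union>D' \<subseteq> \<Union>D \<inter> H \<and> measure lebesgue (\<Union>D') = measure lebesgue (\<Union>D \<inter> H) \<and>
    card D' \<le> card D \<and> ((\<exists>k\<in>D. interior (k \<inter> H) = {}) \<longrightarrow> card D' < card D)"
proof -
  define G where "G = {k \<in> D. interior (k \<inter> H) \<noteq> {}}"
  define D' where "D' = (\<lambda>k. k \<inter> H) ` G"
  have fin: "finite D" and fG: "finite G" using D by (auto simp: box_family_def G_def)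
  have kH: "\<exists>c d. k \<inter> H = cbox c d" if "k \<in> D" for k
    using D H that by (auto simp: box_family_def)
  have lm: "k \<inter> H \<in> lmeasurable" if "k \<in> D" for k using kH[OF that] by auto
  have sub: "\<Union>D' \<subseteq> \<Union>D \<inter> H" by (auto simp: D'_def G_def)
  have null: "measure lebesgue (k \<inter> H) = 0" if k: "k \<in> D" "k \<notin> G" for k
  proof -
    obtain c d where "k \<inter> H = cbox c d" using kH[OF k(1)] by blast
    moreover have "interior (k \<inter> H) = {}" using k by (simp add: G_def)
    ultimately show ?thesis by (simp add: content_eq_0_interior del: interior_Int interior_cbox)
  qed
  have UD: "\<Union>D' \<in> lmeasurable"
    unfolding D'_def using fG lm by (intro fmeasurable.finite_Union) (auto simp: G_def)
  have *: "measure lebesgue (\<Union>D \<inter> H) \<le> measure lebesgue (\<Union>D')"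
  proof -
    have fD: "(\<Union>k\<in>D - G. k \<inter> H) \<in> lmeasurable"
      using fin lm by (intro fmeasurable.finite_Union) auto
    have "measure lebesgue (\<Union>k\<in>D - G. k \<inter> H) \<le> (\<Sum>k\<in>D - G. measure lebesgue (k \<inter> H))"
      using fin lm by (intro measure_UNION_le) auto
    also have "\<dots> = 0" using null by (intro sum.neutral) auto
    finally have z: "measure lebesgue (\<Union>k\<in>D - G. k \<inter> H) \<le> 0" .
    have "\<Union>D \<inter> H = \<Union>D' \<union> (\<Union>k\<in>D - G. k \<inter> H)" by (auto simp: D'_def G_def)
    then have "measure lebesgue (\<Union>D \<inter> H) \<le> measure lebesgue (\<Union>D') + measure lebesgue (\<Union>k\<in>D - G. k \<inter> H)"
      using measure_Un_le[of "\<Union>D'" lebesgue "\<Union>k\<in>D - G. k \<inter> H"] UD fD by auto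
    then show ?thesis using z by simp
  qed
  have UH: "\<Union>D \<inter> H \<in> lmeasurable"
    using lmeasurable_compact[OF box_family_compact[OF D]] assms(4) by (rule fmeasurable_Int_fmeasurable)
  have eq: "measure lebesgue (\<Union>D') = measure lebesgue (\<Union>D \<inter> H)"
    using * measure_mono_fmeasurable[OF sub _ UH] UD by (intro antisym) auto
  have "D' \<noteq> {}" using eq pos by auto
  moreover have "\<forall>k\<in>D'. \<exists>a b. k = cbox a b \<and> box a b \<noteq> {}"
  proof
    fix x assume "x \<in> D'"
    then obtain k where k: "k \<in> D" "interior (k \<inter> H) \<noteq> {}" "x = k \<inter> H" by (auto simp: D'_def G_def)
    then show "\<exists>a b. x = cbox a b \<and> box a b \<noteq> {}" using kH[OF k(1)] by (metis interior_cbox)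
  qed
  moreover have "pairwise (\<lambda>A B. interior A \<inter> interior B = {}) D'"
    unfolding pairwise_def
  proof (intro ballI impI)
    fix x y assume "x \<in> D'" "y \<in> D'" "x \<noteq> y"
    then obtain k l where kl: "k \<in> D" "l \<in> D" "x = k \<inter> H" "y = l \<inter> H" "k \<noteq> l" by (auto simp: D'_def G_def)
    then have "interior k \<inter> interior l = {}" using D by (auto simp: box_family_def pairwise_def)
    then show "interior x \<inter> interior y = {}" unfolding kl by auto
  qed
  ultimately have bf: "box_family D'" using fG by (auto simp: box_family_def D'_def)
  have c1: "card D' \<le> card G" unfolding D'_def by (rule card_image_le[OF fG])
  have c2: "card G \<le> card D" using fin by (intro card_mono) (auto simp: G_def)
  have c3: "card G < card D" if "\<exists>k\<in>D. interior (k \<inter> H) = {}"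
    using fin that by (intro psubset_card_mono) (auto simp: G_def)
  show ?thesis
    using bf sub eq le_trans[OF c1 c2] le_less_trans[OF c1 c3] by (intro exI[of _ D']) blast
qed

lemma cbox_Int_halfspace:
  fixes i :: "'a::euclidean_space"
  assumes "i \<in> Basis"
  shows "\<exists>c d. cbox a b \<inter> {x. x \<bullet> i \<le> s} = cbox c d" "\<exists>c d. cbox a b \<inter> {x. s \<le> x \<bullet> i} = cbox c d"
  using interval_split[OF assms, of a b s] by (auto simp: conj_commute Collect_conj_eq Int_commute)

definition BM_pair :: "'a::euclidean_space set \<Rightarrow> 'a set \<Rightarrow> bool" where
  "BM_pair A B \<longleftrightarrow> (root DIM('a) (measure lebesgue A) + root DIM('a) (measure lebesgue B)) ^ DIM('a)
     \<le> measure lebesgue (A + B)"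

lemma BM_pair_commute: "BM_pair A B \<longleftrightarrow> BM_pair B A"
  by (simp add: BM_pair_def add.commute)

lemma root_mult_sum_power:
  assumes "n > 0" "\<theta> \<ge> 0" "x \<ge> 0" "y \<ge> 0"
  shows "(root n (\<theta> * x) + root n (\<theta> * y)) ^ n = \<theta> * (root n x + root n y) ^ n"
  using assms by (simp add: real_root_mult flip: distrib_left) (simp add: power_mult_distrib)

text \<open>Hadwiger and Ohmann: cut the first set by a hyperplane that separates two of its boxes, and the
  second by a parallel hyperplane in the same volume ratio.\<close>

lemma BM_pair_box_family_step:
  fixes D1 D2 :: "'a::euclidean_space set set"
  assumes D1: "box_family D1" and D2: "box_family D2" and card: "card D1 \<ge> 2"
    and IH: "\<And>D1' D2' :: 'a set set. box_family D1' \<Longrightarrow> box_family D2' \<Longrightarrow>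
       card D1' + card D2' < card D1 + card D2 \<Longrightarrow> BM_pair (\<Union>D1') (\<Union>D2')"
  shows "BM_pair (\<Union>D1) (\<Union>D2)"
proof -
  have "\<exists>k\<in>D1. \<exists>l\<in>D1. k \<noteq> l" 
  proof (rule ccontr)
    assume "\<not> ?thesis"
    moreover have "finite D1" using D1 by (simp add: box_family_def)
    ultimately have "card D1 \<le> Suc 0" by (simp add: card_le_Suc0_iff_eq)
    then show False using card by simp
  qed
  then obtain k l where kl: "k \<in> D1" "l \<in> D1" "k \<noteq> l" by blast
  \<comment> \<open>Boxes with disjoint interiors have disjoint open sides in some coordinate. A
    hyperplane orthogonal to that axis then has one box on each side, so each half of the first
    family loses a box.\<close>
  have "\<exists>i\<in>Basis. \<exists>s. \<exists>k\<in>D1. \<exists>l\<in>D1. k \<subseteq> {x. x \<bullet> i \<le> s} \<and> l \<subseteq> {x. s \<le> x \<bullet> i}"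
  proof -
    obtain a b c d where k: "k = cbox a b" "box a b \<noteq> {}" and l: "l = cbox c d" "box c d \<noteq> {}"
      using kl D1 unfolding box_family_def by meson
    have "interior k \<inter> interior l = {}" using kl D1 by (auto simp: box_family_def pairwise_def)
    then have "box a b \<inter> box c d = {}" using k l by simp
    then obtain i where "i \<in> Basis" "b \<bullet> i \<le> a \<bullet> i \<or> d \<bullet> i \<le> c \<bullet> i \<or> b \<bullet> i \<le> c \<bullet> i \<or> d \<bullet> i \<le> a \<bullet> i"
      unfolding disjoint_interval by blast
    moreover have "a \<bullet> i < b \<bullet> i" "c \<bullet> i < d \<bullet> i" using calculation(1) k l by (auto simp: box_ne_empty)
    ultimately have i: "i \<in> Basis" "b \<bullet> i \<le> c \<bullet> i \<or> d \<bullet> i \<le> a \<bullet> i" by auto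
    then show ?thesis
    proof (elim disjE)
      assume "b \<bullet> i \<le> c \<bullet> i"
      then have "k \<subseteq> {x. x \<bullet> i \<le> b \<bullet> i} \<and> l \<subseteq> {x. b \<bullet> i \<le> x \<bullet> i}" using i unfolding k l 
        by (auto simp: mem_box intro: order_trans)
      then show ?thesis using i kl by blast
    next
      assume "d \<bullet> i \<le> a \<bullet> i"
      then have "l \<subseteq> {x. x \<bullet> i \<le> d \<bullet> i} \<and> k \<subseteq> {x. d \<bullet> i \<le> x \<bullet> i}" using i unfolding k l 
        by (auto simp: mem_box intro: order_trans)
      then show ?thesis using i kl by blast
    qed
  qed
  then obtain i s k l where i: "i \<in> Basis" and kl: "k \<in> D1" "l \<in> D1" 
    and ks: "k \<subseteq> {x. x \<bullet> i \<le> s}" and ls: "l \<subseteq> {x. s \<le> x \<bullet> i}" by blast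
  have i0: "i \<noteq> 0" using i nonzero_Basis by blast
  define A B where "A = \<Union>D1" and "B = \<Union>D2"
  define L R where "L = (\<lambda>s. {x::'a. x \<bullet> i \<le> s})" and "R = (\<lambda>s. {x::'a. s \<le> x \<bullet> i})"
  have [measurable]: "L s \<in> sets lebesgue" "R s \<in> sets lebesgue" for s
    unfolding L_def R_def by (auto intro!: lebesgue_closedin[of UNIV] closed_Collect_le continuous_intros)
  have cA: "compact A" and cB: "compact B" using D1 D2 by (auto simp: A_def B_def box_family_compact)
  note AB = lmeasurable_compact[OF cA] lmeasurable_compact[OF cB]
  have AI: "A \<inter> L s \<in> lmeasurable" "A \<inter> R s \<in> lmeasurable" "B \<inter> L s \<in> lmeasurable" "B \<inter> R s \<in> lmeasurable" for s
    using AB by (auto intro!: fmeasurable_Int_fmeasurable)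
  define \<alpha> \<beta> where "\<alpha> = measure lebesgue A" and "\<beta> = measure lebesgue B"
  have b0: "\<beta> > 0" 
  proof -
    obtain k where "k \<in> D2" using D2 by (auto simp: box_family_def)
    then show ?thesis using box_family_measure_ge[OF D2, of k] by (simp add: \<beta>_def B_def)
  qed
  have split: "measure lebesgue (S \<inter> L t) + measure lebesgue (S \<inter> R t) = measure lebesgue S"
    if "S \<in> lmeasurable" for S t
    unfolding L_def R_def by (rule measure_Int_halfspaces[OF that i0])
  have bfm: "k \<in> sets lebesgue" if "k \<in> D1" for k using D1 that by (auto simp: box_family_def)
  have aL: "measure lebesgue (A \<inter> L s) > 0"
  proof -
    have "measure lebesgue k \<le> measure lebesgue (A \<inter> L s)"
      using kl ks AI by (intro measure_mono_fmeasurable bfm) (auto simp: A_def L_def)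
    then show ?thesis using box_family_measure_ge[OF D1 kl(1)] by simp
  qed
  have aR: "measure lebesgue (A \<inter> R s) > 0"
  proof -
    have "measure lebesgue l \<le> measure lebesgue (A \<inter> R s)"
      using kl ls AI by (intro measure_mono_fmeasurable bfm) (auto simp: A_def R_def)
    then show ?thesis using box_family_measure_ge[OF D1 kl(2)] by simp
  qed
  define \<theta> where "\<theta> = measure lebesgue (A \<inter> L s) / \<alpha>"
  have a0: "\<alpha> > 0" using split[OF AB(1), of s] aL aR by (simp add: \<alpha>_def)
  have th: "measure lebesgue (A \<inter> L s) = \<theta> * \<alpha>" "measure lebesgue (A \<inter> R s) = (1 - \<theta>) * \<alpha>" "0 < \<theta>" "\<theta> < 1"
  proof -
    show 1: "measure lebesgue (A \<inter> L s) = \<theta> * \<alpha>" using a0 by (simp add: \<theta>_def)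
    show 2: "measure lebesgue (A \<inter> R s) = (1 - \<theta>) * \<alpha>"
      using split[OF AB(1), of s] 1 by (simp add: algebra_simps flip: \<alpha>_def)
    show "0 < \<theta>" "\<theta> < 1" using aL aR a0 unfolding 1 2 by (simp_all add: zero_less_mult_iff)
  qed
  obtain t where t: "measure lebesgue (B \<inter> L t) = \<theta> * \<beta>"
    using measure_halfspace_IVT[of B i "\<theta> * \<beta>"] AB cB i0 th b0
    by (auto simp: L_def compact_imp_bounded \<beta>_def)
  have t': "measure lebesgue (B \<inter> R t) = (1 - \<theta>) * \<beta>"
    using split[OF AB(2), of t] t by (simp add: \<beta>_def algebra_simps)
  have int_e: "interior (k \<inter> R s) = {}" "interior (l \<inter> L s) = {}"
  proof -
    have "negligible {x. x \<bullet> i = s}" using negligible_hyperplane[of i s] i0 by (simp add: inner_commute)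
    moreover have "k \<inter> R s \<subseteq> {x. x \<bullet> i = s}" "l \<inter> L s \<subseteq> {x. x \<bullet> i = s}"
      using ks ls by (auto simp: L_def R_def intro: antisym)
    then have "interior (k \<inter> R s) \<subseteq> {x. x \<bullet> i = s}" "interior (l \<inter> L s) \<subseteq> {x. x \<bullet> i = s}"
      using interior_subset by (meson subset_trans)+
    ultimately show "interior (k \<inter> R s) = {}" "interior (l \<inter> L s) = {}"
      by (meson negligible_subset open_not_negligible open_interior)+
  qed
  have HL: "\<exists>c d. cbox a b \<inter> L s = cbox c d" and HR: "\<exists>c d. cbox a b \<inter> R s = cbox c d" for a b s
    unfolding L_def R_def using cbox_Int_halfspace[OF i] by blast+
  have pL: "measure lebesgue (B \<inter> L t) > 0" "measure lebesgue (B \<inter> R t) > 0" using t t' th b0 by auto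
  have Lm: "L s \<in> sets lebesgue" "R s \<in> sets lebesgue" for s by measurable
  have eL: "\<exists>k\<in>D1. interior (k \<inter> L s) = {}" and eR: "\<exists>k\<in>D1. interior (k \<inter> R s) = {}"
    using kl int_e by blast+
  obtain D1L where D1L: "box_family D1L" "\<Union>D1L \<subseteq> A \<inter> L s" "measure lebesgue (\<Union>D1L) = \<theta> * \<alpha>" "card D1L < card D1"
    using box_family_split[OF D1 HL aL[unfolded A_def] Lm(1)] eL unfolding A_def[symmetric] th(1) by blast
  obtain D1R where D1R: "box_family D1R" "\<Union>D1R \<subseteq> A \<inter> R s" "measure lebesgue (\<Union>D1R) = (1 - \<theta>) * \<alpha>" "card D1R < card D1"
    using box_family_split[OF D1 HR aR[unfolded A_def] Lm(2)] eR unfolding A_def[symmetric] th(2) by blast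
  obtain D2L where D2L: "box_family D2L" "\<Union>D2L \<subseteq> B \<inter> L t" "measure lebesgue (\<Union>D2L) = \<theta> * \<beta>" "card D2L \<le> card D2"
    using box_family_split[OF D2 HL pL(1)[unfolded B_def] Lm(1)] unfolding B_def[symmetric] t by blast
  obtain D2R where D2R: "box_family D2R" "\<Union>D2R \<subseteq> B \<inter> R t" "measure lebesgue (\<Union>D2R) = (1 - \<theta>) * \<beta>" "card D2R \<le> card D2"
    using box_family_split[OF D2 HR pL(2)[unfolded B_def] Lm(2)] unfolding B_def[symmetric] t' by blast
  define c where "c = (root DIM('a) \<alpha> + root DIM('a) \<beta>) ^ DIM('a)"
  have ABm: "A + B \<in> lmeasurable" using cA cB by (intro lmeasurable_compact compact_set_plus)
  have ABI: "(A + B) \<inter> L (s + t) \<in> lmeasurable" "(A + B) \<inter> R (s + t) \<in> lmeasurable"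
    using ABm by (auto intro!: fmeasurable_Int_fmeasurable)
  have "\<theta> * c = (root DIM('a) (\<theta> * \<alpha>) + root DIM('a) (\<theta> * \<beta>)) ^ DIM('a)"
    using th a0 b0 by (simp add: c_def root_mult_sum_power)
  also have "\<dots> \<le> measure lebesgue (\<Union>D1L + \<Union>D2L)"
    using IH[OF D1L(1) D2L(1)] D1L(3,4) D2L(3,4) by (simp add: BM_pair_def)
  also have "\<dots> \<le> measure lebesgue ((A + B) \<inter> L (s + t))"
  proof (rule measure_mono_fmeasurable[OF _ _ ABI(1)])
    show "\<Union>D1L + \<Union>D2L \<subseteq> (A + B) \<inter> L (s + t)"
    proof (rule subset_trans[OF set_plus_mono_subset[OF D1L(2) D2L(2)]], rule subsetI)
      fix z assume "z \<in> A \<inter> L s + B \<inter> L t"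
      then obtain x y where "z = x + y" "x \<in> A" "y \<in> B" "x \<in> L s" "y \<in> L t" by (auto simp: set_plus_def)
      then show "z \<in> (A + B) \<inter> L (s + t)" by (auto simp: L_def inner_add_left intro: add_mono)
    qed
    show "\<Union>D1L + \<Union>D2L \<in> sets lebesgue"
      using D1L(1) D2L(1) by (intro fmeasurableD lmeasurable_compact compact_set_plus box_family_compact)
  qed
  finally have 1: "\<theta> * c \<le> measure lebesgue ((A + B) \<inter> L (s + t))" .
  have "(1 - \<theta>) * c = (root DIM('a) ((1 - \<theta>) * \<alpha>) + root DIM('a) ((1 - \<theta>) * \<beta>)) ^ DIM('a)"
    using th a0 b0 by (simp add: c_def root_mult_sum_power)
  also have "\<dots> \<le> measure lebesgue (\<Union>D1R + \<Union>D2R)"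
    using IH[OF D1R(1) D2R(1)] D1R(3,4) D2R(3,4) by (simp add: BM_pair_def)
  also have "\<dots> \<le> measure lebesgue ((A + B) \<inter> R (s + t))"
  proof (rule measure_mono_fmeasurable[OF _ _ ABI(2)])
    show "\<Union>D1R + \<Union>D2R \<subseteq> (A + B) \<inter> R (s + t)"
    proof (rule subset_trans[OF set_plus_mono_subset[OF D1R(2) D2R(2)]], rule subsetI)
      fix z assume "z \<in> A \<inter> R s + B \<inter> R t"
      then obtain x y where "z = x + y" "x \<in> A" "y \<in> B" "x \<in> R s" "y \<in> R t" by (auto simp: set_plus_def)
      then show "z \<in> (A + B) \<inter> R (s + t)" by (auto simp: R_def inner_add_left intro: add_mono)
    qed
    show "\<Union>D1R + \<Union>D2R \<in> sets lebesgue"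
      using D1R(1) D2R(1) by (intro fmeasurableD lmeasurable_compact compact_set_plus box_family_compact)
  qed
  finally have 2: "(1 - \<theta>) * c \<le> measure lebesgue ((A + B) \<inter> R (s + t))" .
  \<comment> \<open>The sums of the lower and of the upper halves lie on opposite sides of the
    hyperplane at height \<open>s + t\<close>, so their volumes add up inside
    \<open>A + B\<close>.\<close>
  have "c = \<theta> * c + (1 - \<theta>) * c" by (simp add: algebra_simps)
  also have "\<dots> \<le> measure lebesgue (A + B)" using 1 2 split[OF ABm, of "s + t"] by simp
  finally show ?thesis unfolding BM_pair_def c_def \<alpha>_def \<beta>_def A_def B_def .
qed

text \<open>Induction on the total number of boxes. The cutting step splits the first family,
  symmetry covers the second, and a pair of single boxes is the base case.\<close>

lemma BM_pair_box_family:
  fixes D1 D2 :: "'a::euclidean_space set set"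
  assumes "box_family D1" "box_family D2"
  shows "BM_pair (\<Union>D1) (\<Union>D2)"
  using assms
proof (induction "card D1 + card D2" arbitrary: D1 D2 rule: less_induct)
  case less
  consider "card D1 \<ge> 2" | "card D2 \<ge> 2" | "card D1 < 2" "card D2 < 2" by linarith
  then show ?case
  proof cases
    case 1
    show ?thesis by (rule BM_pair_box_family_step[OF less(2,3) 1]) (rule less(1))
  next
    case 2
    have "BM_pair (\<Union>D2) (\<Union>D1)"
    proof (rule BM_pair_box_family_step[OF less(3,2) 2])
      fix D1' D2' :: "'a set set" assume "box_family D1'" "box_family D2'" "card D1' + card D2' < card D2 + card D1"
      then show "BM_pair (\<Union>D1') (\<Union>D2')" by (intro less(1)) simp_all
    qed
    then show ?thesis by (simp add: BM_pair_commute)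
  next
    case 3
    have "finite D1" "finite D2" "D1 \<noteq> {}" "D2 \<noteq> {}" using less(2,3) unfolding box_family_def by blast+
    then have "card D1 \<noteq> 0" "card D2 \<noteq> 0" by simp_all
    then have "card D1 = 1" "card D2 = 1" using 3 by linarith+
    then obtain k l where kl: "D1 = {k}" "D2 = {l}" by (metis card_1_singletonE)
    obtain a b where ab: "k = cbox a b" "box a b \<noteq> {}" using less(2) unfolding kl box_family_def by blast
    obtain c d where cd: "l = cbox c d" "box c d \<noteq> {}" using less(3) unfolding kl box_family_def by blast
    from Brunn_Minkowski_cbox[OF ab(2) cd(2)] show ?thesis unfolding kl ab cd BM_pair_def by simp
  qed
qed

lemma box_family_approximation:
  fixes S :: "'a::euclidean_space set"
  assumes S: "open S" "bounded S" "S \<noteq> {}"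
  obtains D where "\<And>n::nat. box_family (D n)" "\<And>n. \<Union>(D n) \<subseteq> S"
    "(\<lambda>n. measure lebesgue (\<Union>(D n))) \<longlonglongrightarrow> measure lebesgue S"
proof -
  obtain a b where ab: "S \<subseteq> cbox a b" "box a b \<noteq> {}"
  proof -
    obtain a where a: "S \<subseteq> box (-a) a" using bounded_subset_box_symmetric[OF S(2)] by blast
    then show thesis using that[of "-a" a] S(3) box_subset_cbox by blast
  qed
  \<comment> \<open>The gauge returns \<open>S\<close> itself at points of \<open>S\<close>; every
    box of the covering contains such a point and therefore stays inside \<open>S\<close>.\<close>
  define g where "g = (\<lambda>x. if x \<in> S then S else UNIV)"
  have "gauge g" using S by (auto simp: gauge_def g_def)
  then obtain \<D> where \<D>: "countable \<D>" "\<And>K. K \<in> \<D> \<Longrightarrow> interior K \<noteq> {} \<and> (\<exists>c d. K = cbox c d)"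
    "pairwise (\<lambda>A B. interior A \<inter> interior B = {}) \<D>" "\<And>K. K \<in> \<D> \<Longrightarrow> \<exists>x \<in> S \<inter> K. K \<subseteq> g x" "S \<subseteq> \<Union>\<D>"
    by (rule covering_lemma[OF ab]) blast
  have US: "\<Union>\<D> = S"
  proof
    show "\<Union>\<D> \<subseteq> S" using \<D>(4) by (fastforce simp: g_def)
  qed (rule \<D>(5))
  have ne: "\<D> \<noteq> {}" using US S by auto
  define D where "D = (\<lambda>n. from_nat_into \<D> ` {..n::nat})"
  have sub: "D n \<subseteq> \<D>" for n using from_nat_into[OF ne] by (auto simp: D_def)
  have bf: "box_family (D n)" for n
    unfolding box_family_def
  proof (intro conjI ballI)
    show "\<exists>a b. k = cbox a b \<and> box a b \<noteq> {}" if "k \<in> D n" for k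
    proof -
      have "k \<in> \<D>" using sub that by blast
      from \<D>(2)[OF this] obtain c d where "interior k \<noteq> {}" "k = cbox c d" by blast
      then show ?thesis by (metis interior_cbox)
    qed
    show "pairwise (\<lambda>A B. interior A \<inter> interior B = {}) (D n)" using \<D>(3) sub by (rule pairwise_subset)
    show "finite (D n)" "D n \<noteq> {}" by (simp_all add: D_def)
  qed
  have lim: "(\<lambda>n. measure lebesgue (\<Union>(D n))) \<longlonglongrightarrow> measure lebesgue (\<Union>n. \<Union>(D n))"
  proof (rule Lim_measure_incseq)
    show "range (\<lambda>n. \<Union>(D n)) \<subseteq> sets lebesgue"
      using lmeasurable_compact[OF box_family_compact[OF bf]] by auto
    show "incseq (\<lambda>n. \<Union>(D n))" by (fastforce simp: incseq_def D_def)
    have "(\<Union>n. \<Union>(D n)) \<subseteq> S" using sub US by blast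
    then have "emeasure lebesgue (\<Union>n. \<Union>(D n)) \<le> emeasure lebesgue S"
      using S by (intro emeasure_mono) auto
    also have "\<dots> < \<infinity>" using lmeasurable_open[OF S(2,1)] unfolding fmeasurable_def by (simp only: mem_Collect_eq infinity_ennreal_def)
    finally show "emeasure lebesgue (\<Union>n. \<Union>(D n)) \<noteq> \<infinity>" by simp
  qed
  have "(\<Union>n. \<Union>(D n)) = S"
  proof
    show "S \<subseteq> (\<Union>n. \<Union>(D n))"
    proof
      fix x assume "x \<in> S"
      then obtain k where k: "k \<in> \<D>" "x \<in> k" using US by blast
      obtain n where "k = from_nat_into \<D> n" using from_nat_into_surj[OF \<D>(1) k(1)] by metis
      then show "x \<in> (\<Union>n. \<Union>(D n))" using k by (auto simp: D_def)
    qed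
  qed (use sub US in blast)
  with lim have "(\<lambda>n. measure lebesgue (\<Union>(D n))) \<longlonglongrightarrow> measure lebesgue S" by simp
  moreover have "\<Union>(D n) \<subseteq> S" for n using sub US by blast
  ultimately show thesis using that bf by blast
qed

text \<open>The frontier of a convex set is null, so the interiors carry the full volume and can be
  exhausted by box families from inside. A body with empty interior has volume zero, and then it is
  enough that the sum contains a translate of the other body.\<close>

theorem Brunn_Minkowski:
  fixes A B :: "'a::euclidean_space set"
  assumes A: "compact A" "convex A" "A \<noteq> {}" and B: "compact B" "convex B" "B \<noteq> {}"
  shows "(root DIM('a) (measure lebesgue A) + root DIM('a) (measure lebesgue B)) ^ DIM('a)
     \<le> measure lebesgue (A + B)"
proof -
  have lm: "A + B \<in> lmeasurable" using A B by (intro lmeasurable_compact compact_set_plus)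
  have mi: "measure lebesgue (interior S) = measure lebesgue S" if "compact S" "convex S" for S :: "'a set"
    using that by (intro measure_interior) (auto simp: compact_imp_bounded negligible_convex_frontier)
  have triv: "measure lebesgue T \<le> measure lebesgue (S + T)" if "S \<noteq> {}" "compact S" "compact T" for S T :: "'a set"
  proof -
    obtain a where "a \<in> S" using \<open>S \<noteq> {}\<close> by blast
    then have "(+) a ` T \<subseteq> S + T" by (auto simp: set_plus_def)
    moreover have "(+) a ` T \<in> sets lebesgue" 
      using that by (intro fmeasurableD lmeasurable_compact compact_translation)
    ultimately have "measure lebesgue ((+) a ` T) \<le> measure lebesgue (S + T)"
      using that by (intro measure_mono_fmeasurable) (auto intro!: lmeasurable_compact compact_set_plus)
    then show ?thesis by (simp add: measure_translation)
  qed
  consider "interior A = {}" | "interior B = {}" | "interior A \<noteq> {}" "interior B \<noteq> {}" by blast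
  then show ?thesis
  proof cases
    case 1
    then have "measure lebesgue A = 0" using mi[OF A(1,2)] by simp
    then show ?thesis using triv[of A B] A B by simp
  next
    case 2
    then have "measure lebesgue B = 0" using mi[OF B(1,2)] by simp
    then show ?thesis using triv[of B A] A B by (simp add: add.commute)
  next
    case 3
    obtain D where D: "\<And>n::nat. box_family (D n)" "\<And>n. \<Union>(D n) \<subseteq> interior A"
      "(\<lambda>n. measure lebesgue (\<Union>(D n))) \<longlonglongrightarrow> measure lebesgue (interior A)"
      using box_family_approximation[of "interior A"] 3 A bounded_interior compact_imp_bounded by blast
    obtain E where E: "\<And>n::nat. box_family (E n)" "\<And>n. \<Union>(E n) \<subseteq> interior B"
      "(\<lambda>n. measure lebesgue (\<Union>(E n))) \<longlonglongrightarrow> measure lebesgue (interior B)"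
      using box_family_approximation[of "interior B"] 3 B bounded_interior compact_imp_bounded by blast
    have "(\<lambda>n. (root DIM('a) (measure lebesgue (\<Union>(D n))) + root DIM('a) (measure lebesgue (\<Union>(E n)))) ^ DIM('a))
       \<longlonglongrightarrow> (root DIM('a) (measure lebesgue (interior A)) + root DIM('a) (measure lebesgue (interior B))) ^ DIM('a)"
      by (intro tendsto_intros D E)
    moreover have "(root DIM('a) (measure lebesgue (\<Union>(D n))) + root DIM('a) (measure lebesgue (\<Union>(E n)))) ^ DIM('a)
      \<le> measure lebesgue (A + B)" for n
    proof -
      have "(root DIM('a) (measure lebesgue (\<Union>(D n))) + root DIM('a) (measure lebesgue (\<Union>(E n)))) ^ DIM('a)
        \<le> measure lebesgue (\<Union>(D n) + \<Union>(E n))"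
        using BM_pair_box_family[OF D(1) E(1)] by (simp add: BM_pair_def)
      also have "\<dots> \<le> measure lebesgue (A + B)"
        using D(2)[of n] E(2)[of n] interior_subset[of A] interior_subset[of B]
        by (intro measure_mono_fmeasurable[OF _ _ lm] set_plus_mono_subset fmeasurableD lmeasurable_compact
             compact_set_plus box_family_compact D E) auto
      finally show ?thesis .
    qed
    ultimately have "(root DIM('a) (measure lebesgue (interior A)) + root DIM('a) (measure lebesgue (interior B))) ^ DIM('a)
      \<le> measure lebesgue (A + B)" by (intro LIMSEQ_le_const2) auto
    then show ?thesis using mi A B by simp
  qed
qed

section \<open>The equality case\<close>

lemma convex_body_interior_nonempty:
  fixes K :: "'a::euclidean_space set"
  assumes "compact K" "convex K" "measure lebesgue K > 0"
  shows "interior K \<noteq> {}"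
proof
  assume "interior K = {}"
  then have "measure lebesgue K = 0"
    using measure_interior[of K] assms by (simp add: compact_imp_bounded negligible_convex_frontier)
  with assms show False by simp
qed

lemma lmeasurable_Int_halfspace:
  fixes S :: "'a::euclidean_space set"
  assumes "S \<in> lmeasurable"
  shows "S \<inter> {x. x \<bullet> u \<le> s} \<in> lmeasurable" "S \<inter> {x. s \<le> x \<bullet> u} \<in> lmeasurable"
proof -
  have "closed {x. x \<bullet> u \<le> s}" "closed {x. s \<le> x \<bullet> u}"
    by (intro closed_Collect_le continuous_intros)+
  then show "S \<inter> {x. x \<bullet> u \<le> s} \<in> lmeasurable" "S \<inter> {x. s \<le> x \<bullet> u} \<in> lmeasurable"
    by (simp_all add: fmeasurable_Int_fmeasurable[OF assms] lborelD borel_closed)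
qed

lemma measure_halfspace_mono:
  fixes S :: "'a::euclidean_space set"
  assumes "S \<in> lmeasurable" "s \<le> t"
  shows "measure lebesgue (S \<inter> {x. x \<bullet> u \<le> s}) \<le> measure lebesgue (S \<inter> {x. x \<bullet> u \<le> t})"
  using assms by (intro measure_mono_fmeasurable lmeasurable_Int_halfspace fmeasurableD) auto

lemma measure_halfspace_le:
  fixes S :: "'a::euclidean_space set"
  assumes "S \<in> lmeasurable"
  shows "measure lebesgue (S \<inter> {x. x \<bullet> u \<le> s}) \<le> measure lebesgue S"
  using assms by (intro measure_mono_fmeasurable lmeasurable_Int_halfspace fmeasurableD) auto

text \<open>The part of the interior strictly between the two hyperplanes is open, and it is null
  because raising the cut gains no volume.\<close>

lemma interior_slab_empty:
  fixes M :: "'a::euclidean_space set"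
  assumes M: "M \<in> lmeasurable" and "s \<le> t"
    and eq: "measure lebesgue (M \<inter> {x. x \<bullet> u \<le> t}) \<le> measure lebesgue (M \<inter> {x. x \<bullet> u \<le> s})"
  shows "interior M \<inter> {x. s < x \<bullet> u} \<inter> {x. x \<bullet> u < t} = {}"
proof -
  let ?T = "interior M \<inter> {x. s < x \<bullet> u} \<inter> {x. x \<bullet> u < t}"
  have op: "open ?T" by (intro open_Int open_interior open_Collect_less continuous_intros)
  note lm = lmeasurable_Int_halfspace(1)[OF M]
  have sub: "?T \<subseteq> (M \<inter> {x. x \<bullet> u \<le> t}) - (M \<inter> {x. x \<bullet> u \<le> s})"
    using interior_subset[of M] by auto
  have "measure lebesgue ((M \<inter> {x. x \<bullet> u \<le> t}) - (M \<inter> {x. x \<bullet> u \<le> s})) =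
     measure lebesgue (M \<inter> {x. x \<bullet> u \<le> t}) - measure lebesgue (M \<inter> {x. x \<bullet> u \<le> s})"
    using \<open>s \<le> t\<close> by (intro measurable_measure_Diff lm fmeasurableD) auto
  also have "\<dots> \<le> 0" using eq by simp
  finally have "measure lebesgue ((M \<inter> {x. x \<bullet> u \<le> t}) - (M \<inter> {x. x \<bullet> u \<le> s})) = 0"
    by (simp add: antisym)
  then have "negligible ((M \<inter> {x. x \<bullet> u \<le> t}) - (M \<inter> {x. x \<bullet> u \<le> s}))"
    using lm by (subst negligible_iff_measure) (auto intro!: fmeasurable.Diff)
  then have "negligible ?T" using sub negligible_subset by blast
  then show ?thesis using op open_not_negligible by blast
qed

lemma measure_halfspace_eq_imp_subset:
  fixes M :: "'a::euclidean_space set"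
  assumes M: "compact M" "convex M" "measure lebesgue M > 0"
    and eq: "measure lebesgue M \<le> measure lebesgue (M \<inter> {x. x \<bullet> u \<le> s})"
  shows "M \<subseteq> {x. x \<bullet> u \<le> s}"
proof -
  have lm: "M \<in> lmeasurable" using M by (simp add: lmeasurable_compact)
  have "interior M \<subseteq> {x. x \<bullet> u \<le> s}"
  proof
    fix x assume x: "x \<in> interior M"
    show "x \<in> {x. x \<bullet> u \<le> s}"
    proof (rule ccontr)
      assume n: "\<not> ?thesis"
      have "measure lebesgue (M \<inter> {y. y \<bullet> u \<le> x \<bullet> u + 1}) \<le> measure lebesgue (M \<inter> {y. y \<bullet> u \<le> s})"
        using measure_halfspace_le[OF lm, of u "x \<bullet> u + 1"] eq by simp
      from interior_slab_empty[OF lm _ this] n 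
      have "interior M \<inter> {y. s < y \<bullet> u} \<inter> {y. y \<bullet> u < x \<bullet> u + 1} = {}" by simp
      moreover have "x \<in> interior M \<inter> {y. s < y \<bullet> u} \<inter> {y. y \<bullet> u < x \<bullet> u + 1}" using n x by simp
      ultimately show False by blast
    qed
  qed
  then have "closure (interior M) \<subseteq> {x. x \<bullet> u \<le> s}"
    by (intro closure_minimal closed_Collect_le continuous_intros)
  then show ?thesis
    using convex_closure_interior[OF M(2) convex_body_interior_nonempty[OF M]] closure_subset by blast
qed

text \<open>If the cut at \<open>t\<close> gained nothing, the open slab would miss the connected
  interior, which would then lie entirely on one side. Below \<open>s\<close> this contradicts
  \<open>lt\<close>, above \<open>t\<close> it contradicts \<open>pos\<close>.\<close>

lemma measure_halfspace_strict_mono: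
  fixes M :: "'a::euclidean_space set"
  assumes M: "compact M" "convex M" and u: "u \<noteq> 0" and st: "s < t"
    and pos: "measure lebesgue (M \<inter> {x. x \<bullet> u \<le> t}) > 0"
    and lt: "measure lebesgue (M \<inter> {x. x \<bullet> u \<le> s}) < measure lebesgue M"
  shows "measure lebesgue (M \<inter> {x. x \<bullet> u \<le> s}) < measure lebesgue (M \<inter> {x. x \<bullet> u \<le> t})"
proof (rule ccontr)
  assume "\<not> ?thesis"
  then have le: "measure lebesgue (M \<inter> {x. x \<bullet> u \<le> t}) \<le> measure lebesgue (M \<inter> {x. x \<bullet> u \<le> s})" by simp
  have lm: "M \<in> lmeasurable" using M by (simp add: lmeasurable_compact)
  have M0: "measure lebesgue M > 0" using pos measure_halfspace_le[OF lm, of u t] by simp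
  note cl = convex_closure_interior[OF M(2) convex_body_interior_nonempty[OF M M0]]
  note e = interior_slab_empty[OF lm less_imp_le[OF st] le]
  consider "interior M \<subseteq> {x. x \<bullet> u \<le> s}" | "interior M \<subseteq> {x. t \<le> x \<bullet> u}"
  proof -
    have "interior M \<subseteq> {x. x \<bullet> u \<le> s} \<or> interior M \<subseteq> {x. t \<le> x \<bullet> u}"
    proof (rule ccontr)
      assume "\<not> ?thesis"
      then obtain x y where x: "x \<in> interior M" "s < x \<bullet> u" and y: "y \<in> interior M" "y \<bullet> u < t" by (auto simp: subset_iff not_le)
      have "x \<bullet> u < t \<Longrightarrow> x \<in> interior M \<inter> {x. s < x \<bullet> u} \<inter> {x. x \<bullet> u < t}"
        "s < y \<bullet> u \<Longrightarrow> y \<in> interior M \<inter> {x. s < x \<bullet> u} \<inter> {x. x \<bullet> u < t}" using x y by simp_all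
      then have x': "t \<le> x \<bullet> u" and y': "y \<bullet> u \<le> s" unfolding e by force+
      have "connected (interior M)" using M(2) by (simp add: convex_connected)
      then have "\<exists>z\<in>interior M. u \<bullet> z = (s + t) / 2"
        using connected_ivt_hyperplane[of "interior M" y x u "(s + t) / 2"] x y x' y' st by (simp add: inner_commute[of _ u])
      then obtain z where "z \<in> interior M" "u \<bullet> z = (s + t) / 2" by blast
      then have "z \<in> interior M \<inter> {x. s < x \<bullet> u} \<inter> {x. x \<bullet> u < t}" using st by (simp add: inner_commute[of z])
      then show False using e by blast
    qed
    then show ?thesis using that by blast
  qed
  then show False
  proof cases
    case 1
    then have "closure (interior M) \<subseteq> {x. x \<bullet> u \<le> s}"
      by (intro closure_minimal closed_Collect_le continuous_intros)
    then have "M \<subseteq> {x. x \<bullet> u \<le> s}" using cl closure_subset[of M] by (simp only: subset_trans)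
    then have "M \<inter> {x. x \<bullet> u \<le> s} = M" by blast
    then show False using lt by simp
  next
    case 2
    then have "closure (interior M) \<subseteq> {x. t \<le> x \<bullet> u}"
      by (intro closure_minimal closed_Collect_le continuous_intros)
    then have "M \<subseteq> {x. t \<le> x \<bullet> u}" using cl closure_subset[of M] by (simp only: subset_trans)
    then have "M \<inter> {x. x \<bullet> u \<le> t} \<subseteq> {x. u \<bullet> x = t}" by (auto simp: inner_commute[of u] intro: antisym)
    moreover have "negligible {x. u \<bullet> x = t}" using negligible_hyperplane u by blast
    ultimately have "measure lebesgue (M \<inter> {x. x \<bullet> u \<le> t}) = 0"
      using negligible_subset negligible_imp_measure0 by blast
    then show False using pos by simp
  qed
qed

section \<open>Volume quantiles of parallel cuts\<close>

lemma cut_volume_set_plus: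
  fixes K L :: "'a::euclidean_space set"
  assumes K: "compact K" "convex K" and L: "compact L" "convex L" and u: "u \<noteq> 0"
    and pK: "measure lebesgue (K \<inter> {x. x \<bullet> u \<le> s}) > 0" and pL: "measure lebesgue (L \<inter> {x. x \<bullet> u \<le> t}) > 0"
  shows "(root DIM('a) (measure lebesgue (K \<inter> {x. x \<bullet> u \<le> s})) +
     root DIM('a) (measure lebesgue (L \<inter> {x. x \<bullet> u \<le> t}))) ^ DIM('a) \<le>
     measure lebesgue ((K + L) \<inter> {x. x \<bullet> u \<le> s + t})"
proof -
  have c: "compact (S \<inter> {x. x \<bullet> u \<le> r})" "convex (S \<inter> {x. x \<bullet> u \<le> r})" if "compact S" "convex S" for S :: "'a set" and r
  proof -
    show "compact (S \<inter> {x. x \<bullet> u \<le> r})" using that by (intro compact_Int_closed closed_Collect_le continuous_intros)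
    show "convex (S \<inter> {x. x \<bullet> u \<le> r})" using that convex_halfspace_le[of u r] by (intro convex_Int) (simp_all add: inner_commute)
  qed
  have "K \<inter> {x. x \<bullet> u \<le> s} \<noteq> {}" "L \<inter> {x. x \<bullet> u \<le> t} \<noteq> {}" using pK pL by auto
  note Brunn_Minkowski[OF c[OF K] this(1) c[OF L] this(2)]
  also have "measure lebesgue ((K \<inter> {x. x \<bullet> u \<le> s}) + (L \<inter> {x. x \<bullet> u \<le> t})) \<le> measure lebesgue ((K + L) \<inter> {x. x \<bullet> u \<le> s + t})"
  proof (rule measure_mono_fmeasurable)
    show "(K \<inter> {x. x \<bullet> u \<le> s}) + (L \<inter> {x. x \<bullet> u \<le> t}) \<subseteq> (K + L) \<inter> {x. x \<bullet> u \<le> s + t}"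
      by (auto simp: set_plus_def inner_add_left intro: add_mono)
    show "(K \<inter> {x. x \<bullet> u \<le> s}) + (L \<inter> {x. x \<bullet> u \<le> t}) \<in> sets lebesgue"
      using c K L by (intro fmeasurableD lmeasurable_compact compact_set_plus)
    show "(K + L) \<inter> {x. x \<bullet> u \<le> s + t} \<in> lmeasurable"
      using K L by (intro lmeasurable_Int_halfspace lmeasurable_compact compact_set_plus)
  qed
  finally show ?thesis .
qed

text \<open>Cutting both bodies in the same volume ratio by parallel hyperplanes turns the equality case into
  the equality case for both pairs of pieces.\<close>

lemma cut_volume_set_plus_eq:
  fixes K L :: "'a::euclidean_space set"
  assumes K: "compact K" "convex K" and L: "compact L" "convex L" and u: "u \<noteq> 0"
    and v: "measure lebesgue K = v" "measure lebesgue L = v" and M: "measure lebesgue (K + L) = 2 ^ DIM('a) * v"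
    and y: "0 < y" "y < v" and s: "measure lebesgue (K \<inter> {x. x \<bullet> u \<le> s}) = y" and t: "measure lebesgue (L \<inter> {x. x \<bullet> u \<le> t}) = y"
  shows "measure lebesgue ((K + L) \<inter> {x. x \<bullet> u \<le> s + t}) = 2 ^ DIM('a) * y"
proof -
  have rt: "(root DIM('a) z + root DIM('a) z) ^ DIM('a) = 2 ^ DIM('a) * z" if "z > 0" for z
  proof -
    have "(root DIM('a) z + root DIM('a) z) ^ DIM('a) = (2 * root DIM('a) z) ^ DIM('a)" by simp
    also have "\<dots> = 2 ^ DIM('a) * z" using that by (simp add: power_mult_distrib)
    finally show ?thesis .
  qed
  have lm: "K \<in> lmeasurable" "L \<in> lmeasurable" "K + L \<in> lmeasurable"
    using K L by (auto intro!: lmeasurable_compact compact_set_plus)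
  have 1: "2 ^ DIM('a) * y \<le> measure lebesgue ((K + L) \<inter> {x. x \<bullet> u \<le> s + t})"
    using cut_volume_set_plus[OF K L u, of s t] s t y rt by simp
  have s': "measure lebesgue (K \<inter> {x. x \<bullet> (- u) \<le> - s}) = v - y"
    using measure_Int_halfspaces[OF lm(1) u, of s] s v by simp
  have t': "measure lebesgue (L \<inter> {x. x \<bullet> (- u) \<le> - t}) = v - y"
    using measure_Int_halfspaces[OF lm(2) u, of t] t v by simp
  have 2: "2 ^ DIM('a) * (v - y) \<le> measure lebesgue ((K + L) \<inter> {x. x \<bullet> (- u) \<le> - s + - t})"
    using cut_volume_set_plus[OF K L, of "- u" "- s" "- t"] s' t' y rt u by simp
  have eq: "{x. x \<bullet> (- u) \<le> - s + - t} = {x. s + t \<le> x \<bullet> u}" by auto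
  show ?thesis
    using 1 2 measure_Int_halfspaces[OF lm(3) u, of "s + t"] M unfolding eq by (simp add: algebra_simps)
qed

lemma quantile_exists:
  fixes K :: "'a::euclidean_space set"
  assumes K: "compact K" and u: "u \<noteq> 0" and y: "0 \<le> y" "y \<le> measure lebesgue K"
  shows "\<exists>s. measure lebesgue (K \<inter> {x. x \<bullet> u \<le> s}) = y"
  using measure_halfspace_IVT[OF lmeasurable_compact[OF K] compact_imp_bounded[OF K] u y] by metis

text \<open>\<open>k\<close> and \<open>l\<close> will be the quantile functions of two bodies in the same direction, as functions of
  the \<open>n\<close>-th root of the volume cut off; telescoping along a grid shows that \<open>k - l\<close> is constant.\<close>

lemma midpoint_quantile_increment_le:
  fixes k l :: "real \<Rightarrow> real"
  assumes mid: "\<And>p q. 0 < p \<Longrightarrow> p < w \<Longrightarrow> 0 < q \<Longrightarrow> q < w \<Longrightarrow>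
      k ((p + q) / 2) + l ((p + q) / 2) \<le> k p + l q"
    and mono: "\<And>p q. 0 < p \<Longrightarrow> p \<le> q \<Longrightarrow> q < w \<Longrightarrow> l p \<le> l q"
    and ab: "0 < a" "a < b" "b < b'" "b' < w"
  shows "k b - k a \<le> l b' - l a"
proof -
  \<comment> \<open>\<open>N\<close> makes the step \<open>h\<close> shorter than
    \<open>b' - b\<close>. Each increment of \<open>k\<close> is compared with the next increment of
    \<open>l\<close>, so the grid for \<open>l\<close> reaches one step past \<open>b\<close> and
    must still end before \<open>b'\<close>.\<close>
  obtain N :: nat where N: "real N > (b - a) / (b' - b)" using reals_Archimedean2 by blast
  define h where "h = (b - a) / N"
  have N0: "real N > 0" using N ab by (smt (verit) divide_nonneg_pos)
  have h: "0 < h" "h < b' - b" "real N * h = b - a"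
    using N N0 ab by (auto simp: h_def field_simps)
  have pb: "a + real (Suc (Suc j)) * h < b'" if "j < N" for j
  proof -
    have "real (Suc (Suc j)) * h \<le> (real N + 1) * h" using that h by (intro mult_right_mono) auto
    then show ?thesis using h by (simp add: algebra_simps)
  qed
  have step: "k (a + real (Suc j) * h) - k (a + real j * h) \<le> l (a + real (Suc (Suc j)) * h) - l (a + real (Suc j) * h)"
    if "j < N" for j
  proof -
    have e: "((a + real j * h) + (a + real (Suc (Suc j)) * h)) / 2 = a + real (Suc j) * h"
      by (simp add: field_simps)
    have "0 \<le> real j * h" using h by simp
    then have "k (a + real (Suc j) * h) + l (a + real (Suc j) * h) \<le> k (a + real j * h) + l (a + real (Suc (Suc j)) * h)"
    proof (intro mid[of "a + real j * h" "a + real (Suc (Suc j)) * h", unfolded e])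
      have "real j * h \<le> real (Suc (Suc j)) * h" using h by (intro mult_right_mono) auto
      then show "a + real j * h < w" "0 < a + real j * h" "0 < a + real (Suc (Suc j)) * h"
        "a + real (Suc (Suc j)) * h < w"
        using pb[OF that] ab \<open>0 \<le> real j * h\<close> by linarith+
    qed
    then show ?thesis by simp
  qed
  have "k b - k a = k (a + real N * h) - k (a + real 0 * h)" using h by simp
  also have "\<dots> = (\<Sum>j<N. k (a + real (Suc j) * h) - k (a + real j * h))"
    by (rule sum_lessThan_telescope[symmetric])
  also have "\<dots> \<le> (\<Sum>j<N. l (a + real (Suc (Suc j)) * h) - l (a + real (Suc j) * h))"
    using step by (intro sum_mono) auto
  also have "\<dots> = l (a + real (Suc N) * h) - l (a + real (Suc 0) * h)"
    by (rule sum_lessThan_telescope)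
  also have "\<dots> \<le> l b' - l a"
  proof (rule diff_mono)
    have e: "a + real (Suc N) * h = b + h" using h by (simp add: algebra_simps)
    show "l (a + real (Suc N) * h) \<le> l b'" unfolding e using ab h by (intro mono) auto
    have "1 * h \<le> real N * h" using N0 h by (intro mult_right_mono) auto
    then have "a + h \<le> b" using h by simp
    then show "l a \<le> l (a + real (Suc 0) * h)" using ab h by (intro mono) auto
  qed
  finally show ?thesis .
qed

text \<open>Cutting at the unequal volumes \<open>p ^ n\<close> and \<open>q ^ n\<close>, with n the
  dimension, Brunn--Minkowski puts at least \<open>(p + q) ^ n\<close> of the sum below
  \<open>s1 + t1\<close>. By the equality case for equal ratios exactly that volume lies below
  \<open>s + t\<close>, and strict monotonicity compares the two heights.\<close>

lemma cut_quantile_midpoint: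
  fixes K L :: "'a::euclidean_space set"
  assumes K: "compact K" "convex K" and L: "compact L" "convex L" and u: "u \<noteq> 0"
    and v: "measure lebesgue K = v" "measure lebesgue L = v" and M: "measure lebesgue (K + L) = 2 ^ DIM('a) * v"
    and p: "0 < p" "p ^ DIM('a) < v" and q: "0 < q" "q ^ DIM('a) < v"
    and s1: "measure lebesgue (K \<inter> {x. x \<bullet> u \<le> s1}) = p ^ DIM('a)"
    and t1: "measure lebesgue (L \<inter> {x. x \<bullet> u \<le> t1}) = q ^ DIM('a)"
    and s: "measure lebesgue (K \<inter> {x. x \<bullet> u \<le> s}) = ((p + q) / 2) ^ DIM('a)"
    and t: "measure lebesgue (L \<inter> {x. x \<bullet> u \<le> t}) = ((p + q) / 2) ^ DIM('a)"
  shows "s + t \<le> s1 + t1"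
proof (rule ccontr)
  assume "\<not> ?thesis"
  then have lt: "s1 + t1 < s + t" by simp
  define m where "m = (p + q) / 2"
  have m0: "m > 0" using p q by (simp add: m_def)
  have mv: "m ^ DIM('a) < v"
  proof -
    have "m \<le> max p q" by (simp add: m_def max_def)
    then have "m ^ DIM('a) \<le> max p q ^ DIM('a)" using m0 by (intro power_mono) auto
    then show ?thesis using p q by (auto simp: max_def split: if_splits)
  qed
  have eq: "measure lebesgue ((K + L) \<inter> {x. x \<bullet> u \<le> s + t}) = 2 ^ DIM('a) * m ^ DIM('a)"
    using s t mv m0 by (intro cut_volume_set_plus_eq[OF K L u v M]) (simp_all add: m_def)
  have "(p + q) ^ DIM('a) \<le> measure lebesgue ((K + L) \<inter> {x. x \<bullet> u \<le> s1 + t1})"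
    using cut_volume_set_plus[OF K L u, of s1 t1] s1 t1 p q by (simp add: real_root_power_cancel)
  moreover have "(p + q) ^ DIM('a) = 2 ^ DIM('a) * m ^ DIM('a)"
  proof -
    have "p + q = 2 * m" by (simp add: m_def)
    then show ?thesis by (simp only: power_mult_distrib)
  qed
  moreover have "measure lebesgue ((K + L) \<inter> {x. x \<bullet> u \<le> s1 + t1}) < measure lebesgue ((K + L) \<inter> {x. x \<bullet> u \<le> s + t})"
  proof (rule measure_halfspace_strict_mono[OF _ _ u lt])
    show KL: "compact (K + L)" using K L by (simp add: compact_set_plus)
    show "convex (K + L)" using K L by (simp add: convex_set_plus)
    show "0 < measure lebesgue ((K + L) \<inter> {x. x \<bullet> u \<le> s + t})" using eq m0 by simp
    have "measure lebesgue ((K + L) \<inter> {x. x \<bullet> u \<le> s1 + t1}) \<le> measure lebesgue ((K + L) \<inter> {x. x \<bullet> u \<le> s + t})"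
      using lt KL by (intro measure_halfspace_mono lmeasurable_compact) auto
    also have "\<dots> < measure lebesgue (K + L)" using eq mv by (simp add: M)
    finally show "measure lebesgue ((K + L) \<inter> {x. x \<bullet> u \<le> s1 + t1}) < measure lebesgue (K + L)" .
  qed
  ultimately show False using eq by simp
qed

text \<open>Just above the quantile \<open>f b\<close> the distribution function \<open>H\<close>
  already exceeds \<open>b ^ n\<close>, which leaves room for a slightly larger level
  \<open>b'\<close>. This absorbs the loss from \<open>b\<close> to \<open>b'\<close> in the grid
  estimate. \<open>H\<close> is abstract so that both bodies are covered.\<close>

lemma quantile_right_continuous:
  fixes H f :: "real \<Rightarrow> real"
  assumes n: "n > 0" and b: "0 < b" "b < w" and e: "e > 0" and wn: "w ^ n = v" and f: "\<And>p. 0 < p \<Longrightarrow> p < w \<Longrightarrow> H (f p) = p ^ n" 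
    and sH: "\<And>s t. s < t \<Longrightarrow> 0 < H t \<Longrightarrow> H s < v \<Longrightarrow> H s < H t" and mH: "\<And>s t. s \<le> t \<Longrightarrow> H s \<le> H t"
  shows "\<exists>b'>b. b' < w \<and> f b' \<le> f b + e"
proof -
  have Hb: "H (f b) = b ^ n" using f b by simp
  have b0: "0 < b ^ n" using b by simp
  have bv: "b ^ n < v" unfolding wn[symmetric] using b n by (intro power_strict_mono) auto
  have "H (f b) < H (f b + e)"
  proof (rule sH)
    show "0 < H (f b + e)" using b0 mH[of "f b" "f b + e"] e Hb by simp
  qed (use bv Hb e in simp_all)
  then have lt: "b ^ n < H (f b + e)" using Hb by simp
  then have H0: "0 < H (f b + e)" using b0 by linarith
  have "root n (b ^ n) < root n (H (f b + e))" using n lt by (rule real_root_less_mono)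
  then have "b < root n (H (f b + e))" using b n by (simp add: real_root_power_cancel)
  then have "b < min w (root n (H (f b + e)))" using b by simp
  from dense[OF this] obtain b' where b': "b < b'" "b' < w" "b' < root n (H (f b + e))" by auto
  have "b' ^ n < root n (H (f b + e)) ^ n" using b b' n by (intro power_strict_mono) auto
  also have "\<dots> = H (f b + e)" using n H0 by simp
  finally have "H (f b') < H (f b + e)" using f[of b'] b' b by simp
  then have "f b' \<le> f b + e" using mH[of "f b + e" "f b'"] by linarith
  then show ?thesis using b' by blast
qed

text \<open>The grid estimate holds with the two bodies in either order. Once \<open>b'\<close> is
  moved down to \<open>b\<close>, both quantile functions have the same increments and differ by a
  constant, and the quantiles determine the distribution functions.\<close>

lemma cut_volume_translate:
  fixes K L :: "'a::euclidean_space set"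
  assumes K: "compact K" "convex K" and L: "compact L" "convex L" and u: "u \<noteq> 0" and v0: "v > 0"
    and v: "measure lebesgue K = v" "measure lebesgue L = v" and M: "measure lebesgue (K + L) = 2 ^ DIM('a) * v"
  shows "\<exists>d. \<forall>s. measure lebesgue (K \<inter> {x. x \<bullet> u \<le> s + d}) = measure lebesgue (L \<inter> {x. x \<bullet> u \<le> s})"
proof -
  define n where "n = DIM('a)"
  define w where "w = root n v"
  have n: "n > 0" by (simp add: n_def)
  have w: "w > 0" "w ^ n = v" using v0 n by (simp_all add: w_def)
  have pw: "p ^ n < v" if "0 < p" "p < w" for p
    using that power_strict_mono[of p w n] w n by simp
  define F G where "F = (\<lambda>s. measure lebesgue (K \<inter> {x. x \<bullet> u \<le> s}))" and "G = (\<lambda>s. measure lebesgue (L \<inter> {x. x \<bullet> u \<le> s}))"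
  note lm = lmeasurable_compact[OF K(1)] lmeasurable_compact[OF L(1)]
  have mono: "F s \<le> F t" "G s \<le> G t" if "s \<le> t" for s t
    unfolding F_def G_def using that lm by (auto intro: measure_halfspace_mono)
  have bd: "0 \<le> F s" "F s \<le> v" "0 \<le> G s" "G s \<le> v" for s
    using measure_halfspace_le[OF lm(1), of u s] measure_halfspace_le[OF lm(2), of u s] v by (auto simp: F_def G_def)
  have smono: "F s < F t" if "s < t" "0 < F t" "F s < v" for s t
    using measure_halfspace_strict_mono[OF K u that(1)] that v by (simp add: F_def)
  have smonoG: "G s < G t" if "s < t" "0 < G t" "G s < v" for s t
    using measure_halfspace_strict_mono[OF L u that(1)] that v by (simp add: G_def)
  have "\<exists>k. \<forall>p. 0 < p \<and> p < w \<longrightarrow> F (k p) = p ^ n"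
  proof (intro choice allI)
    fix p show "\<exists>s. 0 < p \<and> p < w \<longrightarrow> F s = p ^ n"
      using quantile_exists[OF K(1) u, of "p ^ n"] pw[of p] v unfolding F_def by (auto simp: less_imp_le)
  qed
  then obtain k where k: "\<And>p. 0 < p \<Longrightarrow> p < w \<Longrightarrow> F (k p) = p ^ n" by blast
  have "\<exists>k. \<forall>p. 0 < p \<and> p < w \<longrightarrow> G (k p) = p ^ n"
  proof (intro choice allI)
    fix p show "\<exists>s. 0 < p \<and> p < w \<longrightarrow> G s = p ^ n"
      using quantile_exists[OF L(1) u, of "p ^ n"] pw[of p] v unfolding G_def by (auto simp: less_imp_le)
  qed
  then obtain l where l: "\<And>p. 0 < p \<Longrightarrow> p < w \<Longrightarrow> G (l p) = p ^ n" by blast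
  have kmono: "k p \<le> k q" if "0 < p" "p \<le> q" "q < w" for p q
  proof (rule ccontr)
    assume "\<not> ?thesis"
    then have "F (k q) < F (k p)" using that pw by (intro smono) (auto simp: k)
    then show False using that power_mono[of p q n] by (simp add: k)
  qed
  have lmono: "l p \<le> l q" if "0 < p" "p \<le> q" "q < w" for p q
  proof (rule ccontr)
    assume "\<not> ?thesis"
    then have "G (l q) < G (l p)" using that pw by (intro smonoG) (auto simp: l)
    then show False using that power_mono[of p q n] by (simp add: l)
  qed
  have mid: "k ((p + q) / 2) + l ((p + q) / 2) \<le> k p + l q" if "0 < p" "p < w" "0 < q" "q < w" for p q
    using that pw k l by (intro cut_quantile_midpoint[OF K L u v M, of p q]) (auto simp: F_def G_def n_def)
  have le: "k b - k a \<le> l b - l a" if ab: "0 < a" "a < b" "b < w" for a b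
  proof (rule field_le_epsilon)
    fix e :: real assume "e > 0"
    then obtain b' where b': "b < b'" "b' < w" "l b' \<le> l b + e"
      using quantile_right_continuous[where H=G and f=l, OF n _ ab(3) \<open>e > 0\<close> w(2) l smonoG mono(2)] ab(1,2) by auto
    have "k b - k a \<le> l b' - l a"
      by (rule midpoint_quantile_increment_le[where w=w and k=k and l=l, OF mid lmono ab(1,2) b'(1,2)])
    then show "k b - k a \<le> l b - l a + e" using b' by simp
  qed
  have ge: "l b - l a \<le> k b - k a" if ab: "0 < a" "a < b" "b < w" for a b
  proof (rule field_le_epsilon)
    fix e :: real assume "e > 0"
    then obtain b' where b': "b < b'" "b' < w" "k b' \<le> k b + e"
      using quantile_right_continuous[where H=F and f=k, OF n _ ab(3) \<open>e > 0\<close> w(2) k smono mono(1)] ab(1,2) by auto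
    have mid': "l ((p + q) / 2) + k ((p + q) / 2) \<le> l p + k q" if "0 < p" "p < w" "0 < q" "q < w" for p q
      using mid[of q p] that by (simp add: add.commute)
    have "l b - l a \<le> k b' - k a"
      by (rule midpoint_quantile_increment_le[where w=w and k=l and l=k, OF mid' kmono ab(1,2) b'(1,2)])
    then show "l b - l a \<le> k b - k a + e" using b' by simp
  qed
  \<comment> \<open>Any level strictly between 0 and \<open>w\<close> serves; the equations for
    \<open>k\<close> and \<open>l\<close> are available only there.\<close>
  define d where "d = k (w / 2) - l (w / 2)"
  have kl: "k p = l p + d" if "0 < p" "p < w" for p
  proof -
    have w2: "0 < w / 2" "w / 2 < w" using w by auto
    consider "p < w / 2" | "p = w / 2" | "w / 2 < p" by linarith
    then show ?thesis
    proof cases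
      case 1 then show ?thesis using le[of p "w / 2"] ge[of p "w / 2"] w2 that by (simp add: d_def)
    next
      case 2 then show ?thesis unfolding 2 d_def by simp
    next
      case 3 then show ?thesis using le[of "w / 2" p] ge[of "w / 2" p] w2 that by (simp add: d_def)
    qed
  qed
  \<comment> \<open>Provides a level strictly between two different values of the distribution
    functions, at which the quantile identity \<open>kl\<close> applies.\<close>
  have root_lt: "\<exists>p. 0 < p \<and> p < w \<and> x < p ^ n \<and> p ^ n < y" if xy: "0 \<le> x" "x < y" "y \<le> v" for x y
  proof -
    obtain z where z: "x < z" "z < y" using dense[OF xy(2)] by blast
    have "0 < z" using z xy by linarith
    then have "root n z ^ n = z" "0 < root n z" using n by simp_all
    moreover have "root n z < w" unfolding w_def using z xy n by (intro real_root_less_mono) linarith+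
    ultimately show ?thesis using z by (intro exI[of _ "root n z"]) simp
  qed
  have "F (s + d) = G s" for s
  proof (rule antisym)
    show "F (s + d) \<le> G s"
    proof (rule ccontr)
      assume "\<not> ?thesis"
      then obtain p where p: "0 < p" "p < w" "G s < p ^ n" "p ^ n < F (s + d)" 
        using root_lt[of "G s" "F (s + d)"] bd(3)[of s] bd(2)[of "s + d"] unfolding not_le by blast
      have "G s < G (l p)" "F (k p) < F (s + d)" using p k[OF p(1,2)] l[OF p(1,2)] by simp_all
      then have "s < l p" "k p < s + d" using mono(2)[of "l p" s] mono(1)[of "s + d" "k p"] by linarith+
      then show False using kl[OF p(1,2)] by simp
    qed
    show "G s \<le> F (s + d)"
    proof (rule ccontr)
      assume "\<not> ?thesis"
      then obtain p where p: "0 < p" "p < w" "F (s + d) < p ^ n" "p ^ n < G s" 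
        using root_lt[of "F (s + d)" "G s"] bd(1)[of "s + d"] bd(4)[of s] unfolding not_le by blast
      have "G (l p) < G s" "F (s + d) < F (k p)" using p k[OF p(1,2)] l[OF p(1,2)] by simp_all
      then have "l p < s" "s + d < k p" using mono(2)[of s "l p"] mono(1)[of "k p" "s + d"] by linarith+
      then show False using kl[OF p(1,2)] by simp
    qed
  qed
  then show ?thesis unfolding F_def G_def by blast
qed

lemma integrable_lebesgue_on_compact:
  fixes f :: "'a::euclidean_space \<Rightarrow> 'b::euclidean_space"
  assumes "compact S" "continuous_on S f"
  shows "integrable (lebesgue_on S) f"
proof -
  have "integrable lborel (\<lambda>x. indicator S x *\<^sub>R f x)" using assms by (rule borel_integrable_compact)
  then have "integrable lebesgue (\<lambda>x. indicator S x *\<^sub>R f x)" 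
    by (subst integrable_completion) (auto dest: borel_measurable_integrable)
  then show ?thesis
    using assms by (subst integrable_restrict_space) (auto simp: lmeasurable_compact fmeasurableD)
qed

text \<open>The image of Lebesgue measure on \<open>K\<close> under the height in direction
  \<open>u\<close>, and that on \<open>L\<close> under the height plus \<open>d\<close>, agree on
  all rays and are therefore equal; comparing their means determines \<open>d\<close> from the first
  moments.\<close>

lemma first_moment_translate:
  fixes K L :: "'a::euclidean_space set"
  assumes K: "compact K" and L: "compact L"
    and vol: "measure lebesgue K = measure lebesgue L"
    and d: "\<And>s. measure lebesgue (K \<inter> {x. x \<bullet> u \<le> s + d}) = measure lebesgue (L \<inter> {x. x \<bullet> u \<le> s})"
  shows "(LINT x|lebesgue_on K. x) \<bullet> u = (LINT x|lebesgue_on L. x) \<bullet> u + d * measure lebesgue L"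
proof -
  note lm = lmeasurable_compact[OF K] lmeasurable_compact[OF L]
  have meas: "(\<lambda>x. x \<bullet> u + e) \<in> borel_measurable (lebesgue_on S)" for S :: "'a set" and e
  proof -
    have "(\<lambda>x. x \<bullet> u + e) \<in> borel_measurable borel"
      by (intro borel_measurable_continuous_onI continuous_intros)
    then show ?thesis by (intro measurable_restrict_space1 measurable_completion) simp
  qed
  define D where "D = (\<lambda>S e. distr (lebesgue_on S) borel (\<lambda>x::'a. x \<bullet> u + e))"
  have em: "emeasure (D S e) {s<..} = ennreal (measure lebesgue S - measure lebesgue (S \<inter> {x. x \<bullet> u \<le> s - e}))"
    if S: "S \<in> lmeasurable" for S e s
  proof -
    have "emeasure (D S e) {s<..} = emeasure (lebesgue_on S) ((\<lambda>x. x \<bullet> u + e) -` {s<..} \<inter> space (lebesgue_on S))"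
      unfolding D_def by (rule emeasure_distr[OF meas]) simp
    also have "(\<lambda>x. x \<bullet> u + e) -` {s<..} \<inter> space (lebesgue_on S) = S - (S \<inter> {x. x \<bullet> u \<le> s - e})"
      by auto
    also have "emeasure (lebesgue_on S) (S - (S \<inter> {x. x \<bullet> u \<le> s - e})) = emeasure lebesgue (S - (S \<inter> {x. x \<bullet> u \<le> s - e}))"
      using S by (intro emeasure_restrict_space) auto
    also have "\<dots> = measure lebesgue (S - (S \<inter> {x. x \<bullet> u \<le> s - e}))"
      by (intro emeasure_eq_measure2 fmeasurable.Diff S lmeasurable_Int_halfspace)
    also have "measure lebesgue (S - (S \<inter> {x. x \<bullet> u \<le> s - e})) = measure lebesgue S - measure lebesgue (S \<inter> {x. x \<bullet> u \<le> s - e})"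
      by (intro measurable_measure_Diff S fmeasurableD lmeasurable_Int_halfspace) auto
    finally show ?thesis .
  qed
  have "D K 0 = D L d"
  proof (rule measure_eqI_lessThan)
    show "emeasure (D K 0) {s<..} < \<infinity>" for s using em[OF lm(1)] by simp
    show "emeasure (D K 0) {s<..} = emeasure (D L d) {s<..}" for s
      using em[OF lm(1), of 0 s] em[OF lm(2), of d s] d[of "s - d"] vol by simp
  qed (simp_all add: D_def)
  then have "(LINT x|D K 0. x) = (LINT x|D L d. x)" by simp
  moreover have "(LINT x|D S e. x) = (LINT x|lebesgue_on S. x \<bullet> u + e)" for S e
    unfolding D_def by (rule integral_distr[OF meas]) simp
  ultimately have eq: "(LINT x|lebesgue_on K. x \<bullet> u + 0) = (LINT x|lebesgue_on L. x \<bullet> u + d)" by simp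
  have I: "integrable (lebesgue_on S) (\<lambda>x. x)" "integrable (lebesgue_on S) (\<lambda>x. x \<bullet> u)" "integrable (lebesgue_on S) (\<lambda>x. d)"
    if "compact S" for S :: "'a set"
    using that by (auto intro!: integrable_lebesgue_on_compact continuous_intros)
  have "(LINT x|lebesgue_on K. x \<bullet> u + 0) = (LINT x|lebesgue_on K. x) \<bullet> u"
    using I[OF K] by simp
  moreover have "(LINT x|lebesgue_on L. x \<bullet> u + d) = (LINT x|lebesgue_on L. x) \<bullet> u + d * measure lebesgue L"
    using I[OF L] lm by (simp add: measure_restrict_space)
  ultimately show ?thesis using eq by simp
qed

theorem Brunn_Minkowski_eq_imp_translate:
  fixes K L :: "'a::euclidean_space set"
  assumes K: "compact K" "convex K" and L: "compact L" "convex L" and v0: "v > 0"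
    and v: "measure lebesgue K = v" "measure lebesgue L = v" and M: "measure lebesgue (K + L) = 2 ^ DIM('a) * v"
  shows "\<exists>c. K = (+) c ` L"
proof -
  define m where "m = (\<lambda>S::'a set. LINT x|lebesgue_on S. x)"
  \<comment> \<open>The difference of the centroids. In each direction \<open>u\<close> the shift
    \<open>d\<close> satisfies \<open>d * v = (m K - m L) \<bullet> u\<close>, so this one vector
    accounts for all shifts.\<close>
  define c where "c = (1 / v) *\<^sub>R (m K - m L)"
  have F: "measure lebesgue (K \<inter> {x. x \<bullet> u \<le> s + c \<bullet> u}) = measure lebesgue (L \<inter> {x. x \<bullet> u \<le> s})" if u: "u \<noteq> 0" for u s
  proof -
    obtain d where d: "\<And>s. measure lebesgue (K \<inter> {x. x \<bullet> u \<le> s + d}) = measure lebesgue (L \<inter> {x. x \<bullet> u \<le> s})"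
      using cut_volume_translate[OF K L u v0 v M] by blast
    have "m K \<bullet> u = m L \<bullet> u + d * v"
      using first_moment_translate[OF K(1) L(1) _ d] v by (simp add: m_def)
    then have "d = c \<bullet> u" using v0 by (simp add: c_def inner_diff_left)
    then show ?thesis using d by simp
  qed
  \<comment> \<open>A point of \<open>A\<close> outside the translate of \<open>B\<close> would be
    strictly separated from it; the half-space on the side of the translate holds all of its volume,
    hence all the volume of \<open>A\<close>, hence all of \<open>A\<close>.\<close>
  have sub: "A \<subseteq> (+) a ` B"
    if A: "compact A" "convex A" "measure lebesgue A = v" and B: "compact B" "convex B" "measure lebesgue B = v"
      and F: "\<And>u s. u \<noteq> 0 \<Longrightarrow> measure lebesgue (A \<inter> {x. x \<bullet> u \<le> s + a \<bullet> u}) = measure lebesgue (B \<inter> {x. x \<bullet> u \<le> s})"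
    for A B :: "'a set" and a
  proof
    fix x assume x: "x \<in> A"
    show "x \<in> (+) a ` B"
    proof (rule ccontr)
      assume "x \<notin> (+) a ` B"
      then have "x - a \<notin> B" by (metis add.commute diff_add_cancel imageI)
      moreover have "B \<noteq> {}" using B v0 by auto
      ultimately obtain w b where w: "w \<bullet> (x - a) < b" "\<And>y. y \<in> B \<Longrightarrow> w \<bullet> y > b"
        using separating_hyperplane_closed_point[of B "x - a"] B compact_imp_closed by blast
      have w0: "w \<noteq> 0" using w \<open>B \<noteq> {}\<close> by fastforce
      have "B \<inter> {y. y \<bullet> (- w) \<le> - b} = B" using w(2) by (force simp: inner_commute)
      then have "measure lebesgue (A \<inter> {y. y \<bullet> (- w) \<le> - b + a \<bullet> (- w)}) = v"
        using F[of "- w" "- b"] B w0 by simp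
      then have "A \<subseteq> {y. y \<bullet> (- w) \<le> - b + a \<bullet> (- w)}"
        using A v0 by (intro measure_halfspace_eq_imp_subset) auto
      then have "x \<bullet> (- w) \<le> - b + a \<bullet> (- w)" using x by blast
      then show False using w(1) by (simp add: inner_diff_right inner_commute[of w])
    qed
  qed
  have "K \<subseteq> (+) c ` L" using sub[OF K v(1) L v(2)] F by blast
  moreover have "L \<subseteq> (+) (- c) ` K"
  proof (rule sub[OF L v(2) K v(1)])
    show "measure lebesgue (L \<inter> {x. x \<bullet> u \<le> s + - c \<bullet> u}) = measure lebesgue (K \<inter> {x. x \<bullet> u \<le> s})" if "u \<noteq> 0" for u s
      using F[OF that, of "s - c \<bullet> u"] by simp
  qed
  then have "(+) c ` L \<subseteq> (+) c ` (+) (- c) ` K" by (rule image_mono)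
  then have "(+) c ` L \<subseteq> K" by (simp add: image_image)
  ultimately show ?thesis by blast
qed

section \<open>The Steiner polynomial\<close>

lemma abs_exp_minus_linear_le:
  fixes s :: real
  assumes "\<bar>s\<bar> \<le> 1"
  shows "\<bar>exp s - 1 - s\<bar> \<le> s\<^sup>2"
proof -
  have l: "1 + s \<le> exp s" by (rule exp_ge_add_one_self)
  have "exp s \<le> 1 + s + s\<^sup>2"
  proof (cases "s \<ge> 0")
    case True
    then show ?thesis using exp_bound[of s] assms by simp
  next
    case False
    have "1 - s \<le> exp (- s)" using exp_ge_add_one_self[of "- s"] by simp
    then have "exp s \<le> 1 / (1 - s)" using False by (simp add: exp_minus field_simps)
    also have "\<dots> \<le> 1 + s + s\<^sup>2"
    proof -
      have "1 \<le> 1 - s ^ 3" using False by (simp add: power_le_zero_eq)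
      also have "\<dots> = (1 + s + s\<^sup>2) * (1 - s)" by (simp add: algebra_simps power2_eq_square power3_eq_cube)
      finally show ?thesis using False by (simp add: divide_le_eq)
    qed
    finally show ?thesis .
  qed
  then show ?thesis unfolding abs_le_iff using l zero_le_power2[of s] by linarith
qed

text \<open>The weight \<open>\<psi>\<close> is kept general because differentiation in
  \<open>x\<close> multiplies it by a linear form: the Laplace transform, its gradient and the
  derivative of that gradient are all instances.\<close>

definition exp_moment :: "'a::euclidean_space set \<Rightarrow> ('a \<Rightarrow> 'b::euclidean_space) \<Rightarrow> 'a \<Rightarrow> 'b" where
  "exp_moment K \<psi> x = (LINT y|lebesgue_on K. exp (x \<bullet> y) *\<^sub>R \<psi> y)"

text \<open>Differentiation under the integral. For increments of norm below \<open>1 / B\<close>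
  the exponent changes by at most 1 on \<open>K\<close>, so the remainder of the exponential is
  quadratic uniformly in \<open>y\<close>, and \<open>C\<close> collects the constants.\<close>

lemma exp_moment_has_derivative:
  fixes \<psi> :: "'a::euclidean_space \<Rightarrow> 'b::euclidean_space"
  assumes K: "compact K" and \<psi>: "continuous_on K \<psi>"
  shows "(exp_moment K \<psi> has_derivative (\<lambda>h. exp_moment K (\<lambda>y. (h \<bullet> y) *\<^sub>R \<psi> y) x)) (at x)"
proof -
  obtain B where B: "B > 0" "\<And>y. y \<in> K \<Longrightarrow> norm y \<le> B"
    using compact_imp_bounded[OF K] by (auto simp: bounded_pos)
  have I: "integrable (lebesgue_on K) (\<lambda>y. exp (z \<bullet> y) *\<^sub>R \<psi> y)"
    "integrable (lebesgue_on K) (\<lambda>y. exp (z \<bullet> y) *\<^sub>R (h \<bullet> y) *\<^sub>R \<psi> y)" 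
    "integrable (lebesgue_on K) (\<lambda>y. exp (z \<bullet> y) * norm (\<psi> y))" for z h
    by (intro integrable_lebesgue_on_compact[OF K] continuous_intros \<psi>)+
  define C where "C = B\<^sup>2 * (LINT y|lebesgue_on K. exp (x \<bullet> y) * norm (\<psi> y))"
  show ?thesis
  proof (rule has_derivativeI_sandwich[where e="1 / B" and H="\<lambda>y. C * norm (y - x)"])
    show "0 < 1 / B" using B by simp
    have "linear (\<lambda>h. exp_moment K (\<lambda>y. (h \<bullet> y) *\<^sub>R \<psi> y) x)"
    proof
      show "exp_moment K (\<lambda>y. ((b1 + b2) \<bullet> y) *\<^sub>R \<psi> y) x = exp_moment K (\<lambda>y. (b1 \<bullet> y) *\<^sub>R \<psi> y) x + exp_moment K (\<lambda>y. (b2 \<bullet> y) *\<^sub>R \<psi> y) x" for b1 b2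
        using I by (simp add: exp_moment_def inner_add_left scaleR_add_left scaleR_add_right del: scaleR_scaleR)
      show "exp_moment K (\<lambda>y. ((r *\<^sub>R b) \<bullet> y) *\<^sub>R \<psi> y) x = r *\<^sub>R exp_moment K (\<lambda>y. (b \<bullet> y) *\<^sub>R \<psi> y) x" for r b
        unfolding exp_moment_def integral_scaleR_right[symmetric]
        by (intro Bochner_Integration.integral_cong refl) simp
    qed
    then show "bounded_linear (\<lambda>h. exp_moment K (\<lambda>y. (h \<bullet> y) *\<^sub>R \<psi> y) x)" by (simp add: linear_conv_bounded_linear)
    show "((\<lambda>y. C * norm (y - x)) \<longlongrightarrow> 0) (at x)"
      by (rule tendsto_eq_intros refl tendsto_intros | simp)+
    fix z assume z: "z \<noteq> x" "dist z x < 1 / B"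
    define h where "h = z - x"
    have h: "norm h * B \<le> 1" "norm h > 0" using z B by (simp_all add: h_def dist_norm field_simps)
    have "exp_moment K \<psi> z - exp_moment K \<psi> x - exp_moment K (\<lambda>y. ((z - x) \<bullet> y) *\<^sub>R \<psi> y) x =
       (LINT y|lebesgue_on K. exp (z \<bullet> y) *\<^sub>R \<psi> y - exp (x \<bullet> y) *\<^sub>R \<psi> y - exp (x \<bullet> y) *\<^sub>R ((z - x) \<bullet> y) *\<^sub>R \<psi> y)"
      unfolding exp_moment_def using I by (simp del: scaleR_scaleR)
    also have "norm \<dots> \<le> (LINT y|lebesgue_on K. ((norm h)\<^sup>2 * B\<^sup>2) * (exp (x \<bullet> y) * norm (\<psi> y)))"
    proof (rule Bochner_Integration.integral_norm_bound_integral)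
      show "integrable (lebesgue_on K) (\<lambda>y. exp (z \<bullet> y) *\<^sub>R \<psi> y - exp (x \<bullet> y) *\<^sub>R \<psi> y - exp (x \<bullet> y) *\<^sub>R ((z - x) \<bullet> y) *\<^sub>R \<psi> y)"
        using I by (intro Bochner_Integration.integrable_diff)
      show "integrable (lebesgue_on K) (\<lambda>y. ((norm h)\<^sup>2 * B\<^sup>2) * (exp (x \<bullet> y) * norm (\<psi> y)))"
        using I by (intro integrable_mult_right)
      fix y assume "y \<in> space (lebesgue_on K)"
      then have y: "norm y \<le> B" using B by simp
      have "\<bar>h \<bullet> y\<bar> \<le> norm h * norm y" by (rule Cauchy_Schwarz_ineq2)
      also have "\<dots> \<le> norm h * B" using y by (intro mult_left_mono) auto
      finally have hy: "\<bar>h \<bullet> y\<bar> \<le> norm h * B" .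
      have "\<bar>exp (h \<bullet> y) - 1 - h \<bullet> y\<bar> \<le> (h \<bullet> y)\<^sup>2" using hy h by (intro abs_exp_minus_linear_le) simp
      also have "\<dots> \<le> (norm h * B)\<^sup>2" using power_mono[OF hy, of 2] by simp
      finally have e: "\<bar>exp (h \<bullet> y) - 1 - h \<bullet> y\<bar> \<le> (norm h)\<^sup>2 * B\<^sup>2" by (simp add: power_mult_distrib)
      have "exp (z \<bullet> y) = exp (x \<bullet> y) * exp (h \<bullet> y)" by (simp add: h_def inner_diff_left flip: exp_add)
      then have "exp (z \<bullet> y) *\<^sub>R \<psi> y - exp (x \<bullet> y) *\<^sub>R \<psi> y - exp (x \<bullet> y) *\<^sub>R ((z - x) \<bullet> y) *\<^sub>R \<psi> y
        = (exp (x \<bullet> y) * (exp (h \<bullet> y) - 1 - h \<bullet> y)) *\<^sub>R \<psi> y"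
        by (simp add: h_def algebra_simps)
      also have "norm \<dots> = \<bar>exp (h \<bullet> y) - 1 - h \<bullet> y\<bar> * (exp (x \<bullet> y) * norm (\<psi> y))"
        by (simp add: abs_mult)
      also have "\<dots> \<le> ((norm h)\<^sup>2 * B\<^sup>2) * (exp (x \<bullet> y) * norm (\<psi> y))"
        by (rule mult_right_mono[OF e]) simp
      finally show "norm (exp (z \<bullet> y) *\<^sub>R \<psi> y - exp (x \<bullet> y) *\<^sub>R \<psi> y - exp (x \<bullet> y) *\<^sub>R ((z - x) \<bullet> y) *\<^sub>R \<psi> y)
        \<le> ((norm h)\<^sup>2 * B\<^sup>2) * (exp (x \<bullet> y) * norm (\<psi> y))" .
    qed
    also have "\<dots> = (C * norm h) * norm h" unfolding C_def by (simp add: power2_eq_square)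
    finally show "norm (exp_moment K \<psi> z - exp_moment K \<psi> x - exp_moment K (\<lambda>y. ((z - x) \<bullet> y) *\<^sub>R \<psi> y) x) / norm (z - x) \<le> C * norm (z - x)"
      using h by (simp add: h_def divide_le_eq)
  qed
qed

definition laplace :: "'a::euclidean_space set \<Rightarrow> 'a \<Rightarrow> real" where
  "laplace K = exp_moment K (\<lambda>y. 1)"

text \<open>The centroid of \<open>K\<close> for the probability density proportional to
  \<open>exp (x \<bullet> y)\<close>.\<close>

definition tilted_mean :: "'a::euclidean_space set \<Rightarrow> 'a \<Rightarrow> 'a" where
  "tilted_mean K x = exp_moment K (\<lambda>y. y) x /\<^sub>R laplace K x"

text \<open>Source of strictness: an integral over a body of positive volume cannot vanish merely
  because the body is concentrated on a hyperplane.\<close>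

lemma AE_lebesgue_on_hyperplane_imp_null:
  fixes K :: "'a::euclidean_space set"
  assumes K: "K \<in> sets lebesgue" and ae: "AE y in lebesgue_on K. u \<bullet> y = c" and u: "u \<noteq> 0"
  shows "measure lebesgue K = 0"
proof -
  have "AE y in lebesgue. y \<in> K \<longrightarrow> u \<bullet> y = c" using ae K by (subst (asm) AE_restrict_space_iff) auto
  moreover have "AE y in lebesgue. y \<notin> {y. u \<bullet> y = c}"
    using negligible_hyperplane[of u c] u by (intro AE_not_in) (simp add: negligible_iff_null_sets)
  ultimately have "AE y in lebesgue. y \<notin> K" by eventually_elim auto
  then have "K \<in> null_sets lebesgue" using K by (subst (asm) AE_iff_null_sets[symmetric]) auto
  then show ?thesis by (simp add: measure_def null_setsD1)
qed

context
  fixes K :: "'a::euclidean_space set"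
  assumes K: "compact K" and pos: "measure lebesgue K > 0"
begin

lemma integrable_tilt: "continuous_on K f \<Longrightarrow> integrable (lebesgue_on K) (\<lambda>y. exp (x \<bullet> y) *\<^sub>R (f y :: 'b::euclidean_space))"
  by (intro integrable_lebesgue_on_compact[OF K] continuous_intros)

lemma K_sets_lebesgue: "K \<in> sets lebesgue"
  using lmeasurable_compact[OF K] by simp

lemma not_AE_hyperplane: "u \<noteq> 0 \<Longrightarrow> \<not> (AE y in lebesgue_on K. u \<bullet> y = c)"
  using AE_lebesgue_on_hyperplane_imp_null[OF K_sets_lebesgue] pos by fastforce

lemma laplace_pos: "laplace K x > 0"
proof -
  have i: "integrable (lebesgue_on K) (\<lambda>y. exp (x \<bullet> y))" using integrable_tilt[of "\<lambda>y. 1::real" x] by simp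
  have "laplace K x \<ge> 0" unfolding laplace_def exp_moment_def by (rule Bochner_Integration.integral_nonneg) simp
  moreover have "laplace K x \<noteq> 0"
  proof
    assume "laplace K x = 0"
    then have "AE y in lebesgue_on K. exp (x \<bullet> y) = 0"
      unfolding laplace_def exp_moment_def using i by (subst (asm) integral_nonneg_eq_0_iff_AE) auto
    \<comment> \<open>An exponential never vanishes, so the preceding statement is absurd at each
      point and implies membership in a hyperplane; some basis vector serves as its normal.\<close>
    then have "AE y in lebesgue_on K. (SOME u. u \<in> Basis) \<bullet> y = (0::real)" by (rule eventually_mono) simp
    then show False using not_AE_hyperplane[of "SOME u. u \<in> Basis" 0] by (metis nonzero_Basis SOME_Basis)
  qed
  ultimately show ?thesis by simp
qed

lemma laplace_has_derivative:
  "(laplace K has_derivative (\<lambda>h. h \<bullet> exp_moment K (\<lambda>y. y) x)) (at x)"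
proof -
  have "exp_moment K (\<lambda>y. (h \<bullet> y) *\<^sub>R (1::real)) x = h \<bullet> exp_moment K (\<lambda>y. y) x" for h
  proof -
    have "exp_moment K (\<lambda>y. (h \<bullet> y) *\<^sub>R (1::real)) x = (LINT y|lebesgue_on K. h \<bullet> (exp (x \<bullet> y) *\<^sub>R y))"
      by (simp add: exp_moment_def)
    also have "\<dots> = h \<bullet> exp_moment K (\<lambda>y. y) x"
      unfolding exp_moment_def by (intro integral_inner_right integrable_tilt continuous_intros)
    finally show ?thesis .
  qed
  then show ?thesis using exp_moment_has_derivative[OF K, of "\<lambda>y. 1::real" x] by (simp add: laplace_def)
qed

lemma ln_laplace_has_derivative:
  "((\<lambda>x. ln (laplace K x)) has_derivative (\<lambda>h. h \<bullet> tilted_mean K x)) (at x)"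
proof -
  have "((\<lambda>x. ln (laplace K x)) has_derivative (\<lambda>h. (h \<bullet> exp_moment K (\<lambda>y. y) x) * inverse (laplace K x))) (at x)"
    by (rule has_derivative_ln[OF laplace_pos laplace_has_derivative])
  then show ?thesis by (simp add: tilted_mean_def mult.commute)
qed

lemma tilted_mean_differentiable: "tilted_mean K differentiable (at x)"
proof -
  have "laplace K x \<noteq> 0" using laplace_pos[of x] by simp
  note has_derivative_scaleR[OF Deriv.has_derivative_inverse[OF this laplace_has_derivative]
      exp_moment_has_derivative[OF K continuous_on_id]]
  then show ?thesis unfolding tilted_mean_def[abs_def] differentiable_def by blast
qed

lemma tilted_integral:
  "(LINT y|lebesgue_on K. exp (x \<bullet> y) * (d \<bullet> y - d \<bullet> tilted_mean K x)) = 0"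
proof -
  have 1: "integrable (lebesgue_on K) (\<lambda>y. exp (x \<bullet> y) *\<^sub>R y)" "integrable (lebesgue_on K) (\<lambda>y. exp (x \<bullet> y))"
    using integrable_tilt[of "\<lambda>y. y" x] integrable_tilt[of "\<lambda>y. 1::real" x] by (simp_all add: continuous_intros)
  have "(LINT y|lebesgue_on K. exp (x \<bullet> y) * (d \<bullet> y - d \<bullet> tilted_mean K x)) =
    (LINT y|lebesgue_on K. d \<bullet> (exp (x \<bullet> y) *\<^sub>R y) - (d \<bullet> tilted_mean K x) * exp (x \<bullet> y))"
    by (intro Bochner_Integration.integral_cong refl) (simp add: algebra_simps)
  also have "\<dots> = d \<bullet> exp_moment K (\<lambda>y. y) x - (d \<bullet> tilted_mean K x) * laplace K x"
    unfolding exp_moment_def laplace_def using 1 by (simp del: inner_scaleR_right)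
  also have "\<dots> = 0" using laplace_pos[of x] by (simp add: tilted_mean_def)
  finally show ?thesis .
qed

text \<open>\<open>tilted_mean K\<close> is the gradient of the strictly convex function \<open>ln (laplace K)\<close>.\<close>

lemma tilted_mean_strict_mono:
  assumes "x \<noteq> x'"
  shows "(tilted_mean K x - tilted_mean K x') \<bullet> (x - x') > 0"
proof -
  define d where "d = x - x'"
  define m where "m = d \<bullet> tilted_mean K x'"
  have d: "d \<noteq> 0" using assms by (simp add: d_def)
  have I: "integrable (lebesgue_on K) (\<lambda>y. exp (z \<bullet> y) * (d \<bullet> y - c))" for z c
    by (intro integrable_lebesgue_on_compact[OF K] continuous_intros)
  \<comment> \<open>A product of two increasing functions of \<open>d \<bullet> y\<close> that
    vanish together at \<open>m\<close>, hence nonnegative. The weight at \<open>x'\<close>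
    integrates \<open>d \<bullet> y - m\<close> to zero, so only the term with the weight at
    \<open>x\<close> survives in the integral of \<open>q\<close>.\<close>
  define q where "q = (\<lambda>y. exp (x' \<bullet> y) * ((d \<bullet> y - m) * (exp (d \<bullet> y) - exp m)))"
  have qe: "q y = exp (x \<bullet> y) * (d \<bullet> y - m) - exp m * (exp (x' \<bullet> y) * (d \<bullet> y - m))" for y
  proof -
    have "exp (x \<bullet> y) = exp (x' \<bullet> y) * exp (d \<bullet> y)" by (simp add: d_def inner_diff_left flip: exp_add)
    then show ?thesis by (simp add: q_def algebra_simps)
  qed
  have q0: "q y \<ge> 0" for y
  proof -
    have "(d \<bullet> y - m) * (exp (d \<bullet> y) - exp m) \<ge> 0"
      by (cases "d \<bullet> y \<ge> m") (simp_all add: mult_nonneg_nonneg mult_nonpos_nonpos)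
    then show ?thesis unfolding q_def by simp
  qed
  have Iq: "integrable (lebesgue_on K) q" unfolding qe using I by (intro Bochner_Integration.integrable_diff integrable_mult_right)
  have int: "integral\<^sup>L (lebesgue_on K) q = (LINT y|lebesgue_on K. exp (x \<bullet> y) * (d \<bullet> y - m))"
    unfolding qe using I tilted_integral[of x' d] by (simp add: m_def continuous_intros)
  have "integral\<^sup>L (lebesgue_on K) q \<noteq> 0"
  proof
    assume "integral\<^sup>L (lebesgue_on K) q = 0"
    then have "AE y in lebesgue_on K. q y = 0" using Iq q0 by (subst (asm) integral_nonneg_eq_0_iff_AE) auto
    then have "AE y in lebesgue_on K. d \<bullet> y = m" by (rule eventually_mono) (simp add: q_def)
    then show False using not_AE_hyperplane[OF d] by blast
  qed
  moreover have "integral\<^sup>L (lebesgue_on K) q \<ge> 0" using q0 by (intro Bochner_Integration.integral_nonneg)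
  ultimately have p: "(LINT y|lebesgue_on K. exp (x \<bullet> y) * (d \<bullet> y - m)) > 0" using int by linarith
  have "(LINT y|lebesgue_on K. exp (x \<bullet> y) * (d \<bullet> y - m)) = (LINT y|lebesgue_on K. 
     exp (x \<bullet> y) * (d \<bullet> y - d \<bullet> tilted_mean K x) + (d \<bullet> tilted_mean K x - m) * exp (x \<bullet> y))"
    by (intro Bochner_Integration.integral_cong refl) (simp add: algebra_simps)
  also have "\<dots> = (d \<bullet> tilted_mean K x - m) * laplace K x"
    using I tilted_integral[of x d] integrable_tilt[of "\<lambda>y. 1::real" x]
    by (simp add: laplace_def exp_moment_def continuous_intros)
  finally have "d \<bullet> tilted_mean K x - m > 0" using p laplace_pos[of x] by (simp add: zero_less_mult_iff)
  then show ?thesis by (simp add: m_def d_def inner_diff_right inner_diff_left inner_commute)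
qed

lemma tilted_mean_in:
  assumes "convex K"
  shows "tilted_mean K x \<in> K"
proof (rule ccontr)
  assume "tilted_mean K x \<notin> K"
  then obtain a b where ab: "a \<bullet> tilted_mean K x < b" "\<And>y. y \<in> K \<Longrightarrow> a \<bullet> y > b"
    using separating_hyperplane_closed_point[OF assms compact_imp_closed[OF K], of "tilted_mean K x"] by auto
  have I: "integrable (lebesgue_on K) (\<lambda>y. exp (x \<bullet> y) * (a \<bullet> y - c))" for c
    by (intro integrable_lebesgue_on_compact[OF K] continuous_intros)
  have i1: "integrable (lebesgue_on K) (\<lambda>y. (b - a \<bullet> tilted_mean K x) * exp (x \<bullet> y))"
    by (intro integrable_lebesgue_on_compact[OF K] continuous_intros)
  have "(b - a \<bullet> tilted_mean K x) * laplace K x = (LINT y|lebesgue_on K. (b - a \<bullet> tilted_mean K x) * exp (x \<bullet> y))"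
    by (simp add: laplace_def exp_moment_def)
  also have "\<dots> \<le> (LINT y|lebesgue_on K. exp (x \<bullet> y) * (a \<bullet> y - a \<bullet> tilted_mean K x))"
  proof (rule integral_mono[OF i1 I])
    fix y assume "y \<in> space (lebesgue_on K)"
    then have "b \<le> a \<bullet> y" using ab by fastforce
    then show "(b - a \<bullet> tilted_mean K x) * exp (x \<bullet> y) \<le> exp (x \<bullet> y) * (a \<bullet> y - a \<bullet> tilted_mean K x)"
      by (subst mult.commute) (intro mult_left_mono; simp)
  qed
  also have "\<dots> = 0" by (rule tilted_integral)
  finally show False using ab(1) laplace_pos[of x] by (simp add: mult_le_0_iff)
qed

text \<open>Move from \<open>a\<close> by \<open>e / 2\<close> in the direction of \<open>x\<close>:
  the ball of radius \<open>e / 4\<close> around that point lies in \<open>K\<close>, and on it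
  \<open>x \<bullet> y\<close> exceeds \<open>a \<bullet> x\<close> by at least
  \<open>e / 4 * norm x\<close>. Integrating over this ball alone gives the bound, with
  \<open>c\<close> the logarithm of its volume.\<close>

lemma ln_laplace_coercive:
  assumes a: "a \<in> interior K"
  obtains c \<delta> where "\<delta> > 0" "\<And>x. ln (laplace K x) - a \<bullet> x \<ge> \<delta> * norm x + c"
proof -
  obtain e where e: "e > 0" "ball a e \<subseteq> K" using a by (meson mem_interior)
  define w where "w = measure lebesgue (ball (0::'a) (e / 4))"
  have w: "w > 0" using e by (simp add: w_def content_ball_pos)
  have "ln (laplace K x) - a \<bullet> x \<ge> e / 4 * norm x + ln w" for x
  proof -
    define p where "p = a + (e / 2) *\<^sub>R sgn x"
    have sub: "ball p (e / 4) \<subseteq> K"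
    proof
      fix y assume y: "y \<in> ball p (e / 4)"
      have "dist a y \<le> dist a p + dist p y" by (rule dist_triangle)
      also have "\<dots> < e / 2 + e / 4" using y e by (intro add_le_less_mono) (auto simp: p_def dist_norm norm_sgn)
      also have "\<dots> \<le> e" using e by simp
      finally show "y \<in> K" using e by auto
    qed
    have low: "x \<bullet> y \<ge> a \<bullet> x + e / 4 * norm x" if "y \<in> ball p (e / 4)" for y
    proof -
      have "x \<bullet> y = x \<bullet> p + x \<bullet> (y - p)" by (simp add: inner_diff_right)
      moreover have "x \<bullet> p = a \<bullet> x + e / 2 * norm x"
      proof (cases "x = 0")
        case False
        then show ?thesis
          by (simp add: p_def inner_add_right inner_commute sgn_div_norm power2_eq_square flip: power2_norm_eq_inner)
      qed (simp add: p_def)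
      moreover have "\<bar>x \<bullet> (y - p)\<bar> \<le> e / 4 * norm x"
        using Cauchy_Schwarz_ineq2[of x "y - p"] that
        by (smt (verit) dist_norm mem_ball mult_left_mono norm_ge_zero norm_minus_commute mult.commute)
      ultimately show ?thesis unfolding abs_le_iff
        by (simp only: times_divide_eq_left) linarith
    qed
    have wp: "measure lebesgue (ball p (e / 4)) = w"
      unfolding w_def using measure_translation[of p "ball 0 (e / 4)"] by (simp add: ball_translation)
    have "w * exp (a \<bullet> x + e / 4 * norm x) = (LINT y|lebesgue_on K. exp (a \<bullet> x + e / 4 * norm x) * indicat_real (ball p (e / 4)) y)"
      using sub K_sets_lebesgue by (simp add: measure_restrict_space wp Int_absorb1 Int_absorb2)
    also have "\<dots> \<le> (LINT y|lebesgue_on K. exp (x \<bullet> y))"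
    proof (rule integral_mono)
      show "integrable (lebesgue_on K) (\<lambda>y. exp (x \<bullet> y))" using integrable_tilt[of "\<lambda>y. 1::real" x] by simp
      show "integrable (lebesgue_on K) (\<lambda>y. exp (a \<bullet> x + e / 4 * norm x) * indicat_real (ball p (e / 4)) y)"
      proof (intro integrable_mult_right integrable_real_indicator)
        show "ball p (e / 4) \<in> sets (lebesgue_on K)" using sub K_sets_lebesgue by (simp add: sets_restrict_space_iff)
        show "emeasure (lebesgue_on K) (ball p (e / 4)) < \<infinity>"
          using sub K_sets_lebesgue emeasure_bounded_finite[of "ball p (e / 4)"]
          by (simp add: emeasure_restrict_space)
      qed
    qed (use low in \<open>auto simp: indicator_def simp del: mem_ball\<close>)
    also have "\<dots> = laplace K x" by (simp add: laplace_def exp_moment_def)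
    finally have "ln (w * exp (a \<bullet> x + e / 4 * norm x)) \<le> ln (laplace K x)"
      using w laplace_pos[of x] by (subst ln_le_cancel_iff) auto
    then show ?thesis using w by (simp add: ln_mult)
  qed
  then show thesis using that[of "e / 4"] e by auto
qed

end

lemma coercive_attains_min:
  fixes F :: "'a::euclidean_space \<Rightarrow> real"
  assumes cont: "continuous_on UNIV F" and \<delta>: "\<delta> > 0" and co: "\<And>x. F x \<ge> \<delta> * norm x + c"
  obtains x0 where "\<And>x. F x0 \<le> F x"
proof -
  define R where "R = max 0 ((F 0 - c) / \<delta>)"
  have "\<exists>x0\<in>cball 0 R. \<forall>x\<in>cball 0 R. F x0 \<le> F x"
    by (intro continuous_attains_inf continuous_on_subset[OF cont]) (auto simp: R_def)
  then obtain x0 where x0: "\<And>x. x \<in> cball 0 R \<Longrightarrow> F x0 \<le> F x" by blast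
  have "F x0 \<le> F x" for x
  proof (cases "x \<in> cball 0 R")
    case False
    then have "norm x > (F 0 - c) / \<delta>" by (simp add: R_def)
    then have "\<delta> * norm x + c > F 0" using \<delta> by (simp add: divide_less_eq mult.commute)
    moreover have "F x0 \<le> F 0" by (rule x0) (simp add: R_def)
    ultimately show ?thesis using co[of x] by linarith
  qed (rule x0)
  then show thesis by (rule that)
qed

definition mean_map :: "'a::euclidean_space set \<Rightarrow> 'a set \<Rightarrow> real \<Rightarrow> 'a \<Rightarrow> 'a" where
  "mean_map K E t x = tilted_mean K x + t *\<^sub>R tilted_mean E x"

text \<open>Gromov's argument: \<open>mean_map K E t\<close> is the gradient of a strictly convex function and maps the whole
  space onto the interior of \<open>K + t E\<close>, with a Jacobian that is polynomial in \<open>t\<close>.\<close>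

context
  fixes K E :: "'a::euclidean_space set"
  assumes K: "compact K" "convex K" and Kpos: "measure lebesgue K > 0"
    and E: "compact E" "convex E" and Epos: "measure lebesgue E > 0"
begin

lemma mean_map_inj:
  assumes "t \<ge> 0"
  shows "inj (mean_map K E t)"
proof (rule injI, rule ccontr)
  fix x y assume eq: "mean_map K E t x = mean_map K E t y" and "x \<noteq> y"
  then have "(tilted_mean K x - tilted_mean K y) \<bullet> (x - y) > 0" "(tilted_mean E x - tilted_mean E y) \<bullet> (x - y) > 0"
    by (simp_all add: tilted_mean_strict_mono K E Kpos Epos)
  then have "(tilted_mean K x - tilted_mean K y) \<bullet> (x - y) + t * ((tilted_mean E x - tilted_mean E y) \<bullet> (x - y)) > 0"
    using assms by (intro add_pos_nonneg) auto
  moreover have "(tilted_mean K x - tilted_mean K y) \<bullet> (x - y) + t * ((tilted_mean E x - tilted_mean E y) \<bullet> (x - y))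
    = (mean_map K E t x - mean_map K E t y) \<bullet> (x - y)"
    by (simp add: mean_map_def inner_diff_left inner_add_left algebra_simps)
  ultimately show False using eq by simp
qed

text \<open>The value is attained where the convex potential minus the linear form
  \<open>x \<bullet> (a + t *\<^sub>R b)\<close> has its minimum. Coercivity, available because
  \<open>a\<close> and \<open>b\<close> are interior points, makes the minimum exist.\<close>

lemma mean_map_surj:
  assumes t: "t \<ge> 0" and a: "a \<in> interior K" and b: "b \<in> interior E"
  shows "a + t *\<^sub>R b \<in> range (mean_map K E t)"
proof -
  obtain c1 d1 where 1: "d1 > 0" "\<And>x. ln (laplace K x) - a \<bullet> x \<ge> d1 * norm x + c1"
    using ln_laplace_coercive[OF K(1) Kpos a] by blast
  obtain c2 d2 where 2: "d2 > 0" "\<And>x. ln (laplace E x) - b \<bullet> x \<ge> d2 * norm x + c2"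
    using ln_laplace_coercive[OF E(1) Epos b] by blast
  define F where "F = (\<lambda>x. ln (laplace K x) + t * ln (laplace E x) - x \<bullet> (a + t *\<^sub>R b))"
  have deriv: "(F has_derivative (\<lambda>h. h \<bullet> (mean_map K E t x) - h \<bullet> (a + t *\<^sub>R b))) (at x)" for x
  proof -
    have "(F has_derivative (\<lambda>h. h \<bullet> tilted_mean K x + t * (h \<bullet> tilted_mean E x) - h \<bullet> (a + t *\<^sub>R b))) (at x)"
      unfolding F_def
      by (intro has_derivative_diff has_derivative_add has_derivative_mult_right has_derivative_inner_left has_derivative_ident
          ln_laplace_has_derivative K E Kpos Epos)
    then show ?thesis by (simp add: mean_map_def inner_add_right)
  qed
  have "continuous_on UNIV F"
    using deriv by (meson differentiable_def differentiable_imp_continuous_on differentiable_on_def differentiable_at_withinI)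
  moreover have "F x \<ge> d1 * norm x + (c1 + t * c2)" for x
  proof -
    have "0 \<le> t * (d2 * norm x)" using 2 t by simp
    moreover have "t * (d2 * norm x + c2) \<le> t * (ln (laplace E x) - b \<bullet> x)" using t 2 by (intro mult_left_mono) auto
    moreover have "F x = (ln (laplace K x) - a \<bullet> x) + t * (ln (laplace E x) - b \<bullet> x)"
      by (simp add: F_def inner_add_right inner_commute algebra_simps)
    ultimately show ?thesis using 1(2)[of x] by (simp add: algebra_simps)
  qed
  ultimately obtain x0 where x0: "\<And>x. F x0 \<le> F x" using coercive_attains_min[OF _ 1(1)] by blast
  have "(\<lambda>h. h \<bullet> (mean_map K E t x0) - h \<bullet> (a + t *\<^sub>R b)) = (\<lambda>h. 0)"
    using x0 by (intro differential_zero_maxmin[OF UNIV_I open_UNIV deriv]) auto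
  then have "h \<bullet> (mean_map K E t x0 - (a + t *\<^sub>R b)) = 0" for h by (metis inner_diff_right)
  then have "mean_map K E t x0 = a + t *\<^sub>R b" by (metis inner_eq_zero_iff eq_iff_diff_eq_0)
  then show ?thesis by (metis rangeI)
qed

text \<open>The range lies between the sum \<open>?U\<close> of the interiors and the sum
  \<open>?S\<close> of the bodies, which is contained in the closure of \<open>?U\<close>. The gap
  is part of the frontier of a convex set and so is null.\<close>

lemma mean_map_range_measure:
  assumes t: "t \<ge> 0"
  shows "range (mean_map K E t) \<in> lmeasurable"
    and "measure lebesgue (range (mean_map K E t)) = measure lebesgue (K + (*\<^sub>R) t ` E)"
proof -
  let ?U = "interior K + (*\<^sub>R) t ` interior E"
  let ?S = "K + (*\<^sub>R) t ` E"
  have S: "compact ?S" by (intro compact_set_plus K compact_scaling E)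
  have cU: "convex ?U" by (intro convex_set_plus convex_interior convex_scaling K E)
  have "?S \<subseteq> closure (interior K) + closure ((*\<^sub>R) t ` interior E)"
  proof (rule set_plus_mono_subset)
    show "K \<subseteq> closure (interior K)"
      using convex_closure_interior[OF K(2) convex_body_interior_nonempty[OF K Kpos]] closure_subset by blast
    have "E \<subseteq> closure (interior E)"
      using convex_closure_interior[OF E(2) convex_body_interior_nonempty[OF E Epos]] closure_subset by blast
    then show "(*\<^sub>R) t ` E \<subseteq> closure ((*\<^sub>R) t ` interior E)"
      using closure_scaleR[of t "interior E"] by (metis image_mono)
  qed
  also have "\<dots> \<subseteq> closure ?U" by (rule closure_sum)
  finally have Scl: "?S \<subseteq> closure ?U" .
  \<comment> \<open>A union of translates of \<open>interior K\<close>, which also covers the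
    degenerate scaling \<open>t = 0\<close>.\<close>
  have oU: "open ?U"
  proof -
    have "?U = (\<Union>y\<in>(*\<^sub>R) t ` interior E. (+) y ` interior K)"
      by (auto simp: set_plus_def add.commute)
    then show ?thesis by (auto intro!: open_UN open_translation)
  qed
  have Ur: "?U \<subseteq> range (mean_map K E t)" using mean_map_surj[OF t] by (auto simp: set_plus_def)
  have rS: "range (mean_map K E t) \<subseteq> ?S"
    using tilted_mean_in[OF K(1) Kpos K(2)] tilted_mean_in[OF E(1) Epos E(2)] by (auto simp: mean_map_def)
  have neg: "negligible (?S - range (mean_map K E t) \<union> (range (mean_map K E t) - ?S))"
  proof (rule negligible_subset[OF negligible_convex_frontier[OF cU]])
    show "?S - range (mean_map K E t) \<union> (range (mean_map K E t) - ?S) \<subseteq> frontier ?U"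
      using Scl Ur rS oU by (simp add: frontier_def interior_open) blast
  qed
  show "range (mean_map K E t) \<in> lmeasurable"
    using lmeasurable_negligible_symdiff[OF lmeasurable_compact[OF S] neg] .
  show "measure lebesgue (range (mean_map K E t)) = measure lebesgue ?S"
    by (rule measure_negligible_symdiff[OF lmeasurable_compact[OF S] neg])
qed

end

section \<open>Nonnegative Jacobians and interpolation in the dilation parameter\<close>

text \<open>On the segment from the identity to \<open>A\<close> the matrices are positive definite
  before the endpoint, so the determinant starts at 1 and cannot change sign; the endpoint follows
  by continuity. This frees the Jacobian from its absolute value, which would spoil
  polynomiality.\<close>

lemma det_nonneg_of_monotone:
  fixes A :: "real^'n^'n"
  assumes A: "\<And>v. v \<bullet> (A *v v) \<ge> 0"
  shows "det A \<ge> 0"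
proof -
  define M where "M = (\<lambda>s. (1 - s) *\<^sub>R mat 1 + s *\<^sub>R A)"
  have Mv: "M s *v v = (1 - s) *\<^sub>R v + s *\<^sub>R (A *v v)" for s v
    by (simp add: M_def matrix_vector_mult_add_rdistrib scaleR_matrix_vector_assoc[symmetric])
  have cont: "continuous_on {0..1} (\<lambda>s. det (M s))"
    unfolding det_def M_def by (intro continuous_intros)
  have nz: "det (M s) \<noteq> 0" if s: "0 \<le> s" "s < 1" for s
  proof
    assume "det (M s) = 0"
    then obtain v where v: "v \<noteq> 0" "M s *v v = 0"
      by (metis invertible_det_nz invertible_left_inverse matrix_left_invertible_ker)
    then have "0 = v \<bullet> (M s *v v)" by simp
    also have "\<dots> = (1 - s) * (v \<bullet> v) + s * (v \<bullet> (A *v v))" by (simp add: Mv inner_add_right)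
    also have "\<dots> > 0" using s v A[of v] by (intro add_pos_nonneg) auto
    finally show False by simp
  qed
  have "det (M s) \<ge> 0" if s: "0 \<le> s" "s < 1" for s
  proof (rule ccontr)
    assume "\<not> ?thesis"
    then have neg: "det (M s) < 0" by simp
    have "\<exists>x. 0 \<le> x \<and> x \<le> s \<and> det (M x) = 0"
    proof (rule IVT2')
      show "continuous_on {0..s} (\<lambda>s. det (M s))" by (rule continuous_on_subset[OF cont]) (use s in auto)
    qed (use neg s in \<open>auto simp: M_def\<close>)
    then show False using nz s by (meson le_less_trans)
  qed
  then have ev: "eventually (\<lambda>s. 0 \<le> det (M s)) (at_left 1)"
    by (intro eventually_at_leftI[of 0]) auto
  have "((\<lambda>s. det (M s)) \<longlongrightarrow> det (M 1)) (at 1 within {0..1})"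
    using cont by (simp add: continuous_on_def)
  then have "((\<lambda>s. det (M s)) \<longlongrightarrow> det (M 1)) (at_left 1)"
    by (metis at_within_Icc_at_left zero_less_one)
  from tendsto_lowerbound[OF this ev] have "0 \<le> det (M 1)" by simp
  then show ?thesis by (simp add: M_def)
qed

text \<open>The difference quotient of \<open>v \<bullet> G\<close> along \<open>v\<close> is
  nonnegative for either sign of the step.\<close>

lemma monotone_imp_derivative_nonneg:
  fixes G :: "'a::euclidean_space \<Rightarrow> 'a"
  assumes mono: "\<And>x y. (G x - G y) \<bullet> (x - y) \<ge> 0" and D: "(G has_derivative G') (at x)"
  shows "v \<bullet> G' v \<ge> 0"
proof -
  have lin: "linear G'" using D by (rule has_derivative_linear)
  have "((\<lambda>s. G (x + s *\<^sub>R v)) has_derivative (\<lambda>s. G' (s *\<^sub>R v))) (at 0)"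
  proof (rule has_derivative_compose[of "\<lambda>s. x + s *\<^sub>R v" "\<lambda>s. s *\<^sub>R v" 0 UNIV G G'])
    show "((\<lambda>s. x + s *\<^sub>R v) has_derivative (\<lambda>s. s *\<^sub>R v)) (at 0)"
      by (auto intro!: derivative_eq_intros)
    show "(G has_derivative G') (at (x + 0 *\<^sub>R v))" using D by simp
  qed
  then have "((\<lambda>s. v \<bullet> G (x + s *\<^sub>R v)) has_derivative (\<lambda>s. v \<bullet> G' (s *\<^sub>R v))) (at 0)"
    by (rule has_derivative_inner_right)
  then have "((\<lambda>s. v \<bullet> G (x + s *\<^sub>R v)) has_real_derivative (v \<bullet> G' v)) (at 0)"
    unfolding has_field_derivative_def
    by (simp add: linear_scale[OF lin] mult.commute[of _ "v \<bullet> G' v"])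
  then have lim: "((\<lambda>s. (v \<bullet> G (x + s *\<^sub>R v) - v \<bullet> G x) / s) \<longlongrightarrow> v \<bullet> G' v) (at 0)"
    by (simp add: DERIV_def)
  have "0 \<le> (v \<bullet> G (x + s *\<^sub>R v) - v \<bullet> G x) / s" if "s \<noteq> 0" for s
  proof -
    have "0 \<le> (G (x + s *\<^sub>R v) - G x) \<bullet> ((x + s *\<^sub>R v) - x)" by (rule mono)
    also have "\<dots> = s * (v \<bullet> G (x + s *\<^sub>R v) - v \<bullet> G x)" by (simp add: inner_diff_left inner_diff_right inner_commute right_diff_distrib)
    finally show ?thesis by (simp add: zero_le_mult_iff zero_le_divide_iff conj_commute)
  qed
  then have "eventually (\<lambda>s. 0 \<le> (v \<bullet> G (x + s *\<^sub>R v) - v \<bullet> G x) / s) (at 0)"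
    by (simp add: eventually_at_filter)
  from tendsto_lowerbound[OF lim this] show ?thesis by simp
qed

text \<open>The Leibniz formula with affine polynomials as entries.\<close>

lemma det_add_scaleR_poly:
  fixes A B :: "real^'n^'n"
  obtains p where "degree p \<le> CARD('n)" "\<And>t. det (A + t *\<^sub>R B) = poly p t"
proof -
  define q where "q = (\<lambda>\<sigma>::'n \<Rightarrow> 'n. \<Prod>i\<in>UNIV. [:A $ i $ \<sigma> i, B $ i $ \<sigma> i:])"
  define p where "p = (\<Sum>\<sigma> | \<sigma> permutes UNIV. smult (of_int (sign \<sigma>)) (q \<sigma>))"
  have dq: "degree (q \<sigma>) \<le> CARD('n)" for \<sigma>
  proof -
    have "degree (q \<sigma>) \<le> (\<Sum>i\<in>(UNIV::'n set). degree [:A $ i $ \<sigma> i, B $ i $ \<sigma> i:])"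
      unfolding q_def using degree_prod_sum_le[of UNIV "\<lambda>i. [:A $ i $ \<sigma> i, B $ i $ \<sigma> i:]"] by (simp add: o_def)
    also have "\<dots> \<le> (\<Sum>i\<in>(UNIV::'n set). 1)" by (intro sum_mono) simp
    finally show ?thesis by simp
  qed
  have "degree p \<le> CARD('n)"
    unfolding p_def by (intro degree_sum_le finite_permutations order_trans[OF degree_smult_le] dq) simp
  moreover have "det (A + t *\<^sub>R B) = poly p t" for t
    by (simp add: det_def p_def q_def poly_sum poly_prod)
  ultimately show thesis by (rule that)
qed

definition lagrange_basis :: "nat \<Rightarrow> nat \<Rightarrow> real poly" where
  "lagrange_basis n j = (\<Prod>i\<in>{..n} - {j}. smult (1 / (real j - real i)) [:- real i, 1:])"

lemma degree_lagrange_basis: "j \<le> n \<Longrightarrow> degree (lagrange_basis n j) \<le> n"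
proof -
  assume j: "j \<le> n"
  have "degree (lagrange_basis n j) \<le> (\<Sum>i\<in>{..n} - {j}. degree (smult (1 / (real j - real i)) [:- real i, 1:]))"
    unfolding lagrange_basis_def by (rule degree_prod_sum_le[unfolded o_def]) simp
  also have "\<dots> \<le> (\<Sum>i\<in>{..n} - {j}. 1)" by (intro sum_mono order_trans[OF degree_smult_le]) simp
  finally show ?thesis using j by simp
qed

lemma poly_lagrange_basis:
  assumes "i \<le> n" "j \<le> n"
  shows "poly (lagrange_basis n j) (real i) = (if i = j then 1 else 0)"
  using assms
  by (auto simp: lagrange_basis_def poly_prod prod_zero_iff diff_divide_distrib[symmetric] intro!: prod.neutral)

text \<open>The difference of both sides has degree at most \<open>n\<close> and vanishes at the
  \<open>n + 1\<close> nodes 0, ..., \<open>n\<close>.\<close>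

lemma lagrange_interpolation:
  assumes p: "degree p \<le> n"
  shows "poly p t = (\<Sum>j\<le>n. poly p (real j) * poly (lagrange_basis n j) t)"
proof -
  define q where "q = p - (\<Sum>j\<le>n. smult (poly p (real j)) (lagrange_basis n j))"
  have dq: "degree q \<le> n"
    unfolding q_def using p
    by (intro degree_diff_le degree_sum_le order_trans[OF degree_smult_le] degree_lagrange_basis) auto
  have z: "poly q (real i) = 0" if i: "i \<le> n" for i
  proof -
    have "(\<Sum>j\<le>n. poly p (real j) * poly (lagrange_basis n j) (real i)) = (\<Sum>j\<le>n. if j = i then poly p (real j) else 0)"
      using i by (intro sum.cong refl) (auto simp: poly_lagrange_basis)
    also have "\<dots> = poly p (real i)" using i by simp
    finally show ?thesis by (simp add: q_def poly_sum)
  qed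
  have "q = 0"
  proof (rule ccontr)
    assume "q \<noteq> 0"
    then have "card {x. poly q x = 0} \<le> degree q" "finite {x. poly q x = 0}"
      by (auto intro: card_poly_roots_bound poly_roots_finite)
    moreover have "real ` {..n} \<subseteq> {x. poly q x = 0}" using z by auto
    ultimately have "card (real ` {..n}) \<le> n" using dq card_mono by (meson le_trans)
    then show False by (simp add: card_image)
  qed
  then have "poly (p - (\<Sum>j\<le>n. smult (poly p (real j)) (lagrange_basis n j))) t = 0" by (simp add: q_def)
  then show ?thesis by (simp add: poly_sum)
qed

text \<open>The volume is the integral over \<open>x\<close> of the Jacobian \<open>P x t\<close>, a
  polynomial in \<open>t\<close> for each \<open>x\<close>. Interpolation writes it as a combination
  of its values at \<open>n + 1\<close> nodes with weights independent of \<open>x\<close>. Only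
  those values, already known to be integrable, have to be integrated, rather than the
  coefficients.\<close>

lemma volume_polynomial_wellorder:
  fixes K E :: "(real^'m::{finite,wellorder}) set"
  assumes K: "compact K" "convex K" and Kpos: "measure lebesgue K > 0"
    and E: "compact E" "convex E" and Epos: "measure lebesgue E > 0"
  shows "\<exists>Q. degree Q \<le> CARD('m) \<and> (\<forall>t\<ge>0. measure lebesgue (K + (*\<^sub>R) t ` E) = poly Q t)"
proof -
  define n where "n = CARD('m)"
  define A where "A = (\<lambda>S x. matrix (frechet_derivative (tilted_mean S) (at x)) :: real^'m::_^'m::_)"
  have der: "(tilted_mean S has_derivative (\<lambda>h. A S x *v h)) (at x)" if "compact S" "measure lebesgue S > 0" for S and x :: "real^'m::_"
  proof -
    have d: "(tilted_mean S has_derivative frechet_derivative (tilted_mean S) (at x)) (at x)"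
      using tilted_mean_differentiable[OF that] frechet_derivative_works by blast
    moreover have "frechet_derivative (tilted_mean S) (at x) = (\<lambda>h. A S x *v h)"
      unfolding A_def using has_derivative_linear[OF d] by (simp add: matrix_vector_mul(1) fun_eq_iff matrix_works)
    ultimately show ?thesis by simp
  qed
  have psd: "v \<bullet> (A S x *v v) \<ge> 0" if S: "compact S" "measure lebesgue S > 0" for S and x v :: "real^'m::_"
  proof (rule monotone_imp_derivative_nonneg[OF _ der[OF S]])
    show "0 \<le> (tilted_mean S x - tilted_mean S y) \<bullet> (x - y)" for x y
      using tilted_mean_strict_mono[OF S, of x y] by (cases "x = y") auto
  qed
  define P where "P = (\<lambda>x t. det (A K x + t *\<^sub>R A E x))"
  have P0: "P x t \<ge> 0" if "t \<ge> 0" for x t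
  proof -
    have "v \<bullet> ((A K x + t *\<^sub>R A E x) *v v) = v \<bullet> (A K x *v v) + t * (v \<bullet> (A E x *v v))" for v
      by (simp add: matrix_vector_mult_add_rdistrib scaleR_matrix_vector_assoc[symmetric] inner_add_right)
    then show ?thesis
      unfolding P_def using psd[OF K(1) Kpos] psd[OF E(1) Epos] that by (intro det_nonneg_of_monotone) simp
  qed
  define V where "V = (\<lambda>t. measure lebesgue (K + (*\<^sub>R) t ` E))"
  have int: "((\<lambda>x. P x t) has_integral V t) UNIV" if t: "t \<ge> 0" for t
  proof -
    have "(mean_map K E t has_derivative (\<lambda>h. (A K x + t *\<^sub>R A E x) *v h)) (at x)" for x
    proof -
      have "(mean_map K E t has_derivative (\<lambda>h. A K x *v h + t *\<^sub>R (A E x *v h))) (at x)"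
        unfolding mean_map_def[abs_def] using K E Kpos Epos
        by (intro has_derivative_add has_derivative_scaleR_right der)
      then show ?thesis by (simp add: matrix_vector_mult_add_rdistrib scaleR_matrix_vector_assoc)
    qed
    then have "((\<lambda>x. \<bar>det (matrix (\<lambda>h. (A K x + t *\<^sub>R A E x) *v h))\<bar>) has_integral V t) UNIV"
      using mean_map_range_measure[OF K Kpos E Epos t] mean_map_inj[OF K Kpos E Epos t]
      by (intro has_measure_differentiable_image[THEN iffD1]) (auto simp: V_def)
    then show ?thesis using P0[OF t] by (simp add: P_def)
  qed
  define Q where "Q = (\<Sum>j\<le>n. smult (V (real j)) (lagrange_basis n j))"
  have "degree Q \<le> n"
    unfolding Q_def by (intro degree_sum_le order_trans[OF degree_smult_le] degree_lagrange_basis) auto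
  moreover have "V t = poly Q t" if t: "t \<ge> 0" for t
  proof -
    have "((\<lambda>x. \<Sum>j\<le>n. P x (real j) * poly (lagrange_basis n j) t) has_integral (\<Sum>j\<le>n. V (real j) * poly (lagrange_basis n j) t)) UNIV"
      by (intro has_integral_sum has_integral_mult_left int) auto
    moreover have "(\<Sum>j\<le>n. P x (real j) * poly (lagrange_basis n j) t) = P x t" for x
    proof -
      obtain p where "degree p \<le> CARD('m)" "\<And>t. P x t = poly p t"
        using det_add_scaleR_poly[of "A K x" "A E x"] unfolding P_def by metis
      then show ?thesis using lagrange_interpolation[of p n t] by (simp add: n_def)
    qed
    ultimately have "((\<lambda>x. P x t) has_integral (\<Sum>j\<le>n. V (real j) * poly (lagrange_basis n j) t)) UNIV" by simp
    then have "V t = (\<Sum>j\<le>n. V (real j) * poly (lagrange_basis n j) t)" using int[OF t] has_integral_unique by blast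
    then show ?thesis by (simp add: Q_def poly_sum)
  qed
  ultimately show ?thesis unfolding n_def V_def by blast
qed

text \<open>The change of variables theorem is available for well-ordered index types only; this is a
  well-ordered copy of an arbitrary finite index type.\<close>

typedef (overloaded) 'n idx = "{..<CARD('n::finite)}"
  by (rule exI[of _ 0]) simp

instantiation idx :: (finite) linorder
begin

definition less_eq_idx :: "'a idx \<Rightarrow> 'a idx \<Rightarrow> bool" where
  "less_eq_idx i j \<longleftrightarrow> Rep_idx i \<le> Rep_idx j"

definition less_idx :: "'a idx \<Rightarrow> 'a idx \<Rightarrow> bool" where
  "less_idx i j \<longleftrightarrow> Rep_idx i < Rep_idx j"

instance
  by standard (auto simp: less_eq_idx_def less_idx_def Rep_idx_inject)

end

instance idx :: (finite) wellorder
proof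
  fix P :: "'a idx \<Rightarrow> bool" and a
  assume step: "\<And>x. (\<And>y. y < x \<Longrightarrow> P y) \<Longrightarrow> P x"
  show "P a"
  proof (induction "Rep_idx a" arbitrary: a rule: less_induct)
    case less
    show ?case
    proof (rule step)
      fix y assume "y < a"
      then show "P y" by (intro less) (simp add: less_idx_def)
    qed
  qed
qed

lemma bij_betw_Rep_idx: "bij_betw (Rep_idx :: 'n::finite idx \<Rightarrow> nat) UNIV {..<CARD('n)}"
  unfolding bij_betw_def
  by (auto simp: inj_on_def Rep_idx_inject type_definition.Rep_range[OF type_definition_idx])

instance idx :: (finite) finite
proof
  show "finite (UNIV :: 'a idx set)" using bij_betw_finite[OF bij_betw_Rep_idx] by simp
qed

lemma card_idx: "CARD('n::finite idx) = CARD('n)"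
  using bij_betw_same_card[OF bij_betw_Rep_idx[where 'n='n]] by simp

lemma prod_Basis_cart:
  fixes x :: "real^'n"
  shows "(\<Prod>b\<in>Basis. x \<bullet> b) = (\<Prod>i\<in>UNIV. x $ i)"
proof -
  have "(Basis :: (real^'n) set) = range (\<lambda>i. axis i 1)" by (auto simp: Basis_vec_def)
  then have "(\<Prod>b\<in>Basis. x \<bullet> b) = (\<Prod>b\<in>range (\<lambda>i. axis i 1). x \<bullet> b)" by (simp only:)
  also have "\<dots> = (\<Prod>i\<in>UNIV. x \<bullet> axis i 1)"
    by (subst prod.reindex) (auto simp: inj_on_def axis_eq_axis)
  finally show ?thesis by (simp add: inner_axis)
qed

text \<open>Renaming coordinates sends boxes to boxes of the same volume, and a Borel measure with
  the volumes of boxes is Lebesgue measure.\<close>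

lemma measure_reindex:
  fixes \<pi> :: "'m::finite \<Rightarrow> 'n::finite" and S :: "(real^'n) set"
  assumes \<pi>: "bij \<pi>" and S: "compact S"
  shows "measure lebesgue ((\<lambda>x. \<chi> j. x $ \<pi> j) ` S) = measure lebesgue S"
proof -
  define T where "T = (\<lambda>x :: real^'n. (\<chi> j. x $ \<pi> j) :: real^'m)"
  define T' where "T' = (\<lambda>y :: real^'m. (\<chi> i. y $ inv \<pi> i) :: real^'n)"
  have TT': "T' (T x) = x" "T (T' y) = y" for x y
    using \<pi> by (auto simp: T_def T'_def vec_eq_iff bij_is_surj surj_f_inv_f bij_is_inj)
  have cT: "continuous_on A T" and cT': "continuous_on B T'" for A B
    unfolding T_def T'_def by (intro continuous_intros)+
  have [measurable]: "T \<in> borel_measurable borel" "T' \<in> borel_measurable borel"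
    using cT cT' by (auto intro: borel_measurable_continuous_onI)
  have "lborel = distr lborel borel T"
  proof (rule lborel_eqI)
    fix l u :: "real^'m" assume lu: "\<And>b. b \<in> Basis \<Longrightarrow> l \<bullet> b \<le> u \<bullet> b"
    have lu': "l $ j \<le> u $ j" for j
      using lu[of "axis j 1"] by (simp add: inner_axis axis_in_Basis_iff)
    have pre: "T -` box l u = box (T' l) (T' u)"
    proof -
      have "T x \<in> box l u \<longleftrightarrow> x \<in> box (T' l) (T' u)" for x
        using \<pi> unfolding mem_box_cart T_def T'_def
        by (auto simp: bij_is_surj bij_is_inj inv_f_f surj_f_inv_f) (metis bij_inv_eq_iff)+
      then show ?thesis by auto
    qed
    have "emeasure (distr lborel borel T) (box l u) = emeasure lborel (box (T' l) (T' u))"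
      by (subst emeasure_distr) (auto simp: pre)
    also have "\<dots> = (\<Prod>b\<in>Basis. (T' u - T' l) \<bullet> b)"
      using lu' by (intro emeasure_lborel_box) (auto simp: Basis_vec_def inner_axis T'_def)
    also have "(\<Prod>b\<in>Basis. (T' u - T' l) \<bullet> b) = (\<Prod>i\<in>UNIV. T' u $ i - T' l $ i)"
      by (subst prod_Basis_cart) simp
    also have "\<dots> = (\<Prod>j\<in>UNIV. u $ j - l $ j)"
      unfolding T'_def using prod.reindex_bij_betw[OF bij_imp_bij_inv[OF \<pi>], of "\<lambda>j. u $ j - l $ j"] by simp
    also have "\<dots> = (\<Prod>b\<in>Basis. (u - l) \<bullet> b)"
      by (subst prod_Basis_cart) simp
    finally show "emeasure (distr lborel borel T) (box l u) = (\<Prod>b\<in>Basis. (u - l) \<bullet> b)" .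
  qed simp
  moreover have cS: "compact (T ` S)" by (rule compact_continuous_image[OF cT S])
  ultimately have "emeasure lborel (T ` S) = emeasure (distr lborel borel T) (T ` S)" by simp
  also have "\<dots> = emeasure lborel (T -` (T ` S))"
    using cS by (subst emeasure_distr) (auto intro: borel_compact)
  also have "T -` (T ` S) = S" using TT' by (metis inj_on_def inj_vimage_image_eq)
  finally have "measure lborel (T ` S) = measure lborel S" by (simp add: measure_def)
  then show ?thesis
    using S cS unfolding T_def by (simp add: measure_completion borel_compact)
qed

lemma set_plus_eq_Collect: "{x + t *\<^sub>R y |x y. x \<in> K \<and> y \<in> E} = K + (*\<^sub>R) t ` E"
  by (auto simp: set_plus_def)

theorem steiner_coeffs_exist:
  fixes K E :: "(real^'n) set"
  assumes K: "compact K" "convex K" and Kpos: "measure lebesgue K > 0"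
    and E: "compact E" "convex E" and Epos: "measure lebesgue E > 0"
  shows "\<exists>W. steiner_coeffs K E W"
proof -
  have "card (UNIV :: 'n idx set) = card (UNIV :: 'n set)" by (rule card_idx)
  then obtain \<pi> :: "'n idx \<Rightarrow> 'n" where \<pi>: "bij \<pi>"
    using finite_same_card_bij[of "UNIV :: 'n idx set" "UNIV :: 'n set"] by auto
  define T where "T = (\<lambda>x :: real^'n. (\<chi> j. x $ \<pi> j) :: real^('n idx))"
  have lin: "linear T" by (auto simp: T_def linear_iff vec_eq_iff)
  have m: "measure lebesgue (T ` S) = measure lebesgue S" if "compact S" for S
    unfolding T_def by (rule measure_reindex[OF \<pi> that])
  have c: "compact (T ` S)" if "compact S" for S
    using that linear_continuous_on[of T S] lin by (intro compact_continuous_image) (simp_all add: linear_conv_bounded_linear)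
  obtain Q where Q: "degree Q \<le> CARD('n idx)" "\<And>t. t \<ge> 0 \<Longrightarrow> measure lebesgue (T ` K + (*\<^sub>R) t ` (T ` E)) = poly Q t"
    using volume_polynomial_wellorder[of "T ` K" "T ` E"] K E Kpos Epos m c convex_linear_image[OF lin] by auto
  have "T ` K + (*\<^sub>R) t ` (T ` E) = T ` (K + (*\<^sub>R) t ` E)" for t
    by (auto simp: set_plus_def image_iff linear_add[OF lin] linear_scale[OF lin]) (metis linear_add[OF lin] linear_scale[OF lin])+
  moreover have "compact (K + (*\<^sub>R) t ` E)" for t by (intro compact_set_plus K compact_scaling E)
  ultimately have Q': "measure lebesgue (K + (*\<^sub>R) t ` E) = poly Q t" if "t \<ge> 0" for t
    using Q(2)[OF that] m by simp
  define W where "W = (\<lambda>i. coeff Q i / (CARD('n) choose i))"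
  have "poly Q t = (\<Sum>i\<le>CARD('n). real (CARD('n) choose i) * W i * t ^ i)" for t
  proof -
    have "poly Q t = (\<Sum>i\<le>CARD('n). coeff Q i * t ^ i)"
      unfolding poly_altdef using Q(1) by (intro sum.mono_neutral_left) (auto simp: card_idx coeff_eq_0)
    then show ?thesis by (simp add: W_def)
  qed
  then have "steiner_coeffs K E W" unfolding steiner_coeffs_def set_plus_eq_Collect using Q' by simp
  then show ?thesis by blast
qed

section \<open>Volume of Wulff shapes\<close>

lemma lborel_integral_translate:
  fixes f :: "'a::euclidean_space \<Rightarrow> real"
  assumes "f \<in> borel_measurable borel"
  shows "(LINT x|lborel. f (x + c)) = (LINT x|lborel. f x)"
proof -
  have "(LINT x|lborel. f x) = (LINT x|distr lborel borel ((+) c). f x)" by (simp add: lborel_distr_plus)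
  also have "\<dots> = (LINT x|lborel. f (c + x))" using assms by (intro integral_distr) auto
  finally show ?thesis by (simp add: add.commute)
qed

lemma integrable_lborel_compact_support:
  fixes f :: "'a::euclidean_space \<Rightarrow> real"
  assumes "continuous_on UNIV f" "\<And>x. x \<notin> cball 0 R \<Longrightarrow> f x = 0"
  shows "integrable lborel f"
proof -
  have "integrable lborel (\<lambda>x. indicator (cball 0 R) x *\<^sub>R f x)"
    by (intro borel_integrable_compact continuous_on_subset[OF assms(1)]) auto
  moreover have "(\<lambda>x. indicator (cball 0 R) x *\<^sub>R f x) = f" using assms(2) by (auto simp: indicator_def fun_eq_iff)
  ultimately show ?thesis by simp
qed

text \<open>Discrete integration by parts: a translation moves one of the two differences from
  \<open>p\<close> to the tent function \<open>w\<close>. The integrand becomes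
  \<open>(w x - w (x + h)) * (p (x + h) - p x)\<close>, a product of two factors of order
  \<open>t\<close>, supported in a ball.\<close>

lemma second_difference_weighted_integral_le:
  fixes p :: "'a::euclidean_space \<Rightarrow> real"
  assumes L: "\<And>x y. \<bar>p x - p y\<bar> \<le> L * norm (x - y)" and v: "norm v = 1" and t: "0 < t" "t \<le> 1" and R: "R > 0"
  defines "w \<equiv> (\<lambda>x. max 0 (R - norm x))"
  shows "(LINT x|lborel. w x * (p (x + t *\<^sub>R v) + p (x - t *\<^sub>R v) - 2 * p x)) \<le> t\<^sup>2 * (L * measure lborel (cball (0::'a) (R + 1)))"
    and "integrable lborel (\<lambda>x. w x * (p (x + t *\<^sub>R v) + p (x - t *\<^sub>R v) - 2 * p x))"
proof -
  have L0: "L \<ge> 0" using L[of v 0] v by (auto intro: order_trans[OF abs_ge_zero])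
  have contp: "continuous_on UNIV p"
  proof (rule continuous_onI)
    fix x e assume "(e::real) > 0"
    then show "\<exists>d>0. \<forall>x'\<in>UNIV. dist x' x < d \<longrightarrow> dist (p x') (p x) \<le> e"
    proof (intro exI[of _ "e / (L + 1)"] conjI ballI impI)
      fix x' assume "dist x' x < e / (L + 1)"
      then have "(L + 1) * norm (x' - x) < e" using L0 by (simp add: dist_norm field_simps)
      moreover have "L * norm (x' - x) \<le> (L + 1) * norm (x' - x)" by (intro mult_right_mono) auto
      ultimately show "dist (p x') (p x) \<le> e" using L[of x' x] by (simp add: dist_real_def)
    qed (use L0 in auto)
  qed
  have cp: "continuous_on UNIV (\<lambda>x. p (x + c))" for c
    by (rule continuous_on_compose2[OF contp]) (auto intro!: continuous_intros)
  have cw: "continuous_on UNIV (\<lambda>x. w (x + c))" for c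
    unfolding w_def by (intro continuous_intros)
  have w0: "w x = 0" if "norm x \<ge> R" for x using that by (simp add: w_def)
  have int: "integrable lborel (\<lambda>x. w (x + a) * p (x + b))" if a: "norm a \<le> 1" for a b
  proof (rule integrable_lborel_compact_support[where R="R + 1"])
    show "w (x + a) * p (x + b) = 0" if "x \<notin> cball 0 (R + 1)" for x
    proof -
      have "norm x \<le> norm (x + a) + norm a" by norm
      then have "norm (x + a) \<ge> R" using that a by simp
      then show ?thesis using w0 by simp
    qed
  qed (intro continuous_intros cw cp)
  define h where "h = t *\<^sub>R v"
  have nh: "norm h = t" using v t by (simp add: h_def)
  then have nh1: "norm h \<le> 1" "norm (- h) \<le> 1" "norm (0::'a) \<le> 1" using t by auto
  note I = int[OF nh1(1)] int[OF nh1(2)] int[OF nh1(3)]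
  have e: "w x * (p (x + h) + p (x - h) - 2 * p x) = w (x + 0) * p (x + h) + w (x + 0) * p (x + - h) - 2 * (w (x + 0) * p (x + 0))" for x
    by (simp add: algebra_simps)
  show "integrable lborel (\<lambda>x. w x * (p (x + t *\<^sub>R v) + p (x - t *\<^sub>R v) - 2 * p x))"
    unfolding h_def[symmetric] e by (intro Bochner_Integration.integrable_diff Bochner_Integration.integrable_add integrable_mult_right I)
  have bm: "(\<lambda>x. w (x + a) * p (x + b)) \<in> borel_measurable borel" for a b
    by (intro borel_measurable_continuous_onI continuous_intros cw cp)
  have t1: "(LINT x|lborel. w (x + 0) * p (x + 0)) = (LINT x|lborel. w (x + h) * p (x + h))"
    using lborel_integral_translate[OF bm[of 0 0], of h] by simp
  have t2: "(LINT x|lborel. w (x + 0) * p (x + - h)) = (LINT x|lborel. w (x + h) * p (x + 0))"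
    using lborel_integral_translate[OF bm[of 0 "- h"], of h] by (simp add: add.assoc)
  have "(LINT x|lborel. w x * (p (x + h) + p (x - h) - 2 * p x)) =
    (LINT x|lborel. w (x + 0) * p (x + h)) + (LINT x|lborel. w (x + 0) * p (x + - h)) - 2 * (LINT x|lborel. w (x + 0) * p (x + 0))"
    unfolding e using I(3)[of h] I(3)[of "- h"] I(3)[of 0] by simp
  also have "\<dots> = (LINT x|lborel. w (x + 0) * p (x + h)) - (LINT x|lborel. w (x + h) * p (x + h))
     - ((LINT x|lborel. w (x + 0) * p (x + 0)) - (LINT x|lborel. w (x + h) * p (x + 0)))"
    using t1 t2 by simp
  also have "\<dots> = (LINT x|lborel. w (x + 0) * p (x + h) - w (x + h) * p (x + h) - (w (x + 0) * p (x + 0) - w (x + h) * p (x + 0)))"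
    using I(3)[of h] I(1)[of h] I(3)[of 0] I(1)[of 0] by simp
  also have "\<dots> \<le> (LINT x|lborel. t\<^sup>2 * L * indicator (cball (0::'a) (R + 1)) x)"
  proof (rule Bochner_Integration.integral_mono)
    show "integrable lborel (\<lambda>x. w (x + 0) * p (x + h) - w (x + h) * p (x + h) - (w (x + 0) * p (x + 0) - w (x + h) * p (x + 0)))"
      by (intro Bochner_Integration.integrable_diff I)
    show "integrable lborel (\<lambda>x. t\<^sup>2 * L * indicator (cball (0::'a) (R + 1)) x)"
      using emeasure_bounded_finite[of "cball (0::'a) (R + 1)"] by (intro integrable_mult_right integrable_real_indicator) auto
    fix x :: 'a
    have eq: "w (x + 0) * p (x + h) - w (x + h) * p (x + h) - (w (x + 0) * p (x + 0) - w (x + h) * p (x + 0)) = (w x - w (x + h)) * (p (x + h) - p x)"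
      by (simp add: algebra_simps)
    show "w (x + 0) * p (x + h) - w (x + h) * p (x + h) - (w (x + 0) * p (x + 0) - w (x + h) * p (x + 0)) \<le> t\<^sup>2 * L * indicator (cball 0 (R + 1)) x"
    proof (cases "x \<in> cball 0 (R + 1)")
      case True
      have "\<bar>norm x - norm (x + h)\<bar> \<le> norm h" by norm
      then have 1: "\<bar>w x - w (x + h)\<bar> \<le> t" unfolding w_def nh by linarith
      have 2: "\<bar>p (x + h) - p x\<bar> \<le> L * t" using L[of "x + h" x] nh by simp
      have "(w x - w (x + h)) * (p (x + h) - p x) \<le> \<bar>w x - w (x + h)\<bar> * \<bar>p (x + h) - p x\<bar>"
        by (metis abs_ge_self abs_mult)
      also have "\<dots> \<le> t * (L * t)" using 1 2 t by (intro mult_mono) auto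
      finally show ?thesis using True unfolding eq by (simp add: power2_eq_square mult_ac)
    next
      case False
      have "norm x \<le> norm (x + h) + norm h" by norm
      then have "w x = 0" "w (x + h) = 0" using False nh1 by (auto intro!: w0)
      then show ?thesis using False unfolding eq by simp
    qed
  qed
  also have "\<dots> = t\<^sup>2 * (L * measure lborel (cball (0::'a) (R + 1)))"
    using emeasure_bounded_finite[of "cball (0::'a) (R + 1)"] by simp
  finally show "(LINT x|lborel. w x * (p (x + t *\<^sub>R v) + p (x - t *\<^sub>R v) - 2 * p x)) \<le> t\<^sup>2 * (L * measure lborel (cball (0::'a) (R + 1)))"
    by (simp add: h_def)
qed

text \<open>Chords of a convex function have increasing slopes, here added for the two opposite
  directions. Smallness of the quotient at one \<open>t\<close> therefore persists for all smaller
  ones.\<close>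

lemma convex_second_difference_quotient_mono:
  fixes p :: "'a::real_vector \<Rightarrow> real"
  assumes p: "convex_on UNIV p" and st: "0 < s" "s \<le> t"
  shows "(p (x + s *\<^sub>R v) + p (x - s *\<^sub>R v) - 2 * p x) / s \<le> (p (x + t *\<^sub>R v) + p (x - t *\<^sub>R v) - 2 * p x) / t"
    and "0 \<le> (p (x + s *\<^sub>R v) + p (x - s *\<^sub>R v) - 2 * p x) / s"
proof -
  define c where "c = s / t"
  have c: "0 \<le> c" "c \<le> 1" "s = c * t" using st by (auto simp: c_def)
  have "p ((1 - c) *\<^sub>R x + c *\<^sub>R (x + t *\<^sub>R v)) \<le> (1 - c) * p x + c * p (x + t *\<^sub>R v)"
    using c by (intro convex_onD[OF p]) auto
  moreover have "(1 - c) *\<^sub>R x + c *\<^sub>R (x + t *\<^sub>R v) = x + s *\<^sub>R v" by (simp add: c(3) algebra_simps)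
  ultimately have 1: "p (x + s *\<^sub>R v) \<le> (1 - c) * p x + c * p (x + t *\<^sub>R v)" by simp
  have "p ((1 - c) *\<^sub>R x + c *\<^sub>R (x - t *\<^sub>R v)) \<le> (1 - c) * p x + c * p (x - t *\<^sub>R v)"
    using c by (intro convex_onD[OF p]) auto
  moreover have "(1 - c) *\<^sub>R x + c *\<^sub>R (x - t *\<^sub>R v) = x - s *\<^sub>R v" by (simp add: c(3) algebra_simps)
  ultimately have 2: "p (x - s *\<^sub>R v) \<le> (1 - c) * p x + c * p (x - t *\<^sub>R v)" by simp
  have "p (x + s *\<^sub>R v) + p (x - s *\<^sub>R v) - 2 * p x \<le> c * (p (x + t *\<^sub>R v) + p (x - t *\<^sub>R v) - 2 * p x)"
    using add_mono[OF 1 2] by (simp add: algebra_simps)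
  then show "(p (x + s *\<^sub>R v) + p (x - s *\<^sub>R v) - 2 * p x) / s \<le> (p (x + t *\<^sub>R v) + p (x - t *\<^sub>R v) - 2 * p x) / t"
    using st by (simp add: c_def field_simps)
  have "p ((1 - 1/2) *\<^sub>R (x - s *\<^sub>R v) + (1/2) *\<^sub>R (x + s *\<^sub>R v)) \<le> (1 - 1/2) * p (x - s *\<^sub>R v) + (1/2) * p (x + s *\<^sub>R v)"
    by (intro convex_onD[OF p]) auto
  moreover have "(1 - 1/2) *\<^sub>R (x - s *\<^sub>R v) + (1/2) *\<^sub>R (x + s *\<^sub>R v) = x"
    by (simp add: algebra_simps flip: scaleR_add_left)
  ultimately have "0 \<le> p (x + s *\<^sub>R v) + p (x - s *\<^sub>R v) - 2 * p x" by simp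
  then show "0 \<le> (p (x + s *\<^sub>R v) + p (x - s *\<^sub>R v) - 2 * p x) / s" using st by simp
qed

text \<open>The quotients \<open>\<phi> k\<close> are nonnegative with weighted integral of order
  \<open>t k\<close>, so their infimum \<open>\<Phi>\<close> vanishes almost everywhere. By
  monotonicity in the step a single small member of the sequence controls all smaller steps.\<close>

lemma AE_second_difference:
  fixes p :: "'a::euclidean_space \<Rightarrow> real"
  assumes p: "convex_on UNIV p" and L: "\<And>x y. \<bar>p x - p y\<bar> \<le> L * norm (x - y)" and v: "norm v = 1"
  shows "AE x in lborel. \<forall>e>0. \<exists>d>0. \<forall>t. 0 < t \<and> t < d \<longrightarrow> p (x + t *\<^sub>R v) + p (x - t *\<^sub>R v) - 2 * p x \<le> e * t"
proof -
  define t where "t = (\<lambda>k. 1 / real (Suc k))"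
  have t: "0 < t k" "t k \<le> 1" for k by (auto simp: t_def)
  have t_lim: "t \<longlonglongrightarrow> 0" unfolding t_def by (rule lim_1_over_n[THEN LIMSEQ_Suc])
  define \<phi> where "\<phi> = (\<lambda>k x. (p (x + t k *\<^sub>R v) + p (x - t k *\<^sub>R v) - 2 * p x) / t k)"
  have ph0: "\<phi> k x \<ge> 0" for k x unfolding \<phi>_def by (rule convex_second_difference_quotient_mono(2)[OF p t(1) order_refl])
  have contp: "continuous_on UNIV p"
    using convex_on_continuous[OF open_UNIV p] .
  have cp: "continuous_on UNIV (\<lambda>x. p (x + c))" "continuous_on UNIV (\<lambda>x. p (x - c))" for c
    by (rule continuous_on_compose2[OF contp]; auto intro!: continuous_intros)+
  have [measurable]: "\<phi> k \<in> borel_measurable borel" for k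
    unfolding \<phi>_def by (intro borel_measurable_continuous_onI continuous_intros cp contp) (use t in \<open>simp add: less_imp_neq[symmetric]\<close>)
  define \<Phi> where "\<Phi> = (\<lambda>x. INF k. ennreal (\<phi> k x))"
  have [measurable]: "\<Phi> \<in> borel_measurable borel" unfolding \<Phi>_def by measurable
  have ballAE: "AE x in lborel. norm x < R \<longrightarrow> \<Phi> x = 0" if R: "R > 0" for R
  proof -
    define w where "w = (\<lambda>x::'a. max 0 (R - norm x))"
    have [measurable]: "w \<in> borel_measurable borel" unfolding w_def by measurable
    have w0: "w x \<ge> 0" for x by (simp add: w_def)
    define C where "C = L * measure lborel (cball (0::'a) (R + 1))"
    have bd: "(\<integral>\<^sup>+x. ennreal (w x) * \<Phi> x \<partial>lborel) \<le> ennreal (t k * C)" for k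
    proof -
      have eq: "w x * \<phi> k x = (1 / t k) * (w x * (p (x + t k *\<^sub>R v) + p (x - t k *\<^sub>R v) - 2 * p x))" for x
        by (simp add: \<phi>_def)
      have sd: "(LINT x|lborel. w x * (p (x + t k *\<^sub>R v) + p (x - t k *\<^sub>R v) - 2 * p x)) \<le> (t k)\<^sup>2 * C"
        "integrable lborel (\<lambda>x. w x * (p (x + t k *\<^sub>R v) + p (x - t k *\<^sub>R v) - 2 * p x))"
        unfolding w_def C_def using second_difference_weighted_integral_le[OF L v t(1)[of k] t(2)[of k] R] by simp_all
      have nn: "0 \<le> (1 / t k) * (w x * (p (x + t k *\<^sub>R v) + p (x - t k *\<^sub>R v) - 2 * p x))" for x
        unfolding eq[symmetric] using w0[of x] ph0[of k x] by simp
      have "(\<integral>\<^sup>+x. ennreal (w x) * \<Phi> x \<partial>lborel) \<le> (\<integral>\<^sup>+x. ennreal (w x * \<phi> k x) \<partial>lborel)"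
        using w0 ph0 by (intro nn_integral_mono) (auto simp: ennreal_mult \<Phi>_def intro!: mult_left_mono INF_lower)
      also have "\<dots> = ennreal (LINT x|lborel. w x * \<phi> k x)"
        unfolding eq by (intro nn_integral_eq_integral integrable_mult_right sd(2) AE_I2 nn)
      also have "\<dots> \<le> ennreal (t k * C)"
      proof (rule ennreal_leI)
        have "(LINT x|lborel. w x * \<phi> k x) = (1 / t k) * (LINT x|lborel. w x * (p (x + t k *\<^sub>R v) + p (x - t k *\<^sub>R v) - 2 * p x))"
          unfolding eq by simp
        also have "\<dots> \<le> (1 / t k) * ((t k)\<^sup>2 * C)"
          using t[of k] by (intro mult_left_mono sd(1)) auto
        also have "\<dots> = t k * C" using t[of k] by (simp add: power2_eq_square)
        finally show "(LINT x|lborel. w x * \<phi> k x) \<le> t k * C" .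
      qed
      finally show ?thesis .
    qed
    have "(\<lambda>k. ennreal (t k * C)) \<longlonglongrightarrow> ennreal (0 * C)" by (intro tendsto_intros t_lim)
    then have "(\<integral>\<^sup>+x. ennreal (w x) * \<Phi> x \<partial>lborel) \<le> ennreal (0 * C)"
      using bd by (intro LIMSEQ_le_const) auto
    then have "(\<integral>\<^sup>+x. ennreal (w x) * \<Phi> x \<partial>lborel) = 0" by simp
    then have "AE x in lborel. ennreal (w x) * \<Phi> x = 0" by (subst (asm) nn_integral_0_iff_AE) auto
    then show ?thesis by eventually_elim (auto simp: w_def)
  qed
  have "AE x in lborel. \<forall>R::nat. norm x < real (Suc R) \<longrightarrow> \<Phi> x = 0"
    unfolding AE_all_countable using ballAE by simp
  then have "AE x in lborel. \<Phi> x = 0"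
  proof eventually_elim
    case (elim x)
    obtain R :: nat where "norm x < real R" using reals_Archimedean2 by blast
    then have "norm x < real (Suc R)" by simp
    then show ?case using elim by blast
  qed
  then show ?thesis
  proof eventually_elim
    case (elim x)
    show ?case
    proof (intro allI impI)
      fix e :: real assume e: "e > 0"
      then have "(INF k. ennreal (\<phi> k x)) < ennreal e" using elim by (simp add: \<Phi>_def)
      then obtain k where "ennreal (\<phi> k x) < ennreal e" by (auto simp: INF_less_iff)
      then have k: "\<phi> k x < e" using ph0 by (simp add: ennreal_less_iff)
      show "\<exists>d>0. \<forall>t. 0 < t \<and> t < d \<longrightarrow> p (x + t *\<^sub>R v) + p (x - t *\<^sub>R v) - 2 * p x \<le> e * t"
      proof (intro exI[of _ "t k"] conjI allI impI t)
        fix s assume s: "0 < s \<and> s < t k"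
        have "(p (x + s *\<^sub>R v) + p (x - s *\<^sub>R v) - 2 * p x) / s \<le> \<phi> k x"
          unfolding \<phi>_def using s by (intro convex_second_difference_quotient_mono(1)[OF p]) auto
        also have "\<dots> \<le> e" using k by simp
        finally show "p (x + s *\<^sub>R v) + p (x - s *\<^sub>R v) - 2 * p x \<le> e * s" using s by (simp add: divide_le_eq)
      qed
    qed
  qed
qed

text \<open>A convex function with vanishing second differences along the axes is differentiable, and its
  derivative is the unique subgradient; only the upper estimate needs an argument.\<close>

lemma convex_directional_upper_bound:
  fixes p :: "'a::euclidean_space \<Rightarrow> real"
  assumes p: "convex_on UNIV p" and sub: "\<And>y. p y \<ge> p x + a \<bullet> (y - x)"
    and sd: "\<And>i e. i \<in> Basis \<Longrightarrow> e > 0 \<Longrightarrow> \<exists>d>0. \<forall>t. 0 < t \<and> t < d \<longrightarrow> p (x + t *\<^sub>R i) + p (x - t *\<^sub>R i) - 2 * p x \<le> e * t"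
    and e: "e > 0"
  shows "\<exists>d>0. \<forall>t. 0 < t \<and> t < d \<longrightarrow> p (x + t *\<^sub>R v) \<le> p x + t * (a \<bullet> v) + e * t"
proof -
  define n where "n = real DIM('a)"
  have n: "n > 0" by (simp add: n_def)
  define S where "S = (\<Sum>i\<in>Basis. \<bar>v \<bullet> i\<bar>)"
  have S0: "S \<ge> 0" by (simp add: S_def sum_nonneg)
  define e' where "e' = e / (S + 1)"
  have e': "e' > 0" "e' * S \<le> e" using e S0 by (auto simp: e'_def field_simps)
  have "\<forall>i\<in>Basis. \<exists>d>0. \<forall>t. 0 < t \<and> t < d \<longrightarrow> p (x + t *\<^sub>R i) + p (x - t *\<^sub>R i) - 2 * p x \<le> e' * t"
    using sd e' by blast
  then obtain D where D: "\<And>i. i \<in> Basis \<Longrightarrow> D i > 0" 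
    "\<And>i t. i \<in> Basis \<Longrightarrow> 0 < t \<Longrightarrow> t < D i \<Longrightarrow> p (x + t *\<^sub>R i) + p (x - t *\<^sub>R i) - 2 * p x \<le> e' * t"
    by metis
  have line: "p (x + s *\<^sub>R i) \<le> p x + s * (a \<bullet> i) + e' * \<bar>s\<bar>" if i: "i \<in> Basis" "\<bar>s\<bar> < D i" for i s
  proof -
    have 1: "p (x - s *\<^sub>R i) \<ge> p x - s * (a \<bullet> i)" using sub[of "x - s *\<^sub>R i"] by simp
    have "p (x + s *\<^sub>R i) + p (x - s *\<^sub>R i) - 2 * p x \<le> e' * \<bar>s\<bar>"
      using D(2)[OF i(1), of "\<bar>s\<bar>"] i(2) by (cases s "0::real" rule: linorder_cases) (auto simp: add.commute)
    then show ?thesis using 1 by linarith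
  qed
  \<comment> \<open>Chosen so that \<open>n * t * \<bar>v \<bullet> i\<bar>\<close> stays below
    every \<open>D i\<close>; adding 1 to \<open>S\<close> keeps the denominator positive when
    \<open>v\<close> is zero.\<close>
  define d where "d = Min (D ` Basis) / (n * (S + 1))"
  have mp: "Min (D ` Basis) > 0" using D(1) by (subst Min_gr_iff) auto
  have d: "d > 0" using mp n S0 by (simp add: d_def)
  show ?thesis
  proof (intro exI[of _ d] conjI allI impI d)
    fix t assume t: "0 < t \<and> t < d"
    have small: "\<bar>n * t * (v \<bullet> i)\<bar> < D i" if i: "i \<in> Basis" for i
    proof -
      have vi: "\<bar>v \<bullet> i\<bar> \<le> S" unfolding S_def by (rule member_le_sum[OF i]) auto
      have "\<bar>n * t * (v \<bullet> i)\<bar> = n * t * \<bar>v \<bullet> i\<bar>" using n t by (simp add: abs_mult)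
      also have "\<dots> \<le> n * t * (S + 1)" using vi n t by (intro mult_left_mono) auto
      also have "\<dots> < n * d * (S + 1)" using n t S0 by (intro mult_strict_right_mono mult_strict_left_mono) auto
      also have "\<dots> = Min (D ` Basis)" using n S0 by (simp add: d_def)
      also have "\<dots> \<le> D i" using i by simp
      finally show ?thesis .
    qed
    \<comment> \<open>The displaced point is the average of \<open>n\<close> points, each moved
      along one axis by \<open>n\<close> times the corresponding coordinate; convexity then reduces
      to the axes.\<close>
    have eq: "x + t *\<^sub>R v = (\<Sum>i\<in>Basis. (1 / n) *\<^sub>R (x + (n * t * (v \<bullet> i)) *\<^sub>R i))"
    proof -
      have "(\<Sum>i\<in>Basis. (1 / n) *\<^sub>R (x + (n * t * (v \<bullet> i)) *\<^sub>R i)) = (\<Sum>i\<in>(Basis::'a set). (1 / n) *\<^sub>R x) + t *\<^sub>R (\<Sum>i\<in>Basis. (v \<bullet> i) *\<^sub>R i)"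
        using n by (simp add: sum.distrib scaleR_add_right scaleR_sum_right del: sum_constant sum_constant_scaleR)
      also have "(\<Sum>i\<in>(Basis::'a set). (1 / n) *\<^sub>R x) = x" using n by (simp add: n_def sum_constant_scaleR)
      finally show ?thesis by (simp add: euclidean_representation)
    qed
    have "p (x + t *\<^sub>R v) \<le> (\<Sum>i\<in>Basis. (1 / n) * p (x + (n * t * (v \<bullet> i)) *\<^sub>R i))"
      unfolding eq using n by (intro convex_on_sum[OF _ _ p]) (auto simp: n_def)
    also have "\<dots> \<le> (\<Sum>i\<in>Basis. (1 / n) * (p x + (n * t * (v \<bullet> i)) * (a \<bullet> i) + e' * \<bar>n * t * (v \<bullet> i)\<bar>))"
      using n by (intro sum_mono mult_left_mono line small) auto
    also have "\<dots> = (\<Sum>i\<in>(Basis::'a set). (1 / n) * p x) + t * (\<Sum>i\<in>Basis. (a \<bullet> i) * (v \<bullet> i)) + (e' * t) * S"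
      unfolding S_def sum_distrib_left sum.distrib[symmetric] using n t
      by (intro sum.cong refl) (simp add: abs_mult field_simps)
    also have "(\<Sum>i\<in>(Basis::'a set). (1 / n) * p x) = p x" using n by (simp add: n_def)
    also have "(\<Sum>i\<in>Basis. (a \<bullet> i) * (v \<bullet> i)) = a \<bullet> v" by (rule euclidean_inner[symmetric])
    also have "(e' * t) * S = (e' * S) * t" by simp
    also have "p x + t * (a \<bullet> v) + (e' * S) * t \<le> p x + t * (a \<bullet> v) + e * t" using e' t by (intro add_left_mono mult_right_mono) auto
    finally show "p (x + t *\<^sub>R v) \<le> p x + t * (a \<bullet> v) + e * t" by simp
  qed
qed

section \<open>Support functions, Wulff shapes and their first variation\<close>

lemma support_fun_ge:
  assumes "compact E" "x \<in> E"
  shows "x \<bullet> u \<le> support_fun E u"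
proof -
  have "bdd_above ((\<lambda>x. x \<bullet> u) ` E)"
    by (intro compact_imp_bounded bounded_imp_bdd_above compact_continuous_image assms continuous_intros)
  then show ?thesis unfolding support_fun_def using assms by (intro cSUP_upper)
qed

lemma support_fun_attained:
  assumes "compact E" "E \<noteq> {}"
  obtains x where "x \<in> E" "x \<bullet> u = support_fun E u"
proof -
  have "continuous_on E (\<lambda>x. x \<bullet> u)" by (intro continuous_intros)
  then obtain x where x: "x \<in> E" "\<And>y. y \<in> E \<Longrightarrow> y \<bullet> u \<le> x \<bullet> u"
    using continuous_attains_sup[OF assms] by blast
  have "support_fun E u \<le> x \<bullet> u" unfolding support_fun_def using assms x by (intro cSUP_least) auto
  then show thesis using that[of x] x support_fun_ge[OF assms(1) x(1), of u] by (simp add: antisym)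
qed

lemma support_fun_le:
  assumes "E \<noteq> {}" "\<And>x. x \<in> E \<Longrightarrow> x \<bullet> u \<le> c"
  shows "support_fun E u \<le> c"
  unfolding support_fun_def using assms by (intro cSUP_least)

lemma support_fun_scale:
  assumes "compact E" "E \<noteq> {}" "c \<ge> 0"
  shows "support_fun E (c *\<^sub>R u) = c * support_fun E u"
proof (rule antisym)
  show "support_fun E (c *\<^sub>R u) \<le> c * support_fun E u"
    using assms by (intro support_fun_le) (auto intro!: mult_left_mono support_fun_ge)
  obtain x where "x \<in> E" "x \<bullet> u = support_fun E u" using support_fun_attained[OF assms(1,2)] .
  then show "c * support_fun E u \<le> support_fun E (c *\<^sub>R u)" using support_fun_ge[OF assms(1), of x "c *\<^sub>R u"] by simp
qed

lemma support_fun_lipschitz: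
  assumes E: "compact E" "E \<noteq> {}" and B: "\<And>x. x \<in> E \<Longrightarrow> norm x \<le> B"
  shows "\<bar>support_fun E u - support_fun E v\<bar> \<le> B * norm (u - v)"
proof -
  have *: "support_fun E u - support_fun E v \<le> B * norm (u - v)" for u v
  proof -
    obtain x where x: "x \<in> E" "x \<bullet> u = support_fun E u" using support_fun_attained[OF E] .
    have "support_fun E u - support_fun E v \<le> x \<bullet> (u - v)"
      using x support_fun_ge[OF E(1) x(1), of v] by (simp add: inner_diff_right)
    also have "\<dots> \<le> norm x * norm (u - v)" by (rule norm_cauchy_schwarz)
    also have "\<dots> \<le> B * norm (u - v)" using B[OF x(1)] by (intro mult_right_mono) auto
    finally show ?thesis .
  qed
  show ?thesis using *[of u v] *[of v u] by (simp add: norm_minus_commute abs_le_iff)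
qed

lemma continuous_on_support_fun:
  assumes E: "compact E" "E \<noteq> {}"
  shows "continuous_on S (support_fun E)"
proof -
  obtain B where B: "B > 0" "\<And>x. x \<in> E \<Longrightarrow> norm x \<le> B" using compact_imp_bounded[OF E(1)] by (auto simp: bounded_pos)
  show ?thesis
  proof (rule continuous_onI)
    fix x e assume e: "(e::real) > 0"
    show "\<exists>d>0. \<forall>y\<in>S. dist y x < d \<longrightarrow> dist (support_fun E y) (support_fun E x) \<le> e"
    proof (intro exI[of _ "e / B"] conjI ballI impI)
      fix y assume "dist y x < e / B"
      then have "B * norm (y - x) \<le> e" using B(1) by (simp add: dist_norm field_simps)
      then show "dist (support_fun E y) (support_fun E x) \<le> e"
        using support_fun_lipschitz[OF E B(2), of y x] by (simp add: dist_real_def)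
    qed (use e B(1) in simp)
  qed
qed

lemma convex_on_support_fun:
  fixes E :: "(real^'n) set"
  assumes E: "compact E" "E \<noteq> {}"
  shows "convex_on UNIV (support_fun E)"
proof (rule convex_onI)
  fix t :: real and u v :: "real^'n" assume t: "0 < t" "t < 1"
  show "support_fun E ((1 - t) *\<^sub>R u + t *\<^sub>R v) \<le> (1 - t) * support_fun E u + t * support_fun E v"
  proof (rule support_fun_le[OF E(2)])
    fix x assume "x \<in> E"
    then show "x \<bullet> ((1 - t) *\<^sub>R u + t *\<^sub>R v) \<le> (1 - t) * support_fun E u + t * support_fun E v"
      using t support_fun_ge[OF E(1)] by (simp add: inner_add_right add_mono mult_left_mono)
  qed
qed simp

definition wulff :: "(real^'n) set \<Rightarrow> (real^'n \<Rightarrow> real) \<Rightarrow> (real^'n) set" where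
  "wulff \<Omega> b = {x. \<forall>u\<in>\<Omega>. x \<bullet> u \<le> b u}"

lemma closed_wulff: "closed (wulff \<Omega> b)"
proof -
  have "wulff \<Omega> b = (\<Inter>u\<in>\<Omega>. {x. x \<bullet> u \<le> b u})" by (auto simp: wulff_def)
  then show ?thesis by (auto intro!: closed_INT closed_Collect_le continuous_intros)
qed

lemma convex_wulff: "convex (wulff \<Omega> b)"
proof -
  have "wulff \<Omega> b = (\<Inter>u\<in>\<Omega>. {x. u \<bullet> x \<le> b u})" by (auto simp: wulff_def inner_commute)
  then show ?thesis by (auto intro!: convex_INT convex_halfspace_le)
qed

text \<open>The points \<open>x\<close> with \<open>x / c\<close> in \<open>D\<close> form the
  dilate of \<open>D\<close> by \<open>c\<close>, which is at least as large as \<open>D\<close>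
  when \<open>c\<close> is at least 1. Averaging over an interval of length 1 and exchanging the
  integrals turns a volume into lengths along rays.\<close>

lemma emeasure_le_dilation_average:
  fixes D :: "'a::euclidean_space set"
  assumes D: "D \<in> sets borel"
  shows "emeasure lborel D \<le> (\<integral>\<^sup>+x. emeasure lborel {c \<in> {1..2::real}. (1 / c) *\<^sub>R x \<in> D} \<partial>lborel)"
proof -
  have ps: "pair_sigma_finite (lborel :: real measure) (lborel :: 'a measure)"
    by (intro pair_sigma_finite.intro sigma_finite_lborel)
  note [measurable] = D
  define f where "f = (\<lambda>(c::real) (x::'a). indicator {1..2} c * indicator D ((1 / c) *\<^sub>R x) :: ennreal)"
  have f: "case_prod f \<in> borel_measurable (lborel \<Otimes>\<^sub>M lborel)"
    unfolding f_def by measurable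
  have scale: "emeasure lborel ((\<lambda>x. (1 / c) *\<^sub>R x) -` D) = ennreal (\<bar>c\<bar> ^ DIM('a)) * emeasure lborel D" if c: "c \<in> {1..2}" for c :: real
  proof -
    have e: "(\<lambda>x. (1 / c) *\<^sub>R x) -` D = (\<lambda>x. c *\<^sub>R x + 0) ` D"
    proof safe
      fix x assume "(1 / c) *\<^sub>R x \<in> D"
      then show "x \<in> (\<lambda>x. c *\<^sub>R x + 0) ` D" using c by (intro image_eqI[of _ _ "(1 / c) *\<^sub>R x"]) auto
    qed (use c in auto)
    have m: "(\<lambda>x. (1 / c) *\<^sub>R x) -` D \<in> sets lborel" 
      using measurable_sets_borel[of "\<lambda>x::'a. (1 / c) *\<^sub>R x" borel D] D by simp
    have "emeasure lborel ((\<lambda>x. (1 / c) *\<^sub>R x) -` D) = emeasure lebesgue ((\<lambda>x. c *\<^sub>R x + 0) ` D)"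
      using m unfolding e by (simp add: emeasure_completion)
    also have "\<dots> = ennreal (\<bar>c\<bar> ^ DIM('a)) * emeasure lebesgue D" by (rule emeasure_lebesgue_affine)
    also have "emeasure lebesgue D = emeasure lborel D" using D by simp
    finally show ?thesis .
  qed
  have "emeasure lborel D = (\<integral>\<^sup>+c. emeasure lborel D * indicator {1..2::real} c \<partial>lborel)"
    by (simp add: nn_integral_cmult)
  also have "\<dots> \<le> (\<integral>\<^sup>+c. (\<integral>\<^sup>+x. f c x \<partial>lborel) \<partial>lborel)"
  proof (rule nn_integral_mono)
    fix c :: real
    show "emeasure lborel D * indicator {1..2} c \<le> (\<integral>\<^sup>+x. f c x \<partial>lborel)"
    proof (cases "c \<in> {1..2}")
      case True
      have "1 * emeasure lborel D \<le> ennreal (\<bar>c\<bar> ^ DIM('a)) * emeasure lborel D"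
        using True by (intro mult_right_mono) (auto simp: one_le_power ennreal_ge_1)
      also have "\<dots> = (\<integral>\<^sup>+x. indicator ((\<lambda>x. (1 / c) *\<^sub>R x) -` D) x \<partial>lborel)"
        using scale[OF True] measurable_sets_borel[of "\<lambda>x::'a. (1 / c) *\<^sub>R x" borel D] D by (subst nn_integral_indicator) auto
      also have "\<dots> = (\<integral>\<^sup>+x. f c x \<partial>lborel)" using True by (intro nn_integral_cong) (simp add: f_def indicator_def)
      finally show ?thesis using True by simp
    qed simp
  qed
  also have "\<dots> = (\<integral>\<^sup>+x. (\<integral>\<^sup>+c. f c x \<partial>lborel) \<partial>lborel)" using pair_sigma_finite.Fubini'[OF ps f] by simp
  also have "\<dots> = (\<integral>\<^sup>+x. emeasure lborel {c \<in> {1..2::real}. (1 / c) *\<^sub>R x \<in> D} \<partial>lborel)"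
  proof (rule nn_integral_cong)
    fix x :: 'a
    have m: "{c \<in> {1..2::real}. (1 / c) *\<^sub>R x \<in> D} \<in> sets lborel" by measurable
    have "(\<integral>\<^sup>+c. f c x \<partial>lborel) = (\<integral>\<^sup>+c. indicator {c \<in> {1..2::real}. (1 / c) *\<^sub>R x \<in> D} c \<partial>lborel)"
      by (intro nn_integral_cong) (auto simp: f_def indicator_def)
    also have "\<dots> = emeasure lborel {c \<in> {1..2::real}. (1 / c) *\<^sub>R x \<in> D}" using m by (rule nn_integral_indicator)
    finally show "(\<integral>\<^sup>+c. f c x \<partial>lborel) = emeasure lborel {c \<in> {1..2::real}. (1 / c) *\<^sub>R x \<in> D}" .
  qed
  finally show ?thesis .
qed

lemma ennreal_tendsto_0I:
  fixes f :: "nat \<Rightarrow> ennreal"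
  assumes "\<And>e. e > 0 \<Longrightarrow> \<forall>\<^sub>F k in sequentially. f k \<le> ennreal e"
  shows "f \<longlonglongrightarrow> 0"
proof (rule order_tendstoI)
  fix a :: ennreal assume a: "0 < a"
  obtain e where e: "e > 0" "ennreal e < a"
  proof (cases a)
    case (real r)
    then show thesis using that[of "r / 2"] a by (auto simp: ennreal_less_iff)
  next
    case top
    then show thesis using that[of 1] by simp
  qed
  from assms[OF e(1)] show "\<forall>\<^sub>F k in sequentially. f k < a" by eventually_elim (use e in auto)
qed simp

lemma emeasure_interval_le:
  fixes S :: "real set"
  assumes "S \<subseteq> {a..b}" "b - a \<le> l" "l \<ge> 0"
  shows "emeasure lborel S \<le> ennreal l"
proof -
  have "emeasure lborel S \<le> emeasure lborel {a..b}" using assms(1) by (intro emeasure_mono) auto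
  also have "\<dots> \<le> ennreal l" using assms by (cases "a \<le> b") (auto intro: ennreal_leI)
  finally show ?thesis .
qed

text \<open>Averaging over the dilations by \<open>c \<in> {1..2}\<close> bounds the volume of the difference \<open>D\<close> by the integral
  over \<open>x\<close> of the length of \<open>{c. x / c \<in> D}\<close>. Where the gauge \<open>p\<close> of \<open>M\<close> is differentiable this length is
  \<open>o(\<epsilon>)\<close>, and it is \<open>O(\<epsilon>)\<close> everywhere. The gauge is the support function of the closure \<open>A\<close> of the
  rescaled normals \<open>u / b u\<close>, so its gradient is a limit of such normals.\<close>

lemma wulff_shift_volume_core:
  fixes \<Omega> E :: "(real^'n) set" and b :: "real^'n \<Rightarrow> real"
  defines "M \<equiv> wulff \<Omega> b"
  assumes \<Omega>: "\<Omega> \<subseteq> sphere 0 1" and M: "compact M" and \<delta>: "\<delta> > 0" "cball 0 \<delta> \<subseteq> M"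
    and E: "compact E" "0 \<in> E"
    and \<epsilon>: "\<And>k::nat. \<epsilon> k > 0" "\<And>k. \<epsilon> k \<le> 1" "\<epsilon> \<longlonglongrightarrow> 0"
  shows "(\<lambda>k. emeasure lborel (wulff \<Omega> (\<lambda>u. b u + \<epsilon> k * support_fun E u) - (M + (*\<^sub>R) (\<epsilon> k) ` E)) / ennreal (\<epsilon> k)) \<longlonglongrightarrow> 0"
proof -
  have E0: "E \<noteq> {}" using E by auto
  obtain B where B: "B > 0" "\<And>x. x \<in> E \<Longrightarrow> norm x \<le> B" using compact_imp_bounded[OF E(1)] by (auto simp: bounded_pos)
  have bu: "b u \<ge> \<delta>" if u: "u \<in> \<Omega>" for u
  proof -
    have nu: "norm u = 1" using \<Omega> u by auto
    then have "\<delta> *\<^sub>R u \<in> M" using \<delta> by auto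
    then have "(\<delta> *\<^sub>R u) \<bullet> u \<le> b u" using u by (auto simp: M_def wulff_def)
    then show ?thesis using nu by (simp flip: power2_norm_eq_inner)
  qed
  have \<Omega>0: "\<Omega> \<noteq> {}"
  proof
    assume "\<Omega> = {}"
    then have "M = UNIV" by (auto simp: M_def wulff_def)
    then show False using M not_bounded_UNIV compact_imp_bounded by metis
  qed
  define A where "A = closure ((\<lambda>u. u /\<^sub>R b u) ` \<Omega>)"
  have gen: "norm (u /\<^sub>R b u) \<le> 1 / \<delta>" if u: "u \<in> \<Omega>" for u
  proof -
    have "norm u = 1" using \<Omega> u by auto
    then show ?thesis using bu[OF u] \<delta> by (simp add: inverse_eq_divide frac_le)
  qed
  have A_sub: "A \<subseteq> cball 0 (1 / \<delta>)"
    unfolding A_def using gen by (intro closure_minimal) auto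
  have A: "compact A"
    using A_sub bounded_cball bounded_subset unfolding compact_eq_bounded_closed A_def by blast
  have A0: "A \<noteq> {}" using \<Omega>0 by (simp add: A_def)
  have An: "norm a \<le> 1 / \<delta>" if "a \<in> A" for a using A_sub that by auto
  define p where "p = support_fun A"
  have pL: "\<bar>p x - p y\<bar> \<le> (1 / \<delta>) * norm (x - y)" for x y
    unfolding p_def by (rule support_fun_lipschitz[OF A A0 An])
  have pconv: "convex_on UNIV p" unfolding p_def by (rule convex_on_support_fun[OF A A0])
  have pcont: "continuous_on S p" for S unfolding p_def by (rule continuous_on_support_fun[OF A A0])
  have p_ge: "a \<bullet> x \<le> p x" if "a \<in> A" for a x unfolding p_def by (rule support_fun_ge[OF A that])
  have p_scale: "p (c *\<^sub>R x) = c * p x" if "c \<ge> 0" for c x unfolding p_def by (rule support_fun_scale[OF A A0 that])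
  have p_M: "x \<in> M" if "p x \<le> 1" for x
    unfolding M_def wulff_def
  proof (intro CollectI ballI)
    fix u assume u: "u \<in> \<Omega>"
    then have "u /\<^sub>R b u \<in> A" unfolding A_def by (intro subsetD[OF closure_subset] imageI)
    from p_ge[OF this, of x] that have "(u /\<^sub>R b u) \<bullet> x \<le> 1" by linarith
    then have "(u \<bullet> x) / b u \<le> 1" by (simp add: divide_inverse mult.commute)
    then show "x \<bullet> u \<le> b u" using bu[OF u] \<delta>(1) by (simp add: divide_le_eq inner_commute)
  qed
  define h where "h = support_fun E"
  have hcont: "continuous_on S h" for S unfolding h_def by (rule continuous_on_support_fun[OF E(1) E0])
  have h0: "h a \<ge> 0" for a using support_fun_ge[OF E(1) E(2), of a] by (simp add: h_def)
  define C where "C = B / \<delta>"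
  have C: "C > 0" using B \<delta> by (simp add: C_def)
  have hC: "h a \<le> C" if "a \<in> A" for a
    unfolding h_def
  proof (rule support_fun_le[OF E0])
    fix x assume "x \<in> E"
    have "x \<bullet> a \<le> norm x * norm a" by (rule norm_cauchy_schwarz)
    also have "\<dots> \<le> B * (1 / \<delta>)" using B(2)[OF \<open>x \<in> E\<close>] An[OF that] B(1) by (intro mult_mono) auto
    finally show "x \<bullet> a \<le> C" by (simp add: C_def)
  qed
  define W where "W = (\<lambda>k. wulff \<Omega> (\<lambda>u. b u + \<epsilon> k * support_fun E u))"
  \<comment> \<open>By homogeneity of \<open>h\<close> the constraints of \<open>W k\<close> can be
    divided by \<open>b u\<close>; continuity extends them from the rescaled normals to the compact
    set \<open>A\<close>, where maximizers exist.\<close>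
  have WA: "a \<bullet> x \<le> 1 + \<epsilon> k * h a" if x: "x \<in> W k" and a: "a \<in> A" for x a k
  proof -
    have "closed {a. a \<bullet> x - \<epsilon> k * h a \<le> 1}"
      by (intro closed_Collect_le continuous_intros hcont)
    moreover have "(\<lambda>u. u /\<^sub>R b u) ` \<Omega> \<subseteq> {a. a \<bullet> x - \<epsilon> k * h a \<le> 1}"
    proof safe
      fix u assume u: "u \<in> \<Omega>"
      have b0: "b u > 0" using bu[OF u] \<delta> by simp
      have "x \<bullet> u \<le> b u + \<epsilon> k * h u" using x u by (auto simp: W_def wulff_def h_def)
      moreover have "h (u /\<^sub>R b u) = h u / b u" unfolding h_def
        using b0 by (simp add: support_fun_scale[OF E(1) E0] divide_inverse mult.commute)
      ultimately show "(u /\<^sub>R b u) \<bullet> x - \<epsilon> k * h (u /\<^sub>R b u) \<le> 1"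
        using b0 by (simp add: field_simps inner_commute)
    qed
    ultimately have "A \<subseteq> {a. a \<bullet> x - \<epsilon> k * h a \<le> 1}" unfolding A_def by (rule closure_minimal[rotated])
    then show ?thesis using a by auto
  qed
  define S where "S = (\<lambda>k. M + (*\<^sub>R) (\<epsilon> k) ` E)"
  have MS: "M \<subseteq> S k" for k using E(2) by (force simp: S_def set_plus_def)
  define D where "D = (\<lambda>k. W k - S k)"
  have Dm: "D k \<in> sets borel" for k
    unfolding D_def W_def S_def
    by (intro sets.Diff borel_closed closed_wulff compact_imp_closed compact_set_plus M compact_scaling E)
  define Z where "Z = (\<lambda>k x. {c \<in> {1..2::real}. (1 / c) *\<^sub>R x \<in> D k})"
  note [measurable] = Dm
  have Zm[measurable]: "(\<lambda>x. emeasure lborel (Z k x)) \<in> borel_measurable borel" for k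
  proof -
    have "Measurable.pred (borel \<Otimes>\<^sub>M lborel) (\<lambda>y. (case y of (x, c) \<Rightarrow> c \<in> {1..2::real} \<and> (1 / c) *\<^sub>R (x::real^'n) \<in> D k))"
      by measurable
    then have "{y \<in> space (borel \<Otimes>\<^sub>M lborel). snd y \<in> Z k (fst y)} \<in> sets (borel \<Otimes>\<^sub>M (lborel :: real measure))"
      by (simp add: Z_def pred_def case_prod_beta)
    then have "(\<lambda>x. emeasure lborel (Pair x -` {y \<in> space (borel \<Otimes>\<^sub>M (lborel::real measure)). snd y \<in> Z k (fst y)})) \<in> borel_measurable borel"
      by (rule sigma_finite_measure.measurable_emeasure_Pair[OF sigma_finite_lborel])
    then show ?thesis by (simp add: space_pair_measure vimage_def)
  qed
  define g where "g = (\<lambda>k x. emeasure lborel (Z k x) / ennreal (\<epsilon> k))"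
  have g_m: "g k \<in> borel_measurable lborel" for k unfolding g_def by measurable
  \<comment> \<open>If \<open>Z k x\<close> is nonempty, then \<open>p x\<close> is at most
    \<open>c * (1 + \<epsilon> k * C)\<close> with \<open>c \<le> 2\<close> and
    \<open>\<epsilon> k \<le> 1\<close>, hence at most \<open>R\<close>.\<close>
  define R where "R = 2 * (1 + C)"
  have p_low: "p x > c" if c: "c \<in> Z k x" for c k x
  proof (rule ccontr)
    assume "\<not> ?thesis"
    moreover have c0: "c > 0" using c by (simp add: Z_def)
    ultimately have "p ((1 / c) *\<^sub>R x) \<le> 1" by (simp add: p_scale)
    then show False using p_M MS c by (auto simp: Z_def D_def)
  qed
  have a_up: "a \<bullet> x \<le> c * (1 + \<epsilon> k * h a)" if c: "c \<in> Z k x" and a: "a \<in> A" for c k x a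
  proof -
    have c0: "c > 0" using c by (simp add: Z_def)
    have "a \<bullet> ((1 / c) *\<^sub>R x) \<le> 1 + \<epsilon> k * h a" by (rule WA[OF _ a]) (use c in \<open>simp add: Z_def D_def\<close>)
    then show ?thesis using c0 by (simp add: divide_le_eq mult.commute)
  qed
  have dom: "g k x \<le> ennreal (R * C) * indicator {x. p x \<le> R} x" for k x
  proof (cases "Z k x = {}")
    case False
    obtain a where a: "a \<in> A" "a \<bullet> x = p x" using support_fun_attained[OF A A0, of x] unfolding p_def by blast
    have up: "p x \<le> c * (1 + \<epsilon> k * C)" if c: "c \<in> Z k x" for c
    proof -
      have c0: "c > 0" using c by (simp add: Z_def)
      have "p x \<le> c * (1 + \<epsilon> k * h a)" using a_up[OF c a(1)] a(2) by simp
      also have "\<dots> \<le> c * (1 + \<epsilon> k * C)" using hC[OF a(1)] c0 \<epsilon>(1)[of k] by (intro mult_left_mono add_left_mono) auto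
      finally show ?thesis .
    qed
    have e1: "1 + \<epsilon> k * C > 0" "1 + \<epsilon> k * C \<le> 1 + C" using \<epsilon>(1,2)[of k] C
      by (auto intro!: add_pos_nonneg mult_left_le_one_le)
    obtain c where c: "c \<in> Z k x" using False by auto
    have "p x \<le> c * (1 + \<epsilon> k * C)" by (rule up[OF c])
    also have "\<dots> \<le> 2 * (1 + C)" using c e1 by (intro mult_mono) (auto simp: Z_def)
    finally have pR: "p x \<le> R" by (simp add: R_def)
    have p0: "p x > 0" using p_low[OF c] c by (auto simp: Z_def)
    have "emeasure lborel (Z k x) \<le> ennreal (R * C * \<epsilon> k)"
    proof (rule emeasure_interval_le[of _ "p x / (1 + \<epsilon> k * C)" "p x"])
      show "Z k x \<subseteq> {p x / (1 + \<epsilon> k * C)..p x}"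
      proof
        fix c assume "c \<in> Z k x"
        then show "c \<in> {p x / (1 + \<epsilon> k * C)..p x}"
          using up[of c] p_low[of c k x] e1(1) by (simp add: divide_le_eq)
      qed
      have "p x - p x / (1 + \<epsilon> k * C) = p x * (\<epsilon> k * C) / (1 + \<epsilon> k * C)" using e1 by (simp add: field_simps)
      also have "\<dots> \<le> p x * (\<epsilon> k * C) / 1" using p0 \<epsilon>(1)[of k] C e1 by (intro divide_left_mono) auto
      also have "\<dots> \<le> R * (\<epsilon> k * C)" using pR \<epsilon>(1)[of k] C by (simp add: mult_right_mono)
      finally show "p x - p x / (1 + \<epsilon> k * C) \<le> R * C * \<epsilon> k" by (simp add: mult_ac)
      show "0 \<le> R * C * \<epsilon> k" using C \<epsilon>(1)[of k] by (simp add: R_def)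
    qed
    then have "g k x \<le> ennreal (R * C * \<epsilon> k) / ennreal (\<epsilon> k)" unfolding g_def by (rule divide_right_mono_ennreal)
    also have "\<dots> = ennreal (R * C)" using \<epsilon>(1)[of k] C by (subst divide_ennreal) (auto simp: R_def)
    finally show ?thesis using pR by simp
  qed (simp add: g_def)
  have smooth: "AE x in lborel. \<forall>i\<in>Basis. \<forall>e>0. \<exists>d>0. \<forall>t. 0 < t \<and> t < d \<longrightarrow> p (x + t *\<^sub>R i) + p (x - t *\<^sub>R i) - 2 * p x \<le> e * t"
    by (intro AE_finite_allI finite_Basis AE_second_difference[OF pconv pL]) simp
  have lim: "AE x in lborel. (\<lambda>k. g k x) \<longlonglongrightarrow> 0"
    using smooth
  proof eventually_elim
    case (elim x)
    obtain a where a: "a \<in> A" "a \<bullet> x = p x" using support_fun_attained[OF A A0, of x] unfolding p_def by blast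
    have sub: "p y \<ge> p x + a \<bullet> (y - x)" for y using p_ge[OF a(1), of y] a(2) by (simp add: inner_diff_right)
    obtain e0 where e0: "e0 \<in> E" "e0 \<bullet> a = h a" using support_fun_attained[OF E(1) E0, of a] unfolding h_def by blast
    show ?case
    proof (rule ennreal_tendsto_0I)
      fix \<eta> :: real assume \<eta>: "\<eta> > 0"
      \<comment> \<open>The error is \<open>\<eta> / 2\<close>, and below
        \<open>\<epsilon> k\<close> is kept under \<open>d / 2\<close>, because the displacement
        along \<open>- e0\<close> is \<open>c * \<epsilon> k\<close> with \<open>c\<close> up to
        2.\<close>
      obtain d where d: "d > 0" "\<And>t. 0 < t \<Longrightarrow> t < d \<Longrightarrow> p (x + t *\<^sub>R (- e0)) \<le> p x + t * (a \<bullet> (- e0)) + (\<eta> / 2) * t"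
        using convex_directional_upper_bound[OF pconv sub, of "\<eta> / 2" "- e0"] elim \<eta> by auto
      have "\<forall>\<^sub>F k in sequentially. \<epsilon> k < d / 2" using \<epsilon>(3) d(1) by (intro order_tendstoD(2)) auto
      then show "\<forall>\<^sub>F k in sequentially. g k x \<le> ennreal \<eta>"
      proof eventually_elim
        case (elim k)
        have h1: "1 + \<epsilon> k * h a \<ge> 1" using \<epsilon>(1)[of k] h0[of a] by simp
        have "emeasure lborel (Z k x) \<le> ennreal (\<eta> * \<epsilon> k)"
        proof (rule emeasure_interval_le[of _ "p x / (1 + \<epsilon> k * h a)" "(p x + \<eta> * \<epsilon> k) / (1 + \<epsilon> k * h a)"])
          show "Z k x \<subseteq> {p x / (1 + \<epsilon> k * h a)..(p x + \<eta> * \<epsilon> k) / (1 + \<epsilon> k * h a)}"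
          proof
            fix c assume c: "c \<in> Z k x"
            then have c12: "1 \<le> c" "c \<le> 2" by (auto simp: Z_def)
            have lo: "p x \<le> c * (1 + \<epsilon> k * h a)" using a_up[OF c a(1)] a(2) by simp
            \<comment> \<open>A point outside the Minkowski sum stays outside \<open>M\<close> when
              any element of \<open>\<epsilon> k\<close> times \<open>E\<close> is subtracted.
              Subtracting the element extreme for the normal \<open>a\<close> and expanding
              \<open>p\<close> to first order bounds \<open>c\<close> from above; the constraint for
              \<open>a\<close> bounds it from below.\<close>
            have "(1 / c) *\<^sub>R x - \<epsilon> k *\<^sub>R e0 \<notin> M"
            proof
              assume "(1 / c) *\<^sub>R x - \<epsilon> k *\<^sub>R e0 \<in> M"
              then have "((1 / c) *\<^sub>R x - \<epsilon> k *\<^sub>R e0) + \<epsilon> k *\<^sub>R e0 \<in> S k" unfolding S_def using e0 by (intro set_plus_intro) auto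
              then show False using c by (simp add: Z_def D_def)
            qed
            then have "1 < p ((1 / c) *\<^sub>R x - \<epsilon> k *\<^sub>R e0)" using p_M by force
            then have "c * 1 < c * p ((1 / c) *\<^sub>R x - \<epsilon> k *\<^sub>R e0)" using c12 by (intro mult_strict_left_mono) auto
            also have "\<dots> = p (c *\<^sub>R ((1 / c) *\<^sub>R x - \<epsilon> k *\<^sub>R e0))" using c12 by (simp add: p_scale)
            also have "c *\<^sub>R ((1 / c) *\<^sub>R x - \<epsilon> k *\<^sub>R e0) = x + (c * \<epsilon> k) *\<^sub>R (- e0)" using c12 by (simp add: algebra_simps)
            also have "p (x + (c * \<epsilon> k) *\<^sub>R (- e0)) \<le> p x + (c * \<epsilon> k) * (a \<bullet> (- e0)) + (\<eta> / 2) * (c * \<epsilon> k)"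
            proof (rule d(2))
              show "0 < c * \<epsilon> k" using c12 \<epsilon>(1)[of k] by simp
              have "c * \<epsilon> k \<le> 2 * \<epsilon> k" using c12 \<epsilon>(1)[of k] by (intro mult_right_mono) auto
              then show "c * \<epsilon> k < d" using elim by simp
            qed
            also have "\<dots> \<le> p x - c * (\<epsilon> k * h a) + \<eta> * \<epsilon> k"
            proof -
              have "(\<eta> / 2) * (c * \<epsilon> k) = (\<eta> * \<epsilon> k) * (c / 2)" by simp
              also have "\<dots> \<le> (\<eta> * \<epsilon> k) * 1" using c12 \<eta> \<epsilon>(1)[of k] by (intro mult_left_mono) auto
              finally show ?thesis using e0(2) by (simp add: inner_commute)
            qed
            finally have hi: "c * (1 + \<epsilon> k * h a) \<le> p x + \<eta> * \<epsilon> k" by (simp add: algebra_simps)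
            show "c \<in> {p x / (1 + \<epsilon> k * h a)..(p x + \<eta> * \<epsilon> k) / (1 + \<epsilon> k * h a)}"
              using lo hi h1 by (auto simp: divide_le_eq le_divide_eq)
          qed
          have "(p x + \<eta> * \<epsilon> k) / (1 + \<epsilon> k * h a) - p x / (1 + \<epsilon> k * h a) = \<eta> * \<epsilon> k / (1 + \<epsilon> k * h a)"
            by (simp add: diff_divide_distrib[symmetric])
          also have "\<dots> \<le> \<eta> * \<epsilon> k / 1" using h1 \<eta> \<epsilon>(1)[of k] by (intro divide_left_mono) auto
          finally show "(p x + \<eta> * \<epsilon> k) / (1 + \<epsilon> k * h a) - p x / (1 + \<epsilon> k * h a) \<le> \<eta> * \<epsilon> k" by simp
          show "0 \<le> \<eta> * \<epsilon> k" using \<eta> \<epsilon>(1)[of k] by simp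
        qed
        then have "g k x \<le> ennreal (\<eta> * \<epsilon> k) / ennreal (\<epsilon> k)" unfolding g_def by (rule divide_right_mono_ennreal)
        also have "\<dots> = ennreal \<eta>" using \<epsilon>(1)[of k] \<eta> by (subst divide_ennreal) auto
        finally show ?case .
      qed
    qed
  qed
  have R0: "R > 0" using C by (simp add: R_def)
  have Qfin: "emeasure lborel {x. p x \<le> R} < \<infinity>"
  proof (rule emeasure_bounded_finite)
    have "{x. p x \<le> R} \<subseteq> (*\<^sub>R) R ` M"
    proof
      fix x assume "x \<in> {x. p x \<le> R}"
      then have "p ((1 / R) *\<^sub>R x) \<le> 1" using R0 by (simp add: p_scale)
      then have "(1 / R) *\<^sub>R x \<in> M" by (rule p_M)
      then show "x \<in> (*\<^sub>R) R ` M" using R0 by (intro image_eqI[of _ _ "(1 / R) *\<^sub>R x"]) auto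
    qed
    then show "bounded {x. p x \<le> R}"
      using bounded_subset compact_imp_bounded compact_scaling M by metis
  qed
  have Qm: "{x. p x \<le> R} \<in> sets borel" by (intro borel_closed closed_Collect_le pcont continuous_intros)
  have "(\<lambda>k. \<integral>\<^sup>+x. g k x \<partial>lborel) \<longlonglongrightarrow> (\<integral>\<^sup>+x. 0 \<partial>(lborel :: (real^'n) measure))"
  proof (rule nn_integral_dominated_convergence[where w="\<lambda>x. ennreal (R * C) * indicator {x. p x \<le> R} x"])
    show "(\<integral>\<^sup>+x. ennreal (R * C) * indicator {x. p x \<le> R} x \<partial>lborel) < \<infinity>"
      using Qm Qfin by (subst nn_integral_cmult_indicator) (auto simp: ennreal_mult_less_top)
    show "(\<lambda>x. ennreal (R * C) * indicator {x. p x \<le> R} x) \<in> borel_measurable lborel" using Qm by measurable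
  qed (use g_m dom lim in auto)
  then have l0: "(\<lambda>k. \<integral>\<^sup>+x. g k x \<partial>lborel) \<longlonglongrightarrow> 0" by simp
  have "emeasure lborel (D k) / ennreal (\<epsilon> k) \<le> (\<integral>\<^sup>+x. g k x \<partial>lborel)" for k
  proof -
    have "emeasure lborel (D k) / ennreal (\<epsilon> k) \<le> (\<integral>\<^sup>+x. emeasure lborel (Z k x) \<partial>lborel) / ennreal (\<epsilon> k)"
      unfolding Z_def by (intro divide_right_mono_ennreal emeasure_le_dilation_average Dm)
    also have "\<dots> = (\<integral>\<^sup>+x. g k x \<partial>lborel)"
      unfolding g_def by (rule nn_integral_divide[symmetric]) measurable
    finally show ?thesis .
  qed
  then have "(\<lambda>k. emeasure lborel (D k) / ennreal (\<epsilon> k)) \<longlonglongrightarrow> 0"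
    by (intro tendsto_sandwich[OF _ _ tendsto_const l0]) auto
  then show ?thesis by (simp add: D_def W_def S_def)
qed

lemma support_fun_homothet:
  assumes "compact E" "E \<noteq> {}" "c \<ge> 0"
  shows "support_fun ((\<lambda>x. c *\<^sub>R x + a) ` E) u = c * support_fun E u + a \<bullet> u"
proof (rule antisym)
  show "support_fun ((\<lambda>x. c *\<^sub>R x + a) ` E) u \<le> c * support_fun E u + a \<bullet> u"
    using assms by (intro support_fun_le) (auto simp: inner_add_left intro!: mult_left_mono support_fun_ge)
  obtain x where x: "x \<in> E" "x \<bullet> u = support_fun E u" using support_fun_attained[OF assms(1,2)] .
  have "compact ((\<lambda>x. c *\<^sub>R x + a) ` E)" by (intro compact_continuous_image continuous_intros assms)
  from support_fun_ge[OF this imageI[OF x(1)], of u] x(2)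
  show "c * support_fun E u + a \<bullet> u \<le> support_fun ((\<lambda>x. c *\<^sub>R x + a) ` E) u" by (simp add: inner_add_left)
qed

lemma set_plus_subset_wulff:
  assumes "compact E" "\<epsilon> \<ge> 0"
  shows "wulff \<Omega> b + (*\<^sub>R) \<epsilon> ` E \<subseteq> wulff \<Omega> (\<lambda>u. b u + \<epsilon> * support_fun E u)"
  using assms by (auto simp: wulff_def set_plus_def inner_add_left intro!: add_mono mult_left_mono support_fun_ge)

lemma emeasure_lborel_translate:
  fixes S :: "'a::euclidean_space set"
  assumes "S \<in> sets borel" "(+) a ` S \<in> sets borel"
  shows "emeasure lborel ((+) a ` S) = emeasure lborel S"
proof -
  have "emeasure lebesgue ((+) a ` S) = emeasure lebesgue S"
    using emeasure_lebesgue_affine[of 1 a S] by (simp add: add.commute)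
  then show ?thesis using assms by simp
qed

text \<open>Translations put an interior point \<open>m\<close> of the Wulff shape and a point
  \<open>e\<close> of \<open>E\<close> at the origin. They move the Wulff shape and the Minkowski
  sum for parameter \<open>\<epsilon> k\<close> by the same vector \<open>a k\<close>, so the excess
  keeps its volume.\<close>

theorem wulff_shift_volume:
  fixes \<Omega> E :: "(real^'n) set" and b :: "real^'n \<Rightarrow> real"
  assumes \<Omega>: "\<Omega> \<subseteq> sphere 0 1" and M: "compact (wulff \<Omega> b)" "interior (wulff \<Omega> b) \<noteq> {}"
    and E: "compact E" "E \<noteq> {}"
    and \<epsilon>: "\<And>k::nat. \<epsilon> k > 0" "\<And>k. \<epsilon> k \<le> 1" "\<epsilon> \<longlonglongrightarrow> 0"
    and W: "\<And>k. compact (wulff \<Omega> (\<lambda>u. b u + \<epsilon> k * support_fun E u))"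
  shows "(\<lambda>k. (measure lebesgue (wulff \<Omega> (\<lambda>u. b u + \<epsilon> k * support_fun E u)) -
     measure lebesgue (wulff \<Omega> b + (*\<^sub>R) (\<epsilon> k) ` E)) / \<epsilon> k) \<longlonglongrightarrow> 0"
proof -
  obtain m where "m \<in> interior (wulff \<Omega> b)" using M by blast
  then obtain \<delta> where \<delta>: "\<delta> > 0" "cball m \<delta> \<subseteq> wulff \<Omega> b" by (auto simp: mem_interior_cball)
  obtain e where e: "e \<in> E" using E by blast
  define b' where "b' = (\<lambda>u. b u - m \<bullet> u)"
  define E' where "E' = (\<lambda>x. 1 *\<^sub>R x + (- e)) ` E"
  have wt: "wulff \<Omega> (\<lambda>u. f u + a \<bullet> u) = (+) a ` wulff \<Omega> f" for f a
  proof safe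
    fix x assume "x \<in> wulff \<Omega> (\<lambda>u. f u + a \<bullet> u)"
    then have "x - a \<in> wulff \<Omega> f" by (simp add: wulff_def inner_diff_left algebra_simps)
    then show "x \<in> (+) a ` wulff \<Omega> f" by (intro image_eqI[of _ _ "x - a"]) auto
  qed (auto simp: wulff_def inner_add_left)
  have Mb: "wulff \<Omega> b = (+) m ` wulff \<Omega> b'" using wt[of b' m] by (simp add: b'_def)
  have hE': "support_fun E' u = support_fun E u - e \<bullet> u" for u
    unfolding E'_def by (subst support_fun_homothet[OF E]) auto
  have E': "compact E'" "0 \<in> E'" using E e by (auto simp: E'_def intro!: compact_continuous_image continuous_intros)
  have cM': "compact (wulff \<Omega> b')"
  proof -
    have "wulff \<Omega> b' = (+) (- m) ` wulff \<Omega> b" unfolding Mb by (simp add: image_image)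
    then show ?thesis using compact_translation[OF M(1), of "- m"] by simp
  qed
  have d': "cball 0 \<delta> \<subseteq> wulff \<Omega> b'"
  proof
    fix x :: "real^'n" assume "x \<in> cball 0 \<delta>"
    then have "m + x \<in> cball m \<delta>" by (simp add: dist_norm)
    then have "m + x \<in> (+) m ` wulff \<Omega> b'" using \<delta> Mb by auto
    then show "x \<in> wulff \<Omega> b'" by auto
  qed
  define W' S' where "W' = (\<lambda>k. wulff \<Omega> (\<lambda>u. b' u + \<epsilon> k * support_fun E' u))"
    and "S' = (\<lambda>k. wulff \<Omega> b' + (*\<^sub>R) (\<epsilon> k) ` E')"
  define Wk Sk where "Wk = (\<lambda>k. wulff \<Omega> (\<lambda>u. b u + \<epsilon> k * support_fun E u))"
    and "Sk = (\<lambda>k. wulff \<Omega> b + (*\<^sub>R) (\<epsilon> k) ` E)"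
  define a where "a = (\<lambda>k. m + \<epsilon> k *\<^sub>R e)"
  have We: "Wk k = (+) (a k) ` W' k" for k
    unfolding W'_def Wk_def wt[symmetric] by (simp add: b'_def hE' a_def inner_add_left algebra_simps)
  have Se: "Sk k = (+) (a k) ` S' k" for k
  proof -
    have "E = (+) e ` E'" by (simp add: E'_def image_image)
    then have "Sk k = (+) m ` wulff \<Omega> b' + (*\<^sub>R) (\<epsilon> k) ` (+) e ` E'" unfolding Sk_def using Mb by simp
    also have "\<dots> = (+) (a k) ` S' k"
      unfolding S'_def a_def by (fastforce simp: set_plus_def image_iff algebra_simps)
    finally show ?thesis .
  qed
  have cS: "compact (S' k)" "compact (Sk k)" for k
    unfolding S'_def Sk_def by (intro compact_set_plus cM' M compact_scaling E E')+
  have clW: "closed (W' k)" for k unfolding W'_def by (rule closed_wulff)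
  have cW: "compact (Wk k)" for k unfolding Wk_def by (rule W)
  have sub: "Sk k \<subseteq> Wk k" for k
    unfolding Sk_def Wk_def using \<epsilon>(1)[of k] by (intro set_plus_subset_wulff E) auto
  have core: "(\<lambda>k. emeasure lborel (W' k - S' k) / ennreal (\<epsilon> k)) \<longlonglongrightarrow> 0"
    unfolding W'_def S'_def by (rule wulff_shift_volume_core[OF \<Omega> cM' \<delta>(1) d' E' \<epsilon>])
  have eq: "emeasure lborel (W' k - S' k) / ennreal (\<epsilon> k) = ennreal ((measure lebesgue (Wk k) - measure lebesgue (Sk k)) / \<epsilon> k)" for k
  proof -
    have D: "Wk k - Sk k = (+) (a k) ` (W' k - S' k)" unfolding We Se by (simp add: image_set_diff)
    have b1: "W' k - S' k \<in> sets borel" 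
      by (rule sets.Diff[OF borel_closed[OF clW] borel_closed[OF compact_imp_closed[OF cS(1)]]])
    have b2: "Wk k - Sk k \<in> sets borel" using cW cS by (intro sets.Diff borel_closed compact_imp_closed)
    have "emeasure lborel (W' k - S' k) = emeasure lborel (Wk k - Sk k)"
      using emeasure_lborel_translate[OF b1, of "a k"] b2 unfolding D by simp
    also have "\<dots> = emeasure lebesgue (Wk k - Sk k)" using b2 by simp
    also have "\<dots> = measure lebesgue (Wk k - Sk k)"
      using cW cS by (intro emeasure_eq_measure2 fmeasurable.Diff lmeasurable_compact)
    also have "measure lebesgue (Wk k - Sk k) = measure lebesgue (Wk k) - measure lebesgue (Sk k)"
      using cW cS sub by (intro measurable_measure_Diff lmeasurable_compact fmeasurableD)
    finally have m: "emeasure lborel (W' k - S' k) = ennreal (measure lebesgue (Wk k) - measure lebesgue (Sk k))" .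
    have "measure lebesgue (Sk k) \<le> measure lebesgue (Wk k)"
      using cW cS sub by (intro measure_mono_fmeasurable lmeasurable_compact fmeasurableD)
    then show ?thesis unfolding m using \<epsilon>(1)[of k] by (subst divide_ennreal) auto
  qed
  have nn: "0 \<le> (measure lebesgue (Wk k) - measure lebesgue (Sk k)) / \<epsilon> k" for k
  proof -
    have "measure lebesgue (Sk k) \<le> measure lebesgue (Wk k)"
      using cW cS sub by (intro measure_mono_fmeasurable lmeasurable_compact fmeasurableD)
    then show ?thesis using \<epsilon>(1)[of k] by simp
  qed
  have "(\<lambda>k. ennreal ((measure lebesgue (Wk k) - measure lebesgue (Sk k)) / \<epsilon> k)) \<longlonglongrightarrow> ennreal 0"
    using core unfolding eq by simp
  then have "(\<lambda>k. (measure lebesgue (Wk k) - measure lebesgue (Sk k)) / \<epsilon> k) \<longlonglongrightarrow> 0"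
    by (subst (asm) tendsto_ennreal_iff) (use nn in auto)
  then show ?thesis by (simp add: Wk_def Sk_def)
qed

section \<open>Parallel bodies\<close>

lemma measure_pos_of_interior:
  fixes S :: "'a::euclidean_space set"
  assumes "compact S" "interior S \<noteq> {}"
  shows "measure lebesgue S > 0"
proof -
  obtain x where "x \<in> interior S" using assms by blast
  then obtain e where e: "e > 0" "ball x e \<subseteq> S" by (meson mem_interior)
  have "0 < measure lebesgue (ball x e)" using e by (simp add: content_ball_pos)
  also have "\<dots> \<le> measure lebesgue S" using e assms by (intro measure_mono_fmeasurable lmeasurable_compact) auto
  finally show ?thesis .
qed

lemma compact_homothet:
  fixes S :: "'a::real_normed_vector set"
  shows "compact S \<Longrightarrow> compact ((\<lambda>y. c *\<^sub>R y + z) ` S)"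
  by (intro compact_continuous_image continuous_intros)

lemma convex_homothet:
  fixes S :: "'a::real_vector set"
  assumes "convex S"
  shows "convex ((\<lambda>y. c *\<^sub>R y + z) ` S)"
  using convex_affinity[OF assms, of z c] by (simp add: add.commute)

lemma interior_homothet_nonempty:
  fixes S :: "'a::euclidean_space set"
  assumes "interior S \<noteq> {}" "c > 0"
  shows "interior ((\<lambda>y. c *\<^sub>R y + z) ` S) \<noteq> {}"
proof -
  obtain x e where e: "e > 0" "ball x e \<subseteq> S" using assms(1) by (meson ex_in_conv mem_interior)
  have "ball (c *\<^sub>R x + z) (c * e) \<subseteq> (\<lambda>y. c *\<^sub>R y + z) ` S"
  proof
    fix y assume y: "y \<in> ball (c *\<^sub>R x + z) (c * e)"
    define w where "w = (1 / c) *\<^sub>R (y - z)"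
    have yw: "y = c *\<^sub>R w + z" using assms(2) by (simp add: w_def)
    have "dist (c *\<^sub>R x + z) y = c * dist x w" unfolding yw using assms(2) by (simp add: dist_norm flip: scaleR_diff_right)
    then have "dist x w < e" using y assms(2) by simp
    then have "w \<in> S" using e by auto
    then show "y \<in> (\<lambda>y. c *\<^sub>R y + z) ` S" using yw by blast
  qed
  moreover have "c *\<^sub>R x + z \<in> ball (c *\<^sub>R x + z) (c * e)" using e assms(2) by simp
  ultimately show ?thesis using interior_maximal[OF _ open_ball] by blast
qed

lemma homothet_inverse:
  fixes S :: "'a::real_vector set"
  assumes "c \<noteq> 0" "T = (\<lambda>y. c *\<^sub>R y + z) ` S"
  shows "S = (\<lambda>y. (1 / c) *\<^sub>R y + (- (1 / c)) *\<^sub>R z) ` T"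
  using assms by (simp add: image_image scaleR_add_right)

lemma steiner_volume_difference_quotient:
  fixes K E :: "(real^'n) set"
  assumes W: "steiner_coeffs K E W" and \<epsilon>: "\<And>k::nat. \<epsilon> k > 0" "\<epsilon> \<longlonglongrightarrow> 0"
    and E: "E \<noteq> {}"
  shows "(\<lambda>k. (measure lebesgue (K + (*\<^sub>R) (\<epsilon> k) ` E) - measure lebesgue K) / \<epsilon> k) \<longlonglongrightarrow> real CARD('n) * W 1"
proof -
  define Q where "Q = (\<Sum>i\<le>CARD('n). monom (real (CARD('n) choose i) * W i) i)"
  have pQ: "poly Q t = (\<Sum>i\<le>CARD('n). real (CARD('n) choose i) * W i * t ^ i)" for t
    by (simp add: Q_def poly_sum poly_monom)
  have v: "measure lebesgue (K + (*\<^sub>R) t ` E) = poly Q t" if "t \<ge> 0" for t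
    using W that unfolding steiner_coeffs_def set_plus_eq_Collect pQ by blast
  have "K + (*\<^sub>R) 0 ` E = K" using E by (auto simp: set_plus_def)
  then have v0: "measure lebesgue K = poly Q 0" using v[of 0] by simp
  have "poly (pderiv Q) 0 = coeff Q 1" by (simp add: poly_0_coeff_0 coeff_pderiv)
  also have "\<dots> = real CARD('n) * W 1"
    by (simp add: Q_def coeff_sum sum.delta)
  finally have "DERIV (poly Q) 0 :> real CARD('n) * W 1" using poly_DERIV[of Q 0] by simp
  then have "((\<lambda>h. (poly Q h - poly Q 0) / h) \<longlongrightarrow> real CARD('n) * W 1) (at 0)" by (simp add: DERIV_def)
  moreover have "filterlim \<epsilon> (at 0) sequentially"
    using \<epsilon> by (auto simp: filterlim_at less_imp_neq[symmetric] eventually_sequentially)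
  ultimately have "(\<lambda>k. (poly Q (\<epsilon> k) - poly Q 0) / \<epsilon> k) \<longlonglongrightarrow> real CARD('n) * W 1"
    by (rule filterlim_compose)
  then show ?thesis using v \<epsilon>(1) v0 by (simp add: less_imp_le)
qed

lemma surface_area_eq:
  fixes K E :: "(real^'n) set"
  assumes "steiner_coeffs K E W"
  shows "surface_area K E = real CARD('n) * W 1"
proof -
  have "(1::nat) \<le> CARD('n)" by (simp add: Suc_leI)
  then show ?thesis using quermassintegral_eqI[OF assms, of 1] by (simp add: surface_area_def)
qed

lemma surface_area_limit:
  fixes K E :: "(real^'n) set"
  assumes K: "compact K" "convex K" "interior K \<noteq> {}" and E: "compact E" "convex E" "interior E \<noteq> {}"
    and \<epsilon>: "\<And>k::nat. \<epsilon> k > 0" "\<epsilon> \<longlonglongrightarrow> 0"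
  shows "(\<lambda>k. (measure lebesgue (K + (*\<^sub>R) (\<epsilon> k) ` E) - measure lebesgue K) / \<epsilon> k) \<longlonglongrightarrow> surface_area K E"
proof -
  obtain W where W: "steiner_coeffs K E W"
    using steiner_coeffs_exist[OF K(1,2) _ E(1,2)] measure_pos_of_interior K E by blast
  have "E \<noteq> {}" using E by auto
  then show ?thesis using steiner_volume_difference_quotient[OF W \<epsilon>] surface_area_eq[OF W] by simp
qed

text \<open>From \<open>c K + t E = c (K + (t / c) E)\<close> the coefficient of index i scales by
  \<open>c ^ n / c ^ i\<close>. The surface area then scales by \<open>c ^ (n - 1)\<close> and the
  volume by \<open>c ^ n\<close>, and the powers in the quotient cancel.\<close>

lemma isoperimetric_quotient_homothet:
  fixes K E :: "(real^'n) set"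
  assumes K: "compact K" "convex K" "interior K \<noteq> {}" and E: "compact E" "convex E" "interior E \<noteq> {}" and c: "c > 0"
  shows "isoperimetric_quotient ((\<lambda>y. c *\<^sub>R y + z) ` K) E = isoperimetric_quotient K E"
proof -
  define n where "n = CARD('n)"
  have n: "n > 0" by (simp add: n_def)
  obtain W where W: "steiner_coeffs K E W"
    using steiner_coeffs_exist[OF K(1,2) _ E(1,2)] measure_pos_of_interior K E by blast
  define V where "V = (\<lambda>i. c ^ n * W i / c ^ i)"
  have vol: "measure lebesgue ((\<lambda>y. c *\<^sub>R y + z) ` S) = c ^ n * measure lebesgue S" for S :: "(real^'n) set"
    using measure_lebesgue_affine[of c z S] c by (simp add: n_def)
  have "steiner_coeffs ((\<lambda>y. c *\<^sub>R y + z) ` K) E V"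
    unfolding steiner_coeffs_def
  proof (intro allI impI)
    fix t :: real assume t: "t \<ge> 0"
    have "{x + t *\<^sub>R y |x y. x \<in> (\<lambda>y. c *\<^sub>R y + z) ` K \<and> y \<in> E} = (\<lambda>y. c *\<^sub>R y + z) ` {x + (t / c) *\<^sub>R y |x y. x \<in> K \<and> y \<in> E}"
      (is "?A = ?B")
    proof safe
      fix x y assume "x \<in> K" "y \<in> E"
      moreover have "c *\<^sub>R x + z + t *\<^sub>R y = c *\<^sub>R (x + (t / c) *\<^sub>R y) + z" using c by (simp add: scaleR_add_right)
      ultimately show "c *\<^sub>R x + z + t *\<^sub>R y \<in> ?B" by blast
    next
      fix x y assume "x \<in> K" "y \<in> E"
      moreover have "c *\<^sub>R (x + (t / c) *\<^sub>R y) + z = (c *\<^sub>R x + z) + t *\<^sub>R y" using c by (simp add: scaleR_add_right)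
      ultimately show "\<exists>x' y'. c *\<^sub>R (x + (t / c) *\<^sub>R y) + z = x' + t *\<^sub>R y' \<and> x' \<in> (\<lambda>y. c *\<^sub>R y + z) ` K \<and> y' \<in> E" by blast
    qed
    moreover have "measure lebesgue {x + (t / c) *\<^sub>R y |x y. x \<in> K \<and> y \<in> E} = (\<Sum>i\<le>CARD('n). real (CARD('n) choose i) * W i * (t / c) ^ i)"
      using W t c unfolding steiner_coeffs_def by simp
    ultimately show "measure lebesgue ?A = (\<Sum>i\<le>CARD('n). real (CARD('n) choose i) * V i * t ^ i)"
      by (simp add: vol sum_distrib_left V_def power_divide mult_ac)
  qed
  then have "surface_area ((\<lambda>y. c *\<^sub>R y + z) ` K) E = real n * V 1" by (simp add: surface_area_eq n_def)
  moreover have "V 1 = c ^ (n - 1) * W 1" using c n by (cases n) (simp_all add: V_def)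
  ultimately have "isoperimetric_quotient ((\<lambda>y. c *\<^sub>R y + z) ` K) E = (c ^ (n - 1) * (real n * W 1)) ^ n / (c ^ n * measure lebesgue K) ^ (n - 1)"
    by (simp add: isoperimetric_quotient_def vol n_def mult_ac)
  also have "\<dots> = (c ^ ((n - 1) * n) / c ^ (n * (n - 1))) * ((real n * W 1) ^ n / measure lebesgue K ^ (n - 1))"
    by (simp only: power_mult_distrib power_mult times_divide_times_eq)
  also have "\<dots> = isoperimetric_quotient K E"
    using c by (simp add: isoperimetric_quotient_def surface_area_eq[OF W] n_def mult.commute)
  finally show ?thesis .
qed

lemma parallel_body_eq_wulff:
  "parallel_body K E \<Omega> lam = wulff \<Omega> (\<lambda>u. support_fun K u + lam * support_fun E u)"
  by (simp add: parallel_body_def wulff_def)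

lemma form_body_eq_wulff: "form_body E \<Omega> = wulff \<Omega> (support_fun E)"
  by (simp add: form_body_def wulff_def)

locale parallel_bodies =
  fixes K E \<Omega> :: "(real^'n) set"
  assumes K: "compact K" "convex K" and K_int: "interior K \<noteq> {}"
    and E: "compact E" "convex E" and E_int: "interior E \<noteq> {}"
    and \<Omega>: "\<Omega> \<subseteq> sphere 0 1" and det: "determines \<Omega> K"
begin

abbreviation "hK \<equiv> support_fun K"
abbreviation "hE \<equiv> support_fun E"
abbreviation "P \<equiv> parallel_body K E \<Omega>"
abbreviation "rad \<equiv> inradius K E"

lemma K_ne: "K \<noteq> {}" and E_ne: "E \<noteq> {}" using K_int E_int by auto

lemma P_eq: "P lam = wulff \<Omega> (\<lambda>u. hK u + lam * hE u)" by (rule parallel_body_eq_wulff)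

lemma K_iff: "x \<in> K \<longleftrightarrow> (\<forall>u\<in>\<Omega>. x \<bullet> u \<le> hK u)"
  using det unfolding determines_def by blast

lemma P_0: "P 0 = K"
  using K_iff by (auto simp: P_eq wulff_def)

lemma \<Omega>_ne: "\<Omega> \<noteq> {}"
proof
  assume "\<Omega> = {}"
  then have "K = UNIV" using K_iff by auto
  then show False using K(1) not_bounded_UNIV compact_imp_bounded by metis
qed

text \<open>If some direction had nonpositive product with all of \<open>\<Omega>\<close>, then
  \<open>K\<close> would contain a ray. The bound is uniform by compactness of the sphere, and
  halving it allows for a maximum attained only in the closure of \<open>\<Omega>\<close>.\<close>

lemma \<Omega>_spanning: "\<exists>c>0. \<forall>x. \<exists>u\<in>\<Omega>. c * norm x \<le> x \<bullet> u"
proof -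
  let ?A = "closure \<Omega>"
  have A: "compact ?A"
    using \<Omega> bounded_subset[OF bounded_sphere] by (simp add: compact_closure)
  have A0: "?A \<noteq> {}" using \<Omega>_ne by simp
  have "sphere (0::real^'n) 1 \<noteq> {}" using \<Omega> \<Omega>_ne by blast
  then obtain x0 where x0: "x0 \<in> sphere 0 1" "\<And>x. x \<in> sphere 0 1 \<Longrightarrow> support_fun ?A x0 \<le> support_fun ?A x"
    using continuous_attains_inf[OF compact_sphere _ continuous_on_support_fun[OF A A0]] by blast
  define m where "m = support_fun ?A x0"
  have m: "m > 0"
  proof (rule ccontr)
    assume "\<not> m > 0"
    then have le: "x0 \<bullet> u \<le> 0" if "u \<in> \<Omega>" for u
      using support_fun_ge[OF A, of u x0] that closure_subset[of \<Omega>] by (auto simp: m_def inner_commute)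
    obtain k where k: "k \<in> K" using K_ne by blast
    obtain B where B: "\<And>x. x \<in> K \<Longrightarrow> norm x \<le> B" using compact_imp_bounded[OF K(1)] by (auto simp: bounded_iff)
    define t where "t = norm k + \<bar>B\<bar> + 1"
    have "k + t *\<^sub>R x0 \<in> K"
      unfolding K_iff
    proof
      fix u assume u: "u \<in> \<Omega>"
      have "t * (x0 \<bullet> u) \<le> 0" using le[OF u] by (simp add: t_def mult_nonneg_nonpos)
      then show "(k + t *\<^sub>R x0) \<bullet> u \<le> hK u" using k u K_iff[of k] by (fastforce simp: inner_add_left)
    qed
    from B[OF this] have "norm (k + t *\<^sub>R x0) \<le> B" .
    moreover have "norm (t *\<^sub>R x0) \<le> norm (k + t *\<^sub>R x0) + norm k"
      using norm_triangle_ineq4[of "k + t *\<^sub>R x0" k] by simp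
    moreover have "norm (t *\<^sub>R x0) = t" using x0(1) by (simp add: t_def)
    ultimately show False unfolding t_def by linarith
  qed
  have "\<exists>u\<in>\<Omega>. m / 2 * norm x \<le> x \<bullet> u" for x
  proof (cases "x = 0")
    case False
    show ?thesis
    proof (rule ccontr)
      assume n: "\<not> ?thesis"
      have "\<Omega> \<subseteq> {u. x \<bullet> u \<le> m / 2 * norm x}" using n by force
      then have cl: "?A \<subseteq> {u. x \<bullet> u \<le> m / 2 * norm x}"
        by (rule closure_minimal) (rule closed_halfspace_le)
      have "norm x * m \<le> norm x * support_fun ?A (x /\<^sub>R norm x)"
        unfolding m_def using False by (intro mult_left_mono x0(2)) auto
      also have "\<dots> = support_fun ?A x"
        using False by (subst support_fun_scale[OF A A0, symmetric]) auto
      also have "\<dots> \<le> m / 2 * norm x" using cl by (intro support_fun_le A0) (auto simp: inner_commute)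
      finally show False using m False by simp
    qed
  qed (use \<Omega>_ne in auto)
  then show ?thesis using m by (intro exI[of _ "m / 2"]) auto
qed

lemma compact_wulff_of_bounded:
  assumes "\<And>u. u \<in> \<Omega> \<Longrightarrow> b u \<le> B"
  shows "compact (wulff \<Omega> b)"
proof -
  obtain c where c: "c > 0" "\<And>x. \<exists>u\<in>\<Omega>. c * norm x \<le> x \<bullet> u" using \<Omega>_spanning by blast
  have "norm x \<le> B / c" if x: "x \<in> wulff \<Omega> b" for x
  proof -
    obtain u where u: "u \<in> \<Omega>" "c * norm x \<le> x \<bullet> u" using c by blast
    have "x \<bullet> u \<le> b u" using x u(1) by (auto simp: wulff_def)
    then have "c * norm x \<le> B" using u assms[OF u(1)] by linarith
    then show ?thesis using c(1) by (simp add: le_divide_eq mult.commute)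
  qed
  then show ?thesis using closed_wulff by (auto simp: compact_eq_bounded_closed bounded_iff)
qed

lemma support_fun_bounded:
  assumes "compact S" "S \<noteq> {}"
  shows "\<exists>B. \<forall>u\<in>\<Omega>. \<bar>support_fun S u\<bar> \<le> B"
proof -
  obtain B where B: "\<And>x. x \<in> S \<Longrightarrow> norm x \<le> B" using compact_imp_bounded[OF assms(1)] by (auto simp: bounded_iff)
  have "\<bar>support_fun S u\<bar> \<le> B" if u: "u \<in> \<Omega>" for u
  proof -
    have "norm u = 1" using \<Omega> u by auto
    moreover have "support_fun S 0 = 0" using support_fun_scale[OF assms, of 0 0] by simp
    ultimately show ?thesis using support_fun_lipschitz[OF assms B, of u 0] by simp
  qed
  then show ?thesis by blast
qed

lemma compact_P: "compact (P lam)"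
proof -
  obtain B1 where B1: "\<forall>u\<in>\<Omega>. \<bar>hK u\<bar> \<le> B1" using support_fun_bounded[OF K(1) K_ne] ..
  obtain B2 where B2: "\<forall>u\<in>\<Omega>. \<bar>hE u\<bar> \<le> B2" using support_fun_bounded[OF E(1) E_ne] ..
  show ?thesis unfolding P_eq
  proof (rule compact_wulff_of_bounded)
    fix u assume u: "u \<in> \<Omega>"
    have "lam * hE u \<le> \<bar>lam\<bar> * \<bar>hE u\<bar>" by (metis abs_ge_self abs_mult)
    also have "\<dots> \<le> \<bar>lam\<bar> * B2" using B2 u by (intro mult_left_mono) auto
    finally show "hK u + lam * hE u \<le> B1 + \<bar>lam\<bar> * B2" using B1 u by fastforce
  qed
qed

lemma convex_P: "convex (P lam)"
  unfolding P_eq by (rule convex_wulff)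

lemma compact_form: "compact (form_body E \<Omega>)"
proof -
  obtain B2 where B2: "\<forall>u\<in>\<Omega>. \<bar>hE u\<bar> \<le> B2" using support_fun_bounded[OF E(1) E_ne] ..
  then show ?thesis unfolding form_body_eq_wulff by (intro compact_wulff_of_bounded[of _ B2]) fastforce
qed

lemma E_subset_form: "E \<subseteq> form_body E \<Omega>"
  unfolding form_body_def using support_fun_ge[OF E(1)] by blast

text \<open>A ball in \<open>K\<close> holds a small copy of \<open>E\<close>. To use this, the set
  under the supremum must be bounded above: \<open>E\<close> contains a segment of length
  \<open>s\<close>, and its scaled copy has to fit into the bounded \<open>K\<close>.\<close>

lemma rad_pos: "rad > 0"
proof -
  let ?R = "{r. r \<ge> 0 \<and> (\<exists>x. (\<lambda>y. x + r *\<^sub>R y) ` E \<subseteq> K)}"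
  obtain k d where k: "d > 0" "cball k d \<subseteq> K" using K_int by (auto simp: mem_interior_cball)
  obtain B where B: "B > 0" "\<And>x. x \<in> E \<Longrightarrow> norm x \<le> B" using compact_imp_bounded[OF E(1)] by (auto simp: bounded_pos)
  have "(\<lambda>y. k + (d / B) *\<^sub>R y) ` E \<subseteq> K"
  proof
    fix z assume "z \<in> (\<lambda>y. k + (d / B) *\<^sub>R y) ` E"
    then obtain y where y: "y \<in> E" "z = k + (d / B) *\<^sub>R y" by blast
    have "dist k z = d / B * norm y" using y k B by (simp add: dist_norm)
    also have "\<dots> \<le> d / B * B" using B y k by (intro mult_left_mono) auto
    finally show "z \<in> K" using k B by auto
  qed
  then have mem: "d / B \<in> ?R" using k B by auto
  obtain e s where s: "s > 0" "cball e s \<subseteq> E" using E_int by (auto simp: mem_interior_cball)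
  obtain v :: "real^'n" where v: "norm v = 1" using vector_choose_size[of 1] by auto
  have e12: "e \<in> E" "e + s *\<^sub>R v \<in> E" using s v by (auto simp: subset_iff dist_norm)
  obtain C where C: "\<And>x. x \<in> K \<Longrightarrow> norm x \<le> C" using compact_imp_bounded[OF K(1)] by (auto simp: bounded_iff)
  have "r \<le> 2 * C / s" if r: "r \<in> ?R" for r
  proof -
    obtain x where x: "r \<ge> 0" "(\<lambda>y. x + r *\<^sub>R y) ` E \<subseteq> K" using r by blast
    have "norm (x + r *\<^sub>R e) \<le> C" "norm (x + r *\<^sub>R (e + s *\<^sub>R v)) \<le> C" using x e12 C by blast+
    moreover have "norm ((x + r *\<^sub>R (e + s *\<^sub>R v)) - (x + r *\<^sub>R e)) \<le> norm (x + r *\<^sub>R (e + s *\<^sub>R v)) + norm (x + r *\<^sub>R e)"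
      by (rule norm_triangle_ineq4)
    moreover have "norm ((x + r *\<^sub>R (e + s *\<^sub>R v)) - (x + r *\<^sub>R e)) = r * s"
      using v x s by (simp add: scaleR_add_right)
    ultimately show ?thesis using s by (simp add: le_divide_eq)
  qed
  then have "bdd_above ?R" by (meson bdd_above.I)
  then have "d / B \<le> rad" unfolding inradius_def using mem by (rule cSup_upper[rotated])
  moreover have "0 < d / B" using k B by simp
  ultimately show ?thesis by linarith
qed

text \<open>The supremum yields a copy of \<open>r E\<close> in \<open>K\<close> with
  \<open>r > - lam\<close>, and shifting the constraints by \<open>lam\<close> leaves a copy of
  \<open>(r + lam) E\<close> in \<open>P lam\<close>.\<close>

lemma P_interior:
  assumes "lam > - rad"
  shows "interior (P lam) \<noteq> {}"
proof -
  let ?R = "{r. r \<ge> 0 \<and> (\<exists>x. (\<lambda>y. x + r *\<^sub>R y) ` E \<subseteq> K)}"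
  obtain k where "k \<in> K" using K_ne by blast
  then have "0 \<in> ?R" using E_ne by auto
  then have "?R \<noteq> {}" by blast
  moreover have "- lam < Sup ?R" using assms unfolding inradius_def by linarith
  ultimately obtain r x where r: "- lam < r" "(\<lambda>y. x + r *\<^sub>R y) ` E \<subseteq> K"
    using less_cSupD[of ?R "- lam"] by blast
  have "(\<lambda>y. (r + lam) *\<^sub>R y + x) ` E \<subseteq> P lam"
  proof (rule image_subsetI)
    fix y assume y: "y \<in> E"
    show "(r + lam) *\<^sub>R y + x \<in> P lam"
      unfolding P_eq wulff_def
    proof (intro CollectI ballI)
      fix u assume "u \<in> \<Omega>"
      obtain e where e: "e \<in> E" "e \<bullet> u = hE u" using support_fun_attained[OF E(1) E_ne] .
      have "x + r *\<^sub>R e \<in> K" using r(2) e(1) by blast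
      then have "x \<bullet> u + r * hE u \<le> hK u" using support_fun_ge[OF K(1), of "x + r *\<^sub>R e" u] e(2) by (simp add: inner_add_left)
      moreover have "(r + lam) * (y \<bullet> u) \<le> (r + lam) * hE u"
        using r(1) support_fun_ge[OF E(1) y] by (intro mult_left_mono) auto
      ultimately show "((r + lam) *\<^sub>R y + x) \<bullet> u \<le> hK u + lam * hE u" by (simp add: inner_add_left algebra_simps)
    qed
  qed
  moreover have "interior ((\<lambda>y. (r + lam) *\<^sub>R y + x) ` E) \<noteq> {}"
    using r(1) by (intro interior_homothet_nonempty E_int) simp
  ultimately show ?thesis using interior_mono by blast
qed

end

section \<open>Concavity of the root volume and rigidity of the quotient\<close>

context parallel_bodies
begin

definition V :: "real \<Rightarrow> real" where "V lam = measure lebesgue (P lam)"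

definition f :: "real \<Rightarrow> real" where "f lam = root CARD('n) (V lam)"

definition g :: "real \<Rightarrow> real" where
  "g lam = surface_area (P lam) E / (real CARD('n) * f lam ^ (CARD('n) - 1))"

lemma V_pos: "lam > - rad \<Longrightarrow> V lam > 0"
  unfolding V_def by (intro measure_pos_of_interior compact_P P_interior)

lemma f_pos: "lam > - rad \<Longrightarrow> f lam > 0"
  unfolding f_def using V_pos by simp

lemma f_power: "lam > - rad \<Longrightarrow> f lam ^ CARD('n) = V lam"
  unfolding f_def using V_pos by (simp add: less_imp_le)

lemma P_ne: "lam > - rad \<Longrightarrow> P lam \<noteq> {}"
  using P_interior[of lam] by auto

lemma P_plus_E_subset:
  assumes "s \<ge> 0"
  shows "P lam + (*\<^sub>R) s ` E \<subseteq> P (lam + s)"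
  using set_plus_subset_wulff[OF E(1) assms, of \<Omega> "\<lambda>u. hK u + lam * hE u"]
  unfolding P_eq by (simp add: algebra_simps)

lemma P_convex_combination_subset:
  assumes "0 \<le> s" "s \<le> 1"
  shows "(*\<^sub>R) (1 - s) ` P a + (*\<^sub>R) s ` P b \<subseteq> P ((1 - s) * a + s * b)"
proof
  fix z assume "z \<in> (*\<^sub>R) (1 - s) ` P a + (*\<^sub>R) s ` P b"
  then obtain x y where xy: "x \<in> P a" "y \<in> P b" "z = (1 - s) *\<^sub>R x + s *\<^sub>R y" by (auto simp: set_plus_def)
  show "z \<in> P ((1 - s) * a + s * b)"
    unfolding P_eq wulff_def
  proof (intro CollectI ballI)
    fix u assume u: "u \<in> \<Omega>"
    have "z \<bullet> u = (1 - s) * (x \<bullet> u) + s * (y \<bullet> u)" by (simp add: xy inner_add_left)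
    also have "\<dots> \<le> (1 - s) * (hK u + a * hE u) + s * (hK u + b * hE u)"
      using xy u assms by (intro add_mono mult_left_mono) (auto simp: P_eq wulff_def)
    also have "\<dots> = hK u + ((1 - s) * a + s * b) * hE u" by (simp add: algebra_simps)
    finally show "z \<bullet> u \<le> hK u + ((1 - s) * a + s * b) * hE u" .
  qed
qed

lemma measure_scaleR_image:
  fixes S :: "(real^'n) set"
  assumes "c \<ge> 0"
  shows "measure lebesgue ((*\<^sub>R) c ` S) = c ^ CARD('n) * measure lebesgue S"
  using measure_lebesgue_affine[of c 0 S] assms by simp

lemma root_measure_scaleR_image:
  fixes S :: "(real^'n) set"
  assumes "c \<ge> 0"
  shows "root CARD('n) (measure lebesgue ((*\<^sub>R) c ` S)) = c * root CARD('n) (measure lebesgue S)"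
  using assms by (simp add: measure_scaleR_image real_root_mult real_root_power_cancel)

lemma root_volume_superadditive:
  fixes A B :: "(real^'n) set"
  assumes "compact A" "convex A" "A \<noteq> {}" "compact B" "convex B" "B \<noteq> {}"
  shows "root CARD('n) (measure lebesgue A) + root CARD('n) (measure lebesgue B) \<le> root CARD('n) (measure lebesgue (A + B))"
proof -
  have "root CARD('n) ((root CARD('n) (measure lebesgue A) + root CARD('n) (measure lebesgue B)) ^ CARD('n)) \<le> root CARD('n) (measure lebesgue (A + B))"
    using Brunn_Minkowski[OF assms] by (intro real_root_le_mono) simp_all
  then show ?thesis by (simp add: real_root_power_cancel)
qed

text \<open>Concavity is kept as two inequalities around the volume of the convex combination, since
  the equality case needs this middle term.\<close>

lemma f_concave_aux:
  assumes ab: "a > - rad" "b > - rad" and s: "0 \<le> s" "s \<le> 1"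
  shows "(1 - s) * f a + s * f b \<le> root CARD('n) (measure lebesgue ((*\<^sub>R) (1 - s) ` P a + (*\<^sub>R) s ` P b))"
    and "root CARD('n) (measure lebesgue ((*\<^sub>R) (1 - s) ` P a + (*\<^sub>R) s ` P b)) \<le> f ((1 - s) * a + s * b)"
proof -
  have "(1 - s) * f a + s * f b = root CARD('n) (measure lebesgue ((*\<^sub>R) (1 - s) ` P a)) + root CARD('n) (measure lebesgue ((*\<^sub>R) s ` P b))"
    using s by (simp add: root_measure_scaleR_image f_def V_def)
  also have "\<dots> \<le> root CARD('n) (measure lebesgue ((*\<^sub>R) (1 - s) ` P a + (*\<^sub>R) s ` P b))"
    using P_ne ab by (intro root_volume_superadditive compact_scaling convex_scaling compact_P convex_P) auto
  finally show "(1 - s) * f a + s * f b \<le> root CARD('n) (measure lebesgue ((*\<^sub>R) (1 - s) ` P a + (*\<^sub>R) s ` P b))" .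
  show "root CARD('n) (measure lebesgue ((*\<^sub>R) (1 - s) ` P a + (*\<^sub>R) s ` P b)) \<le> f ((1 - s) * a + s * b)"
    unfolding f_def V_def
    by (intro real_root_le_mono measure_mono_fmeasurable P_convex_combination_subset s lmeasurable_compact fmeasurableD
        compact_set_plus compact_scaling compact_P) simp
qed

lemma f_concave:
  assumes "a > - rad" "b > - rad" "0 \<le> s" "s \<le> 1"
  shows "(1 - s) * f a + s * f b \<le> f ((1 - s) * a + s * b)"
  using f_concave_aux[OF assms] by (rule order_trans)

text \<open>\<open>P b\<close> contains \<open>P a + (b - a) E\<close>, and \<open>E\<close> has
  positive volume.\<close>

lemma f_strict_mono:
  assumes "a > - rad" "a < b"
  shows "f a < f b"
proof -
  have "f a < f a + (b - a) * root CARD('n) (measure lebesgue E)"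
    using assms measure_pos_of_interior[OF E(1) E_int] by simp
  also have "\<dots> = root CARD('n) (measure lebesgue (P a)) + root CARD('n) (measure lebesgue ((*\<^sub>R) (b - a) ` E))"
    using assms by (simp add: root_measure_scaleR_image f_def V_def)
  also have "\<dots> \<le> root CARD('n) (measure lebesgue (P a + (*\<^sub>R) (b - a) ` E))"
    using P_ne assms E_ne by (intro root_volume_superadditive compact_scaling convex_scaling compact_P convex_P E) auto
  also have "\<dots> \<le> f b"
    unfolding f_def V_def using P_plus_E_subset[of "b - a" a] assms
    by (intro real_root_le_mono measure_mono_fmeasurable lmeasurable_compact fmeasurableD
        compact_set_plus compact_scaling compact_P E) auto
  finally show ?thesis .
qed

text \<open>The step sequence for right derivatives; it starts at 1 and stays positive, as the
  volume estimate for Wulff shapes requires.\<close>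

definition \<epsilon> :: "nat \<Rightarrow> real" where "\<epsilon> k = 1 / real (Suc k)"

lemma \<epsilon>: "\<epsilon> k > 0" "\<epsilon> k \<le> 1" "\<epsilon> \<longlonglongrightarrow> 0"
proof -
  show "\<epsilon> k > 0" "\<epsilon> k \<le> 1" by (simp_all add: \<epsilon>_def)
  show "\<epsilon> \<longlonglongrightarrow> 0" unfolding \<epsilon>_def[abs_def] by (rule LIMSEQ_Suc[OF lim_1_over_n])
qed

text \<open>The increment is the excess of \<open>P (lam + \<epsilon> k)\<close> over the Minkowski
  sum, which is of smaller order, plus the growth of the Minkowski sum, whose rate is the linear
  Steiner coefficient.\<close>

lemma V_right_derivative:
  assumes lam: "lam > - rad"
  shows "(\<lambda>k. (V (lam + \<epsilon> k) - V lam) / \<epsilon> k) \<longlonglongrightarrow> surface_area (P lam) E"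
proof -
  have e: "wulff \<Omega> (\<lambda>u. (hK u + lam * hE u) + t * hE u) = P (lam + t)" for t
    unfolding P_eq by (simp add: algebra_simps)
  have "(\<lambda>k. (measure lebesgue (P (lam + \<epsilon> k)) - measure lebesgue (P lam + (*\<^sub>R) (\<epsilon> k) ` E)) / \<epsilon> k) \<longlonglongrightarrow> 0"
    using wulff_shift_volume[OF \<Omega> _ _ E(1) E_ne \<epsilon>, of "\<lambda>u. hK u + lam * hE u"] compact_P P_interior[OF lam]
    unfolding e P_eq[symmetric] by simp
  moreover have "(\<lambda>k. (measure lebesgue (P lam + (*\<^sub>R) (\<epsilon> k) ` E) - measure lebesgue (P lam)) / \<epsilon> k) \<longlonglongrightarrow> surface_area (P lam) E"
    by (rule surface_area_limit[OF compact_P convex_P P_interior[OF lam] E E_int \<epsilon>(1,3)])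
  ultimately have "(\<lambda>k. (measure lebesgue (P (lam + \<epsilon> k)) - measure lebesgue (P lam + (*\<^sub>R) (\<epsilon> k) ` E)) / \<epsilon> k
     + (measure lebesgue (P lam + (*\<^sub>R) (\<epsilon> k) ` E) - measure lebesgue (P lam)) / \<epsilon> k) \<longlonglongrightarrow> 0 + surface_area (P lam) E"
    by (rule tendsto_add)
  then show ?thesis by (simp add: V_def add_divide_distrib[symmetric])
qed

text \<open>Factor the difference of n-th powers: the increment of \<open>V\<close> is the increment
  of \<open>f\<close> times \<open>S k\<close>, and \<open>S k\<close> tends to the derivative of
  the n-th power at \<open>f lam\<close>.\<close>

lemma f_right_derivative:
  assumes lam: "lam > - rad"
  shows "(\<lambda>k. (f (lam + \<epsilon> k) - f lam) / \<epsilon> k) \<longlonglongrightarrow> g lam"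
proof -
  define n where "n = CARD('n)"
  have n: "n > 0" by (simp add: n_def)
  have lk: "lam + \<epsilon> k > - rad" for k using lam \<epsilon>(1)[of k] by simp
  note f0 = f_pos[OF lam] f_pos[OF lk]
  have "(\<lambda>k. V lam + (V (lam + \<epsilon> k) - V lam) / \<epsilon> k * \<epsilon> k) \<longlonglongrightarrow> V lam + surface_area (P lam) E * 0"
    by (intro tendsto_intros V_right_derivative lam \<epsilon>)
  moreover have "V lam + (V (lam + \<epsilon> k) - V lam) / \<epsilon> k * \<epsilon> k = V (lam + \<epsilon> k)" for k
    using \<epsilon>(1)[of k] by simp
  ultimately have "(\<lambda>k. V (lam + \<epsilon> k)) \<longlonglongrightarrow> V lam" by simp
  then have flim: "(\<lambda>k. f (lam + \<epsilon> k)) \<longlonglongrightarrow> f lam" unfolding f_def by (rule tendsto_real_root)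
  define S where "S = (\<lambda>k. \<Sum>i<n. f lam ^ (n - Suc i) * f (lam + \<epsilon> k) ^ i)"
  have "S \<longlonglongrightarrow> (\<Sum>i<n. f lam ^ (n - Suc i) * f lam ^ i)"
    unfolding S_def by (intro tendsto_intros flim)
  also have "(\<Sum>i<n. f lam ^ (n - Suc i) * f lam ^ i) = (\<Sum>i<n. f lam ^ (n - 1))"
    by (intro sum.cong refl) (simp flip: power_add)
  also have "\<dots> = real n * f lam ^ (n - 1)" by simp
  finally have Slim: "S \<longlonglongrightarrow> real n * f lam ^ (n - 1)" .
  have S0: "S k > 0" for k unfolding S_def using n f0 by (intro sum_pos) (auto intro!: mult_pos_pos)
  have "(\<lambda>k. (V (lam + \<epsilon> k) - V lam) / \<epsilon> k / S k) \<longlonglongrightarrow> surface_area (P lam) E / (real n * f lam ^ (n - 1))"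
    using n f0 by (intro tendsto_divide V_right_derivative lam Slim) auto
  moreover have "(V (lam + \<epsilon> k) - V lam) / \<epsilon> k / S k = (f (lam + \<epsilon> k) - f lam) / \<epsilon> k" for k
  proof -
    have "V (lam + \<epsilon> k) - V lam = f (lam + \<epsilon> k) ^ n - f lam ^ n"
      by (simp add: f_power[OF lam] f_power[OF lk] n_def)
    also have "\<dots> = (f (lam + \<epsilon> k) - f lam) * S k" unfolding S_def by (rule power_diff_sumr2)
    finally show ?thesis using S0[of k] by simp
  qed
  ultimately show ?thesis by (simp add: g_def n_def)
qed

text \<open>By concavity a short chord to the right of \<open>mu\<close> is at least as steep as the
  chord from \<open>mu\<close> to a point further right and at most as steep as a chord ending at
  \<open>mu\<close> from the left. The weight \<open>s\<close> expresses the intermediate point as a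
  convex combination.\<close>

lemma f_supergradient:
  assumes lam: "lam > - rad" and mu: "mu > - rad"
  shows "f lam \<le> f mu + (lam - mu) * g mu"
proof -
  consider "lam = mu" | "lam > mu" | "lam < mu" by linarith
  then show ?thesis
  proof cases
    case 2
    have "\<forall>\<^sub>F k in sequentially. \<epsilon> k < lam - mu" using \<epsilon>(3) 2 by (intro order_tendstoD(2)) auto
    then have "\<forall>\<^sub>F k in sequentially. (f lam - f mu) / (lam - mu) \<le> (f (mu + \<epsilon> k) - f mu) / \<epsilon> k"
    proof eventually_elim
      case (elim k)
      define s where "s = \<epsilon> k / (lam - mu)"
      have s: "0 \<le> s" "s \<le> 1" "s * (lam - mu) = \<epsilon> k" using \<epsilon>(1)[of k] elim 2 by (auto simp: s_def)
      have "(1 - s) * mu + s * lam = mu + \<epsilon> k" using s(3) by (simp add: algebra_simps)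
      then have "s * (f lam - f mu) \<le> f (mu + \<epsilon> k) - f mu" using f_concave[OF mu lam s(1,2)] by (simp add: algebra_simps)
      then show ?case using \<epsilon>(1)[of k] 2 by (simp add: s_def field_simps)
    qed
    from tendsto_lowerbound[OF f_right_derivative[OF mu] this] show ?thesis using 2 by (simp add: field_simps)
  next
    case 3
    have "(f (mu + \<epsilon> k) - f mu) / \<epsilon> k \<le> (f mu - f lam) / (mu - lam)" for k
    proof -
      define s where "s = (mu - lam) / (mu - lam + \<epsilon> k)"
      have d: "mu - lam + \<epsilon> k > 0" using 3 \<epsilon>(1)[of k] by simp
      have s: "0 \<le> s" "s \<le> 1" using 3 \<epsilon>(1)[of k] by (auto simp: s_def)
      have s': "s * (mu - lam + \<epsilon> k) = mu - lam" using d by (simp add: s_def)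
      have "(1 - s) * lam + s * (mu + \<epsilon> k) = mu" using s' by (simp add: algebra_simps)
      moreover have "mu + \<epsilon> k > - rad" using mu \<epsilon>(1)[of k] by simp
      ultimately have "(1 - s) * f lam + s * f (mu + \<epsilon> k) \<le> f mu" using f_concave[OF lam _ s, of "mu + \<epsilon> k"] by simp
      then have "((1 - s) * f lam + s * f (mu + \<epsilon> k)) * (mu - lam + \<epsilon> k) \<le> f mu * (mu - lam + \<epsilon> k)"
        using d by (intro mult_right_mono) auto
      moreover have "((1 - s) * f lam + s * f (mu + \<epsilon> k)) * (mu - lam + \<epsilon> k) =
        f lam * ((mu - lam + \<epsilon> k) - s * (mu - lam + \<epsilon> k)) + f (mu + \<epsilon> k) * (s * (mu - lam + \<epsilon> k))" by (simp add: algebra_simps)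
      ultimately have "f lam * \<epsilon> k + f (mu + \<epsilon> k) * (mu - lam) \<le> f mu * (mu - lam + \<epsilon> k)" unfolding s' by simp
      then have "(f (mu + \<epsilon> k) - f mu) * (mu - lam) \<le> (f mu - f lam) * \<epsilon> k" by (simp add: algebra_simps)
      then show ?thesis using 3 \<epsilon>(1)[of k] by (simp add: frac_le_eq pos_divide_le_eq pos_le_divide_eq mult.commute)
    qed
    then have "g mu \<le> (f mu - f lam) / (mu - lam)"
      by (intro LIMSEQ_le_const2[OF f_right_derivative[OF mu]]) auto
    then show ?thesis using 3 by (simp add: field_simps)
  qed simp
qed

lemma g_nonneg:
  assumes "lam > - rad"
  shows "g lam \<ge> 0"
proof -
  have "0 \<le> (f (lam + \<epsilon> k) - f lam) / \<epsilon> k" for k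
    using f_strict_mono[OF assms, of "lam + \<epsilon> k"] \<epsilon>(1)[of k] by simp
  then show ?thesis by (intro LIMSEQ_le_const[OF f_right_derivative[OF assms]]) auto
qed

text \<open>Add the supergradient inequalities at \<open>a\<close> and \<open>b\<close>, each
  evaluated at the other point.\<close>

lemma g_antimono:
  assumes "a > - rad" "a \<le> b"
  shows "g b \<le> g a"
proof (cases "a = b")
  case False
  have b: "b > - rad" using assms by simp
  have "f b \<le> f a + (b - a) * g a" "f a \<le> f b + (a - b) * g b"
    using f_supergradient[OF b assms(1)] f_supergradient[OF assms(1) b] .
  then have "(b - a) * g b \<le> (b - a) * g a" by (simp add: algebra_simps)
  then show ?thesis using False assms(2) by simp
qed simp

abbreviation "Iq lam \<equiv> isoperimetric_quotient (P lam) E"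

lemma Iq_eq:
  assumes "lam > - rad"
  shows "Iq lam = (real CARD('n) * g lam) ^ CARD('n)"
proof -
  define n where "n = CARD('n)"
  have n: "n > 0" by (simp add: n_def)
  have "(real n * g lam) ^ n = (surface_area (P lam) E / f lam ^ (n - 1)) ^ n"
    using n by (simp add: g_def n_def)
  also have "\<dots> = surface_area (P lam) E ^ n / (f lam ^ n) ^ (n - 1)"
    by (simp add: power_divide mult.commute flip: power_mult)
  also have "f lam ^ n = V lam" using f_power[OF assms] by (simp add: n_def)
  finally show ?thesis by (simp add: isoperimetric_quotient_def V_def n_def)
qed

lemma Iq_eq_iff:
  assumes "a > - rad" "b > - rad"
  shows "Iq a = Iq b \<longleftrightarrow> g a = g b"
  using assms g_nonneg by (simp add: Iq_eq power_eq_iff_eq_base)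

lemma Iq_antimono: "antimono_on {- rad<..} Iq"
proof (rule monotone_onI)
  fix a b assume "a \<in> {- rad<..}" "b \<in> {- rad<..}" "a \<le> b"
  then show "Iq b \<le> Iq a"
    using g_nonneg[of b] g_antimono[of a b] by (simp add: Iq_eq power_mono)
qed

text \<open>Equal slopes at \<open>a\<close> and \<open>b\<close> make \<open>f\<close> affine in between, which forces equality in the Brunn--Minkowski
  inequality; the weight \<open>s\<close> is chosen to give the two summands equal volume.\<close>

lemma Iq_eq_imp_homothetic:
  assumes a: "a > - rad" and ab: "a < b" and eq: "Iq a = Iq b"
  shows "homothetic (P a) (P b)"
proof -
  have b: "b > - rad" using a ab by simp
  have geq: "g a = g b" using eq Iq_eq_iff[OF a b] by simp
  \<comment> \<open>With equal slopes the supergradient inequalities at \<open>a\<close> and at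
    \<open>b\<close> bound \<open>f b - f a\<close> by the same number from above and from
    below.\<close>
  have fb: "f b = f a + (b - a) * g a"
    using f_supergradient[OF b a] f_supergradient[OF a b] geq by (simp add: algebra_simps)
  note fa0 = f_pos[OF a] and fb0 = f_pos[OF b]
  define s where "s = f a / (f a + f b)"
  have s: "0 < s" "s < 1" using fa0 fb0 by (auto simp: s_def)
  have sw: "(1 - s) * f a = s * f b"
    using fa0 fb0 by (simp add: s_def field_simps)
  define w where "w = s * f b"
  have w: "w > 0" using s fb0 by (simp add: w_def)
  define A B where "A = (*\<^sub>R) (1 - s) ` P a" and "B = (*\<^sub>R) s ` P b"
  have A: "compact A" "convex A" and B: "compact B" "convex B"
    unfolding A_def B_def by (intro compact_scaling convex_scaling compact_P convex_P)+
  have lam: "(1 - s) * a + s * b > - rad"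
  proof -
    have "s * (b - a) > 0" using s ab by simp
    then show ?thesis using a by (simp add: algebra_simps)
  qed
  have mA: "measure lebesgue A = w ^ CARD('n)"
  proof -
    have "measure lebesgue A = (1 - s) ^ CARD('n) * f a ^ CARD('n)"
      unfolding A_def f_power[OF a] V_def using s by (intro measure_scaleR_image) simp
    also have "\<dots> = ((1 - s) * f a) ^ CARD('n)" by (simp add: power_mult_distrib)
    finally show ?thesis by (simp add: sw w_def)
  qed
  have mB: "measure lebesgue B = w ^ CARD('n)"
  proof -
    have "measure lebesgue B = s ^ CARD('n) * f b ^ CARD('n)"
      unfolding B_def f_power[OF b] V_def using s by (intro measure_scaleR_image) simp
    then show ?thesis by (simp add: w_def power_mult_distrib)
  qed
  \<comment> \<open>The supergradient at \<open>a\<close> bounds \<open>f\<close> at the averaged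
    parameter by exactly the value that concavity gives from below, so the volume of
    \<open>A + B\<close> in between is determined.\<close>
  have "f ((1 - s) * a + s * b) \<le> f a + ((1 - s) * a + s * b - a) * g a" by (rule f_supergradient[OF lam a])
  also have "\<dots> = (1 - s) * f a + s * f b" by (simp add: fb algebra_simps)
  finally have "root CARD('n) (measure lebesgue (A + B)) = (1 - s) * f a + s * f b"
    using f_concave_aux[OF a b, of s] s unfolding A_def B_def by simp
  also have "\<dots> = 2 * w" by (simp add: sw w_def)
  finally have "root CARD('n) (measure lebesgue (A + B)) ^ CARD('n) = (2 * w) ^ CARD('n)" by simp
  then have mAB: "measure lebesgue (A + B) = 2 ^ CARD('n) * w ^ CARD('n)"
    by (simp add: power_mult_distrib)
  obtain c where c: "A = (+) c ` B"
    using Brunn_Minkowski_eq_imp_translate[OF A B _ mA mB] mAB w by auto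
  have "P b = (\<lambda>y. ((1 - s) / s) *\<^sub>R y + (- (1 / s)) *\<^sub>R c) ` P a"
  proof -
    have "B = (+) (- c) ` A" unfolding c by (simp add: image_image)
    then have "(*\<^sub>R) (1 / s) ` B = (\<lambda>y. (1 / s) *\<^sub>R ((1 - s) *\<^sub>R y - c)) ` P a"
      unfolding A_def by (simp add: image_image)
    moreover have "(*\<^sub>R) (1 / s) ` B = P b" unfolding B_def using s by (simp add: image_image)
    ultimately show ?thesis by (simp add: scaleR_diff_right)
  qed
  moreover have "(1 - s) / s > 0" using s by simp
  ultimately show ?thesis unfolding homothetic_def by blast
qed

end

section \<open>Tangential bodies and homotheties within the family\<close>

text \<open>The half-spaces supporting both bodies already cut out \<open>T\<close>. The segment
  from an interior point to a point outside leaves \<open>T\<close> at a frontier point; the common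
  supporting hyperplane there has the interior point strictly inside and hence excludes the far
  end.\<close>

lemma tangential_body_eq:
  fixes T E :: "(real^'n) set"
  assumes "tangential_body T E"
  shows "T = {x. \<forall>u. support_fun T u = support_fun E u \<longrightarrow> x \<bullet> u \<le> support_fun E u}"
proof -
  have T: "compact T" "convex T" "interior T \<noteq> {}" and E: "compact E" "E \<noteq> {}" and ET: "E \<subseteq> T"
    and sup: "\<And>x. x \<in> frontier T \<Longrightarrow> \<exists>H. x \<in> H \<and> supporting_hyperplane H T \<and> supporting_hyperplane H E"
    using assms by (auto simp: tangential_body_def convex_body_def)
  have "x \<in> T" if x: "\<And>u. support_fun T u = support_fun E u \<Longrightarrow> x \<bullet> u \<le> support_fun E u" for x
  proof (rule ccontr)
    assume nx: "x \<notin> T"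
    obtain t where t: "t \<in> interior T" using T by blast
    then have tT: "t \<in> T" using interior_subset by blast
    have "closed_segment t x \<inter> frontier T \<noteq> {}"
      using tT nx by (intro connected_Int_frontier) auto
    then obtain y where y: "y \<in> closed_segment t x" "y \<in> frontier T" by blast
    then obtain \<theta> where \<theta>: "0 \<le> \<theta>" "\<theta> \<le> 1" "y = (1 - \<theta>) *\<^sub>R t + \<theta> *\<^sub>R x" by (auto simp: in_segment)
    obtain H where H: "y \<in> H" "supporting_hyperplane H T" "supporting_hyperplane H E" using sup[OF y(2)] by blast
    obtain u c where u: "u \<noteq> 0" "H = {x. x \<bullet> u = c}" "\<And>z. z \<in> T \<Longrightarrow> z \<bullet> u \<le> c"
      using H(2) unfolding supporting_hyperplane_def by blast
    have yT: "y \<in> T" using y(2) T(1) frontier_subset_compact by blast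
    have hT: "support_fun T u = c"
    proof (rule antisym)
      show "support_fun T u \<le> c" using tT u(3) by (intro support_fun_le) auto
      show "c \<le> support_fun T u" using support_fun_ge[OF T(1) yT, of u] H(1) u(2) by simp
    qed
    have hE: "support_fun E u = c"
    proof (rule antisym)
      show "support_fun E u \<le> c" using E ET u(3) by (intro support_fun_le) auto
      obtain e where "e \<in> E" "e \<in> H" using H(3) unfolding supporting_hyperplane_def by blast
      then show "c \<le> support_fun E u" using support_fun_ge[OF E(1), of e u] u(2) by simp
    qed
    have xu: "x \<bullet> u \<le> c" using x[of u] hT hE by simp
    obtain d where d: "d > 0" "cball t d \<subseteq> T" using t by (auto simp: mem_interior_cball)
    have "t + (d / norm u) *\<^sub>R u \<in> T" using d u(1) by (intro subsetD[OF d(2)]) (simp add: dist_norm)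
    from u(3)[OF this] have tu: "t \<bullet> u < c"
    proof -
      have "0 < (d / norm u) * (u \<bullet> u)" using d u(1) by simp
      then show ?thesis using u(3)[OF \<open>t + (d / norm u) *\<^sub>R u \<in> T\<close>] by (simp add: inner_add_left)
    qed
    have "c = (1 - \<theta>) * (t \<bullet> u) + \<theta> * (x \<bullet> u)" using H(1) u(2) \<theta>(3) by (simp add: inner_add_left)
    also have "\<dots> \<le> (1 - \<theta>) * (t \<bullet> u) + \<theta> * c" using xu \<theta>(1) by (intro add_left_mono mult_left_mono) auto
    finally have "(1 - \<theta>) * (c - t \<bullet> u) \<le> 0" by (simp add: algebra_simps)
    then have "\<theta> = 1" using tu \<theta>(2) by (simp add: mult_le_0_iff)
    then show False using \<theta>(3) yT nx by simp
  qed
  moreover have "x \<bullet> u \<le> support_fun E u" if "x \<in> T" "support_fun T u = support_fun E u" for x u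
    using support_fun_ge[OF T(1) that(1), of u] that(2) by simp
  ultimately show ?thesis by blast
qed

text \<open>Otherwise \<open>w + \<tau> e\<close> is a recession direction of a bounded set.\<close>

lemma wulff_nonpositive_multiple:
  fixes E U :: "(real^'n) set"
  assumes E: "compact E" "e \<in> E" and bd: "bounded (wulff U (support_fun E))"
    and \<tau>: "\<tau> \<ge> 0" and w: "w \<in> wulff U (\<lambda>u. - \<tau> * support_fun E u)"
  shows "w = - \<tau> *\<^sub>R e"
proof (rule ccontr)
  assume "w \<noteq> - \<tau> *\<^sub>R e"
  define d where "d = w + \<tau> *\<^sub>R e"
  have d: "d \<noteq> 0" using \<open>w \<noteq> - \<tau> *\<^sub>R e\<close> by (auto simp: d_def eq_neg_iff_add_eq_0)
  have ray: "e + q *\<^sub>R d \<in> wulff U (support_fun E)" if q: "q \<ge> 0" for q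
    unfolding wulff_def
  proof (intro CollectI ballI)
    fix u assume u: "u \<in> U"
    have e: "e \<bullet> u \<le> support_fun E u" by (rule support_fun_ge[OF E])
    have "d \<bullet> u = w \<bullet> u + \<tau> * (e \<bullet> u)" by (simp add: d_def inner_add_left)
    also have "\<dots> \<le> - \<tau> * support_fun E u + \<tau> * support_fun E u"
      using w u \<tau> e by (intro add_mono mult_left_mono) (auto simp: wulff_def)
    finally have "q * (d \<bullet> u) \<le> 0" using q by (simp add: mult_nonneg_nonpos)
    then show "(e + q *\<^sub>R d) \<bullet> u \<le> support_fun E u" using e by (simp add: inner_add_left)
  qed
  obtain B where B: "\<And>x. x \<in> wulff U (support_fun E) \<Longrightarrow> norm x \<le> B" using bd by (auto simp: bounded_iff)
  define q where "q = (norm e + \<bar>B\<bar> + 1) / norm d"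
  have q: "q \<ge> 0" by (simp add: q_def)
  have "norm (q *\<^sub>R d) \<le> norm (e + q *\<^sub>R d) + norm e" using norm_triangle_ineq4[of "e + q *\<^sub>R d" e] by simp
  also have "\<dots> \<le> B + norm e" using B[OF ray[OF q]] by simp
  finally show False using d by (simp add: q_def)
qed

lemma interior_subset_singleton_empty:
  fixes S :: "'a::euclidean_space set"
  assumes "S \<subseteq> {a}"
  shows "interior S = {}"
  using interior_mono[OF assms] by simp

context parallel_bodies
begin

lemma homothetic_imp_ratio_gt_1:
  assumes a: "a > - rad" and ab: "a < b" and \<alpha>: "\<alpha> > 0" "P b = (\<lambda>y. \<alpha> *\<^sub>R y + x) ` P a"
  shows "\<alpha> > 1"
proof -
  have "V b = \<alpha> ^ CARD('n) * V a"
    using measure_lebesgue_affine[of \<alpha> x "P a"] \<alpha> by (simp add: V_def)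
  then have "f b = \<alpha> * f a" unfolding f_def using \<alpha> by (simp add: real_root_mult real_root_power_cancel)
  then show ?thesis using f_strict_mono[OF a ab] f_pos[OF a] by simp
qed

text \<open>Were all constraints slack by \<open>1 / (k + 1)\<close> at \<open>n\<close>, a ball
  around \<open>n\<close> would lie in the body. So almost active normals exist, and a subsequence
  converges to some \<open>u\<close> in the closure of \<open>\<Omega>\<close>. The constraints of
  all bodies of the family pass to this same limit.\<close>

lemma P_frontier_active:
  assumes "n \<in> frontier (P a)"
  obtains u where "norm u = 1" "n \<bullet> u = hK u + a * hE u" "\<And>y c. y \<in> P c \<Longrightarrow> y \<bullet> u \<le> hK u + c * hE u"
proof -
  let ?h = "\<lambda>u. hK u + a * hE u"
  have nP: "n \<in> P a" using assms compact_P frontier_subset_compact by blast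
  have ex: "\<exists>u\<in>\<Omega>. n \<bullet> u > ?h u - 1 / real (Suc k)" for k
  proof (rule ccontr)
    assume "\<not> ?thesis"
    then have le: "n \<bullet> u \<le> ?h u - 1 / real (Suc k)" if "u \<in> \<Omega>" for u using that by force
    have "ball n (1 / real (Suc k)) \<subseteq> P a"
    proof
      fix y assume y: "y \<in> ball n (1 / real (Suc k))"
      show "y \<in> P a"
        unfolding P_eq wulff_def
      proof (intro CollectI ballI)
        fix u assume u: "u \<in> \<Omega>"
        then have "norm u = 1" using \<Omega> by auto
        then have "(y - n) \<bullet> u \<le> norm (y - n)" using norm_cauchy_schwarz[of "y - n" u] by simp
        also have "\<dots> \<le> 1 / real (Suc k)" using y by (simp add: dist_norm norm_minus_commute)
        finally show "y \<bullet> u \<le> ?h u" using le[OF u] by (simp add: inner_diff_left)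
      qed
    qed
    then have "n \<in> interior (P a)" by (meson mem_interior of_nat_0_less_iff zero_less_Suc zero_less_divide_1_iff)
    then show False using assms by (simp add: frontier_def)
  qed
  then obtain U where U: "\<And>k. U k \<in> \<Omega>" "\<And>k. n \<bullet> U k > ?h (U k) - 1 / real (Suc k)" by metis
  have "seq_compact (sphere (0::real^'n) 1)" by (rule compact_imp_seq_compact) simp
  moreover have "\<forall>k. U k \<in> sphere 0 1" using U(1) \<Omega> by blast
  ultimately obtain u r where ur: "u \<in> sphere 0 1" "strict_mono (r :: nat \<Rightarrow> nat)" "(U \<circ> r) \<longlonglongrightarrow> u"
    unfolding seq_compact_def by meson
  have lim: "(\<lambda>k. U (r k)) \<longlonglongrightarrow> u" using ur(3) by (simp add: o_def)
  have cK: "(\<lambda>k. hK (U (r k))) \<longlonglongrightarrow> hK u" and cE: "(\<lambda>k. hE (U (r k))) \<longlonglongrightarrow> hE u"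
    using continuous_on_support_fun[OF K(1) K_ne, of UNIV] continuous_on_support_fun[OF E(1) E_ne, of UNIV] lim
    by (auto simp: continuous_on_eq_continuous_at isCont_def intro: isCont_tendsto_compose)
  have P: "y \<bullet> u \<le> hK u + c * hE u" if y: "y \<in> P c" for y c
  proof (rule LIMSEQ_le)
    show "(\<lambda>k. y \<bullet> U (r k)) \<longlonglongrightarrow> y \<bullet> u" by (intro tendsto_intros lim)
    show "(\<lambda>k. hK (U (r k)) + c * hE (U (r k))) \<longlonglongrightarrow> hK u + c * hE u" by (intro tendsto_intros cK cE)
    show "\<exists>N. \<forall>k\<ge>N. y \<bullet> U (r k) \<le> hK (U (r k)) + c * hE (U (r k))" using y U(1) by (auto simp: P_eq wulff_def)
  qed
  have "?h u - 0 \<le> n \<bullet> u"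
  proof (rule LIMSEQ_le)
    have "(\<lambda>k. 1 / real (Suc (r k))) \<longlonglongrightarrow> 0"
      using LIMSEQ_subseq_LIMSEQ[OF LIMSEQ_Suc[OF lim_1_over_n[where 'a=real]] ur(2)] by (simp add: o_def)
    then show "(\<lambda>k. (hK (U (r k)) + a * hE (U (r k))) - 1 / real (Suc (r k))) \<longlonglongrightarrow> ?h u - 0"
      by (intro tendsto_intros cK cE)
    show "(\<lambda>k. n \<bullet> U (r k)) \<longlonglongrightarrow> n \<bullet> u" by (intro tendsto_intros lim)
    show "\<exists>N. \<forall>k\<ge>N. (hK (U (r k)) + a * hE (U (r k))) - 1 / real (Suc (r k)) \<le> n \<bullet> U (r k)" using U(2) by (auto intro: less_imp_le)
  qed
  then have "n \<bullet> u = ?h u" using P[OF nP] by simp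
  then show thesis using that[of u] ur(1) P by simp
qed

lemma homothetic_imp_tangential:
  assumes a: "a > - rad" and ab: "a < b" and hom: "homothetic (P a) (P b)"
  shows "\<exists>T. tangential_body T E \<and> homothetic (P b) T"
proof -
  obtain \<alpha> x where \<alpha>: "\<alpha> > 0" "P b = (\<lambda>y. \<alpha> *\<^sub>R y + x) ` P a" using hom unfolding homothetic_def by blast
  have \<alpha>1: "\<alpha> > 1" by (rule homothetic_imp_ratio_gt_1[OF a ab \<alpha>])
  define \<beta> where "\<beta> = 1 / \<alpha>"
  have \<beta>: "0 < \<beta>" "\<beta> < 1" using \<alpha>1 by (auto simp: \<beta>_def)
  define s where "s = b - a"
  have s: "s > 0" using ab by (simp add: s_def)
  \<comment> \<open>Let Q be \<open>P b\<close> seen from \<open>z\<close>. The inclusion of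
    \<open>P a + s E\<close> in \<open>P b\<close> says that Q contains
    \<open>\<beta> Q + s E\<close>; iterating this sums a geometric series to
    \<open>s / (1 - \<beta>)\<close>, so \<open>\<rho> E\<close> should fit into Q, and
    \<open>T\<close> is Q divided by \<open>\<rho>\<close>.\<close>
  define \<rho> where "\<rho> = s / (1 - \<beta>)"
  have \<rho>: "\<rho> > 0" "s = (1 - \<beta>) * \<rho>" using s \<beta> by (auto simp: \<rho>_def)
  define z where "z = (1 / (1 - \<alpha>)) *\<^sub>R x"
  have z: "x = (1 - \<alpha>) *\<^sub>R z" using \<alpha>1 by (simp add: z_def)
  text \<open>\<open>z\<close> is the fixed point of the homothety and \<open>\<beta>\<close> its inverse ratio.\<close>
  have contr: "z + \<beta> *\<^sub>R (m - z) \<in> P a" if m: "m \<in> P b" for m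
  proof -
    obtain y where y: "y \<in> P a" "m = \<alpha> *\<^sub>R y + x" using m \<alpha>(2) by blast
    have "m - z = \<alpha> *\<^sub>R (y - z)" unfolding y(2) z by (simp add: algebra_simps)
    then have "z + \<beta> *\<^sub>R (m - z) = y" using \<alpha>(1) by (simp add: \<beta>_def)
    then show ?thesis using y by simp
  qed
  have expand: "z + (1 / \<beta>) *\<^sub>R (n - z) \<in> P b" if n: "n \<in> P a" for n
  proof -
    have "z + (1 / \<beta>) *\<^sub>R (n - z) = \<alpha> *\<^sub>R n + x" unfolding z by (simp add: \<beta>_def algebra_simps)
    then show ?thesis using n \<alpha>(2) by blast
  qed
  have plus: "n + s *\<^sub>R e \<in> P b" if "n \<in> P a" "e \<in> E" for n e
    using P_plus_E_subset[of s a] s that by (force simp: s_def set_plus_def)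
  have bl: "b > - rad" using a ab by simp
  define T where "T = (\<lambda>y. (1 / \<rho>) *\<^sub>R y + (- (1 / \<rho>)) *\<^sub>R z) ` P b"
  have T_iff: "t \<in> T \<longleftrightarrow> z + \<rho> *\<^sub>R t \<in> P b" for t
  proof
    assume "t \<in> T"
    then show "z + \<rho> *\<^sub>R t \<in> P b" using \<rho>(1) by (auto simp: T_def scaleR_diff_right)
  next
    assume "z + \<rho> *\<^sub>R t \<in> P b"
    moreover have "t = (1 / \<rho>) *\<^sub>R (z + \<rho> *\<^sub>R t) + (- (1 / \<rho>)) *\<^sub>R z" using \<rho>(1) by (simp add: scaleR_add_right)
    ultimately show "t \<in> T" unfolding T_def by blast
  qed
  have T: "compact T" "convex T" "interior T \<noteq> {}"
  proof -
    show "compact T" "convex T" unfolding T_def by (intro compact_homothet convex_homothet compact_P convex_P)+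
    show "interior T \<noteq> {}" unfolding T_def using \<rho>(1) by (intro interior_homothet_nonempty P_interior[OF bl]) simp
  qed
  have ET: "E \<subseteq> T"
  proof
    fix e assume e: "e \<in> E"
    show "e \<in> T"
    proof (rule ccontr)
      assume "e \<notin> T"
      then have "z + \<rho> *\<^sub>R e \<notin> P b" by (simp add: T_iff)
      then obtain w c where w: "w \<bullet> (z + \<rho> *\<^sub>R e) < c" "\<And>m. m \<in> P b \<Longrightarrow> w \<bullet> m > c"
        using separating_hyperplane_closed_point[OF convex_P compact_imp_closed[OF compact_P]] by blast
      obtain m where m: "m \<in> P b" "m \<bullet> (- w) = support_fun (P b) (- w)"
        using support_fun_attained[OF compact_P P_ne[OF bl]] by blast
      \<comment> \<open>Applying the inclusion once at an extreme point \<open>m\<close> replaces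
        the series: the separating functional at \<open>m\<close> is compared with itself, and
        solving for it gives the factor \<open>1 - \<beta>\<close>.\<close>
      have "z + \<beta> *\<^sub>R (m - z) + s *\<^sub>R e \<in> P b" by (intro plus contr m e)
      then have "(z + \<beta> *\<^sub>R (m - z) + s *\<^sub>R e) \<bullet> (- w) \<le> m \<bullet> (- w)"
        unfolding m(2) by (rule support_fun_ge[OF compact_P])
      then have "w \<bullet> m \<le> (1 - \<beta>) * (w \<bullet> z) + \<beta> * (w \<bullet> m) + (1 - \<beta>) * (\<rho> * (w \<bullet> e))"
        unfolding \<rho>(2) by (simp add: inner_add_left inner_diff_left inner_commute[of _ w] algebra_simps)
      then have "(1 - \<beta>) * (w \<bullet> m) \<le> (1 - \<beta>) * (w \<bullet> (z + \<rho> *\<^sub>R e))" by (simp add: inner_add_right algebra_simps)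
      then have "w \<bullet> m \<le> w \<bullet> (z + \<rho> *\<^sub>R e)" using \<beta> by simp
      then show False using w(1) w(2)[OF m(1)] by simp
    qed
  qed
  have sup: "\<exists>H. t \<in> H \<and> supporting_hyperplane H T \<and> supporting_hyperplane H E" if t: "t \<in> frontier T" for t
  proof -
    have tT: "t \<in> T" using t T(1) frontier_subset_compact by blast
    define y where "y = z + \<rho> *\<^sub>R t"
    define n where "n = z + \<beta> *\<^sub>R (y - z)"
    have yb: "y \<in> P b" using tT T_iff by (simp add: y_def)
    have nf: "n \<in> frontier (P a)"
    proof -
      have "n \<notin> interior (P a)"
      proof
        assume "n \<in> interior (P a)"
        then obtain d where d: "d > 0" "ball n d \<subseteq> P a" by (meson mem_interior)
        have "ball t (d / (\<beta> * \<rho>)) \<subseteq> T"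
        proof
          fix t' assume t': "t' \<in> ball t (d / (\<beta> * \<rho>))"
          define n' where "n' = z + (\<beta> * \<rho>) *\<^sub>R t'"
          have "dist n n' = \<beta> * \<rho> * dist t t'"
            using \<beta> \<rho> by (simp add: n_def n'_def y_def dist_norm flip: scaleR_diff_right)
          then have "n' \<in> P a" using t' \<beta> \<rho> d by (auto simp: field_simps intro!: subsetD[OF d(2)])
          from expand[OF this] show "t' \<in> T" using \<beta> by (simp add: n'_def T_iff)
        qed
        then have "t \<in> interior T" using d \<beta> \<rho> by (metis mem_interior mult_pos_pos zero_less_divide_iff)
        then show False using t by (simp add: frontier_def)
      qed
      moreover have "n \<in> P a" unfolding n_def by (rule contr[OF yb])
      ultimately show ?thesis using closure_subset by (auto simp: frontier_def)
    qed
    obtain u where u: "norm u = 1" "n \<bullet> u = hK u + a * hE u" "\<And>y c. y \<in> P c \<Longrightarrow> y \<bullet> u \<le> hK u + c * hE u"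
      using P_frontier_active[OF nf] by blast
    have Tu: "t' \<bullet> u \<le> t \<bullet> u" if t': "t' \<in> T" for t'
    proof -
      have "z + \<beta> *\<^sub>R ((z + \<rho> *\<^sub>R t') - z) \<in> P a" using t' T_iff by (intro contr) simp
      from u(3)[OF this] have "(z + \<beta> *\<^sub>R (\<rho> *\<^sub>R t')) \<bullet> u \<le> n \<bullet> u" using u(2) by simp
      then have "\<beta> * (\<rho> * (t' \<bullet> u)) \<le> \<beta> * (\<rho> * (t \<bullet> u))" by (simp add: n_def y_def inner_add_left)
      then show ?thesis using \<beta> \<rho> by simp
    qed
    \<comment> \<open>The constraint for \<open>u\<close> is active at \<open>n\<close> with
      parameter \<open>a\<close> and valid at \<open>y\<close> with parameter \<open>b\<close>. The
      bounds differ by \<open>s * hE u\<close> while \<open>y - n\<close> is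
      \<open>s *\<^sub>R t\<close>, so the height of \<open>t\<close> is at most
      \<open>hE u\<close>; as \<open>E\<close> lies in \<open>T\<close>, they are equal.\<close>
    have "y \<bullet> u \<le> n \<bullet> u + s * hE u" using u(3)[OF yb] u(2) by (simp add: s_def algebra_simps)
    then have "(1 - \<beta>) * (\<rho> * (t \<bullet> u)) \<le> s * hE u" by (simp add: n_def y_def inner_add_left algebra_simps)
    then have tu: "t \<bullet> u \<le> hE u" using \<rho> \<beta> by simp
    obtain e where e: "e \<in> E" "e \<bullet> u = hE u" using support_fun_attained[OF E(1) E_ne] .
    have eT: "e \<bullet> u = t \<bullet> u" using Tu[of e] e ET tu by auto
    have u0: "u \<noteq> 0" using u(1) by auto
    let ?H = "{x. x \<bullet> u = t \<bullet> u}"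
    have ne: "?H \<inter> T \<noteq> {}" "?H \<inter> E \<noteq> {}" using tT e(1) eT by auto
    have "supporting_hyperplane ?H T"
      unfolding supporting_hyperplane_def
      by (intro exI[of _ u] exI[of _ "t \<bullet> u"] conjI ballI u0 refl Tu ne)
    moreover have "supporting_hyperplane ?H E"
      unfolding supporting_hyperplane_def
      by (intro exI[of _ u] exI[of _ "t \<bullet> u"] conjI ballI u0 refl Tu subsetD[OF ET] ne)
    ultimately show ?thesis by (intro exI[of _ ?H]) simp
  qed
  have "tangential_body T E"
  proof -
    have "T \<noteq> {}" using ET E_ne by blast
    then show ?thesis
      unfolding tangential_body_def convex_body_def by (intro conjI ballI sup T E ET E_ne E_int)
  qed
  moreover have "homothetic (P b) T"
  proof -
    have "1 / \<rho> > 0" using \<rho>(1) by simp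
    then show ?thesis unfolding homothetic_def T_def by blast
  qed
  ultimately show ?thesis by blast
qed

text \<open>Adding \<open>(b - lam) E\<close> to \<open>P lam\<close> must stay in
  \<open>P b\<close>. On the common normals \<open>U\<close> this lowers each bound by
  \<open>(b - lam) h_E\<close>, and these normals determine \<open>T\<close>, which confines
  \<open>P lam\<close> to the smaller homothet. The converse uses \<open>h_E \<le> h_T\<close>. A
  nonpositive ratio would confine \<open>P lam\<close> to a point.\<close>

lemma tangential_imp_P_eq:
  assumes T: "tangential_body T E" and \<rho>: "\<rho> > 0" "P b = (\<lambda>y. \<rho> *\<^sub>R y + z) ` T"
    and lam: "- rad < lam" "lam \<le> b"
  shows "\<rho> - (b - lam) > 0" and "P lam = (\<lambda>y. (\<rho> - (b - lam)) *\<^sub>R y + z) ` T"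
proof -
  define \<sigma> where "\<sigma> = b - lam"
  have \<sigma>: "\<sigma> \<ge> 0" using lam by (simp add: \<sigma>_def)
  have cT: "compact T" "T \<noteq> {}" and ET: "E \<subseteq> T" using T by (auto simp: tangential_body_def convex_body_def)
  define U where "U = {u. support_fun T u = hE u}"
  have TU: "T = wulff U hE" using tangential_body_eq[OF T] by (auto simp: U_def wulff_def)
  have hb: "support_fun (P b) u = \<rho> * support_fun T u + z \<bullet> u" for u
    unfolding \<rho>(2) using \<rho>(1) by (intro support_fun_homothet cT) simp
  have up: "(y - z) \<in> wulff U (\<lambda>u. (\<rho> - \<sigma>) * hE u)" if y: "y \<in> P lam" for y
    unfolding wulff_def
  proof (intro CollectI ballI)
    fix u assume u: "u \<in> U"
    obtain e where e: "e \<in> E" "e \<bullet> u = hE u" using support_fun_attained[OF E(1) E_ne] .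
    have "y + \<sigma> *\<^sub>R e \<in> P b"
      using P_plus_E_subset[OF \<sigma>, of lam] y e(1) by (force simp: \<sigma>_def set_plus_def)
    then have "(y + \<sigma> *\<^sub>R e) \<bullet> u \<le> \<rho> * hE u + z \<bullet> u"
      using support_fun_ge[OF compact_P, of "y + \<sigma> *\<^sub>R e" b u] u unfolding hb by (simp add: U_def)
    then show "(y - z) \<bullet> u \<le> (\<rho> - \<sigma>) * hE u" using e(2) by (simp add: inner_add_left inner_diff_left algebra_simps)
  qed
  have pos: "\<rho> - \<sigma> > 0"
  proof (rule ccontr)
    assume n: "\<not> \<rho> - \<sigma> > 0"
    obtain e where e: "e \<in> E" using E_ne by blast
    have "y \<in> {z - (\<sigma> - \<rho>) *\<^sub>R e}" if y: "y \<in> P lam" for y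
    proof -
      have "y - z = - (\<sigma> - \<rho>) *\<^sub>R e"
        using compact_imp_bounded[OF cT(1)] n up[OF y]
        by (intro wulff_nonpositive_multiple[OF E(1) e, of U]) (auto simp: TU[symmetric])
      then show ?thesis by (simp add: algebra_simps)
    qed
    then have "P lam \<subseteq> {z - (\<sigma> - \<rho>) *\<^sub>R e}" by blast
    then show False using interior_subset_singleton_empty P_interior[OF lam(1)] by blast
  qed
  then show "\<rho> - (b - lam) > 0" by (simp add: \<sigma>_def)
  show "P lam = (\<lambda>y. (\<rho> - (b - lam)) *\<^sub>R y + z) ` T"
    unfolding \<sigma>_def[symmetric]
  proof
    show "P lam \<subseteq> (\<lambda>y. (\<rho> - \<sigma>) *\<^sub>R y + z) ` T"
    proof
      fix y assume y: "y \<in> P lam"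
      have "(1 / (\<rho> - \<sigma>)) *\<^sub>R (y - z) \<in> T"
        unfolding TU wulff_def
      proof (intro CollectI ballI)
        fix u assume "u \<in> U"
        then have "(y - z) \<bullet> u \<le> (\<rho> - \<sigma>) * hE u" using up[OF y] by (simp add: wulff_def)
        then show "((1 / (\<rho> - \<sigma>)) *\<^sub>R (y - z)) \<bullet> u \<le> hE u" using pos by (simp add: divide_le_eq mult.commute)
      qed
      moreover have "y = (\<rho> - \<sigma>) *\<^sub>R ((1 / (\<rho> - \<sigma>)) *\<^sub>R (y - z)) + z" using pos by simp
      ultimately show "y \<in> (\<lambda>y. (\<rho> - \<sigma>) *\<^sub>R y + z) ` T" by blast
    qed
    show "(\<lambda>y. (\<rho> - \<sigma>) *\<^sub>R y + z) ` T \<subseteq> P lam"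
    proof (rule image_subsetI)
      fix t assume t: "t \<in> T"
      show "(\<rho> - \<sigma>) *\<^sub>R t + z \<in> P lam"
        unfolding P_eq wulff_def
      proof (intro CollectI ballI)
        fix v assume v: "v \<in> \<Omega>"
        have "hE v \<le> support_fun T v" using ET E_ne support_fun_ge[OF cT(1)] by (intro support_fun_le) auto
        then have sE: "\<sigma> * hE v \<le> \<sigma> * support_fun T v" using \<sigma> by (rule mult_left_mono)
        have "support_fun (P b) v \<le> hK v + b * hE v"
          using v lam P_ne[of b] by (intro support_fun_le) (auto simp: P_eq wulff_def)
        then have 1: "\<rho> * support_fun T v + z \<bullet> v \<le> hK v + b * hE v" unfolding hb .
        have "(\<rho> - \<sigma>) * (t \<bullet> v) \<le> (\<rho> - \<sigma>) * support_fun T v"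
          using pos support_fun_ge[OF cT(1) t] by (intro mult_left_mono) auto
        moreover have "(\<rho> - \<sigma>) * support_fun T v = \<rho> * support_fun T v - \<sigma> * support_fun T v" by (rule left_diff_distrib)
        moreover have "lam * hE v = b * hE v - \<sigma> * hE v" by (simp add: \<sigma>_def algebra_simps)
        moreover have "((\<rho> - \<sigma>) *\<^sub>R t + z) \<bullet> v = (\<rho> - \<sigma>) * (t \<bullet> v) + z \<bullet> v" by (simp add: inner_add_left)
        ultimately show "((\<rho> - \<sigma>) *\<^sub>R t + z) \<bullet> v \<le> hK v + lam * hE v"
          using 1 sE by linarith
      qed
    qed
  qed
qed

lemma tangential_imp_P_homothets:
  assumes T: "tangential_body T E" and hom: "homothetic (P b) T"
  obtains \<rho> z where "\<And>lam. - rad < lam \<Longrightarrow> lam \<le> b \<Longrightarrow> \<rho> - (b - lam) > 0"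
    "\<And>lam. - rad < lam \<Longrightarrow> lam \<le> b \<Longrightarrow> P lam = (\<lambda>y. (\<rho> - (b - lam)) *\<^sub>R y + z) ` T"
proof -
  obtain \<alpha> x where \<alpha>: "\<alpha> > 0" "T = (\<lambda>y. \<alpha> *\<^sub>R y + x) ` P b" using hom unfolding homothetic_def by blast
  have "P b = (\<lambda>y. (1 / \<alpha>) *\<^sub>R y + (- (1 / \<alpha>)) *\<^sub>R x) ` T"
    using \<alpha>(1) by (intro homothet_inverse[OF _ \<alpha>(2)]) simp
  moreover have "1 / \<alpha> > 0" using \<alpha>(1) by simp
  ultimately show thesis
    by (intro that[of "1 / \<alpha>" "(- (1 / \<alpha>)) *\<^sub>R x"] tangential_imp_P_eq[OF T])
qed

lemma tangential_imp_Iq_eq: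
  assumes T: "tangential_body T E" and hom: "homothetic (P b) T" and lam: "- rad < lam" "lam \<le> b"
  shows "Iq lam = isoperimetric_quotient T E"
proof -
  obtain \<rho> z where "\<rho> - (b - lam) > 0" "P lam = (\<lambda>y. (\<rho> - (b - lam)) *\<^sub>R y + z) ` T"
    using tangential_imp_P_homothets[OF T hom] lam by metis
  moreover have "compact T" "convex T" "interior T \<noteq> {}" using T by (auto simp: tangential_body_def convex_body_def)
  ultimately show ?thesis using isoperimetric_quotient_homothet E E_int by metis
qed

text \<open>\<open>K\<close> and \<open>P b\<close> are homothets of \<open>T\<close> whose ratios
  differ by \<open>b\<close>, while their constraints differ by \<open>b h_E\<close> on
  \<open>\<Omega>\<close>. Dividing by the positive \<open>b\<close> yields
  \<open>h_T \<le> h_E\<close> on \<open>\<Omega>\<close>, and with \<open>E \<subseteq> T\<close>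
  this identifies \<open>T\<close> with the form body.\<close>

lemma tangential_imp_homothetic_form_body:
  assumes T: "tangential_body T E" and hom: "homothetic (P b) T" and b: "b > 0"
  shows "homothetic K (form_body E \<Omega>)"
proof -
  obtain \<rho> z where \<rho>: "\<And>lam. - rad < lam \<Longrightarrow> lam \<le> b \<Longrightarrow> \<rho> - (b - lam) > 0"
    "\<And>lam. - rad < lam \<Longrightarrow> lam \<le> b \<Longrightarrow> P lam = (\<lambda>y. (\<rho> - (b - lam)) *\<^sub>R y + z) ` T"
    using tangential_imp_P_homothets[OF T hom] by blast
  have cT: "compact T" "T \<noteq> {}" and ET: "E \<subseteq> T" using T by (auto simp: tangential_body_def convex_body_def)
  define \<gamma> where "\<gamma> = \<rho> - b"
  have \<gamma>: "\<gamma> > 0" "K = (\<lambda>y. \<gamma> *\<^sub>R y + z) ` T"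
    using \<rho>[of 0] rad_pos b by (auto simp: \<gamma>_def P_0)
  have Pb: "P b = (\<lambda>y. \<rho> *\<^sub>R y + z) ` T" and \<rho>0: "\<rho> > 0" using \<rho>[of b] rad_pos b by auto
  have hK_eq: "hK u = \<gamma> * support_fun T u + z \<bullet> u" for u
    unfolding \<gamma>(2) using \<gamma>(1) by (intro support_fun_homothet cT) simp
  have "T = form_body E \<Omega>"
  proof
    show "T \<subseteq> form_body E \<Omega>"
    proof
      fix t assume t: "t \<in> T"
      have "t \<bullet> u \<le> hE u" if u: "u \<in> \<Omega>" for u
      proof -
        obtain t' where t': "t' \<in> T" "t' \<bullet> u = support_fun T u" using support_fun_attained[OF cT] .
        have "\<rho> *\<^sub>R t' + z \<in> P b" using t'(1) Pb by blast
        then have "(\<rho> *\<^sub>R t' + z) \<bullet> u \<le> hK u + b * hE u" using u by (simp add: P_eq wulff_def)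
        then have "b * support_fun T u \<le> b * hE u" using t'(2) by (simp add: hK_eq \<gamma>_def inner_add_left algebra_simps)
        then show ?thesis using b support_fun_ge[OF cT(1) t, of u] by simp
      qed
      then show "t \<in> form_body E \<Omega>" by (simp add: form_body_def)
    qed
    show "form_body E \<Omega> \<subseteq> T"
    proof
      fix x assume x: "x \<in> form_body E \<Omega>"
      have "\<gamma> *\<^sub>R x + z \<in> K"
        unfolding K_iff
      proof
        fix u assume u: "u \<in> \<Omega>"
        have "x \<bullet> u \<le> hE u" using x u by (simp add: form_body_def)
        also have "hE u \<le> support_fun T u" using ET E_ne support_fun_ge[OF cT(1)] by (intro support_fun_le) auto
        finally have "\<gamma> * (x \<bullet> u) \<le> \<gamma> * support_fun T u" using \<gamma>(1) by simp
        then show "(\<gamma> *\<^sub>R x + z) \<bullet> u \<le> hK u" by (simp add: hK_eq inner_add_left)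
      qed
      then show "x \<in> T" using \<gamma> by auto
    qed
  qed
  then have "form_body E \<Omega> = (\<lambda>y. (1 / \<gamma>) *\<^sub>R y + (- (1 / \<gamma>)) *\<^sub>R z) ` K"
    unfolding \<open>T = form_body E \<Omega>\<close>[symmetric] using \<gamma>(1) by (intro homothet_inverse[OF _ \<gamma>(2)]) simp
  moreover have "1 / \<gamma> > 0" using \<gamma> by simp
  ultimately show ?thesis unfolding homothetic_def by blast
qed

text \<open>If \<open>K\<close> is the form body scaled by \<open>\<gamma>\<close>, then on
  \<open>\<Omega>\<close> the bounds of \<open>P l\<close> are \<open>(\<gamma> + l) h_E\<close> up
  to a translation, so every body of the family is a homothet of the form body, on both sides of
  0.\<close>

lemma homothetic_form_body_imp_Iq:
  assumes hom: "homothetic K (form_body E \<Omega>)" and lam: "lam > - rad"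
  shows "Iq lam = isoperimetric_quotient (form_body E \<Omega>) E"
    and "isoperimetric_quotient (form_body E \<Omega>) E = real CARD('n) ^ CARD('n) * measure lebesgue (form_body E \<Omega>)"
proof -
  let ?F = "form_body E \<Omega>"
  obtain \<alpha> x where \<alpha>: "\<alpha> > 0" "?F = (\<lambda>y. \<alpha> *\<^sub>R y + x) ` K" using hom unfolding homothetic_def by blast
  define \<gamma> where "\<gamma> = 1 / \<alpha>"
  define z where "z = (- (1 / \<alpha>)) *\<^sub>R x"
  have \<gamma>: "\<gamma> > 0" "K = (\<lambda>y. \<gamma> *\<^sub>R y + z) ` ?F"
    unfolding \<gamma>_def z_def using \<alpha>(1) homothet_inverse[OF _ \<alpha>(2)] by simp_all
  have F: "compact ?F" "convex ?F" "?F \<noteq> {}" "interior ?F \<noteq> {}"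
  proof -
    show "compact ?F" "convex ?F" using compact_form convex_wulff by (simp_all add: form_body_eq_wulff)
    show "?F \<noteq> {}" using E_subset_form E_ne by blast
    show "interior ?F \<noteq> {}" using interior_mono[OF E_subset_form] E_int by blast
  qed
  have hF: "support_fun ?F u = hE u" if u: "u \<in> \<Omega>" for u
  proof (rule antisym)
    show "support_fun ?F u \<le> hE u" using F u by (intro support_fun_le) (auto simp: form_body_def)
    show "hE u \<le> support_fun ?F u" using E_subset_form E_ne support_fun_ge[OF F(1)] by (intro support_fun_le) auto
  qed
  have hK_eq: "hK u = \<gamma> * hE u + z \<bullet> u" if u: "u \<in> \<Omega>" for u
    using support_fun_homothet[OF F(1,3), of \<gamma> z u] \<gamma> hF[OF u] by simp
  have P_iff: "y \<in> P l \<longleftrightarrow> y - z \<in> wulff \<Omega> (\<lambda>u. (\<gamma> + l) * hE u)" for y l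
    unfolding P_eq wulff_def by (auto simp: hK_eq inner_diff_left algebra_simps)
  have pos: "\<gamma> + l > 0" if l: "l > - rad" for l
  proof (rule ccontr)
    assume n: "\<not> \<gamma> + l > 0"
    obtain e where e: "e \<in> E" using E_ne by blast
    have "y \<in> {z + (\<gamma> + l) *\<^sub>R e}" if y: "y \<in> P l" for y
    proof -
      have "y - z = - (- (\<gamma> + l)) *\<^sub>R e"
        using compact_imp_bounded[OF compact_form] n y unfolding P_iff form_body_eq_wulff
        by (intro wulff_nonpositive_multiple[OF E(1) e, of \<Omega>]) (auto simp: add.commute)
      then show ?thesis by (simp add: algebra_simps)
    qed
    then have "P l \<subseteq> {z + (\<gamma> + l) *\<^sub>R e}" by blast
    then show False using interior_subset_singleton_empty P_interior[OF l] by blast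
  qed
  have PF: "P l = (\<lambda>y. (\<gamma> + l) *\<^sub>R y + z) ` ?F" if l: "l > - rad" for l
  proof safe
    fix y assume "y \<in> P l"
    then have "(1 / (\<gamma> + l)) *\<^sub>R (y - z) \<in> ?F"
      using pos[OF l] by (simp add: P_iff form_body_def wulff_def divide_le_eq mult.commute)
    moreover have "y = (\<gamma> + l) *\<^sub>R ((1 / (\<gamma> + l)) *\<^sub>R (y - z)) + z" using pos[OF l] by simp
    ultimately show "y \<in> (\<lambda>y. (\<gamma> + l) *\<^sub>R y + z) ` ?F" by blast
  next
    fix y assume "y \<in> ?F"
    then show "(\<gamma> + l) *\<^sub>R y + z \<in> P l" using pos[OF l] by (simp add: P_iff form_body_def wulff_def)
  qed
  show IF: "Iq lam = isoperimetric_quotient ?F E"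
    unfolding PF[OF lam] by (rule isoperimetric_quotient_homothet[OF F(1,2,4) E E_int pos[OF lam]])
  \<comment> \<open>\<open>f\<close> is affine with slope \<open>R\<close>, so the explicit value of
    the quotient is read off from \<open>g = R\<close> instead of from the surface area of the form
    body.\<close>
  define R where "R = root CARD('n) (measure lebesgue ?F)"
  have fl: "f l = (\<gamma> + l) * R" if l: "l > - rad" for l
  proof -
    have "V l = (\<gamma> + l) ^ CARD('n) * measure lebesgue ?F"
      using measure_lebesgue_affine[of "\<gamma> + l" z ?F] pos[OF l] by (simp add: V_def PF[OF l])
    then show ?thesis using pos[OF l] by (simp add: f_def R_def real_root_mult real_root_power_cancel)
  qed
  have "(f (lam + \<epsilon> k) - f lam) / \<epsilon> k = R" for k
  proof -
    have "lam + \<epsilon> k > - rad" using lam \<epsilon>(1)[of k] by simp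
    then show ?thesis using fl lam \<epsilon>(1)[of k] by (simp add: field_simps)
  qed
  then have "g lam = R" using f_right_derivative[OF lam] by (simp add: LIMSEQ_const_iff)
  then have "Iq lam = (real CARD('n) * R) ^ CARD('n)" by (simp add: Iq_eq[OF lam])
  also have "\<dots> = real CARD('n) ^ CARD('n) * measure lebesgue ?F"
    by (simp add: power_mult_distrib R_def)
  finally show "isoperimetric_quotient ?F E = real CARD('n) ^ CARD('n) * measure lebesgue ?F" using IF by simp
qed

end

theorem theorem4p5:
  fixes K E \<Omega> :: "(real^'n) set"
  defines "r \<equiv> inradius K E"
    and "I \<equiv> (\<lambda>lam. isoperimetric_quotient (parallel_body K E \<Omega> lam) E)"
  assumes "convex_body K" and "interior K \<noteq> {}"
    and "convex_body E" and "interior E \<noteq> {}"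
    and "\<Omega> \<subseteq> sphere 0 1" and "determines \<Omega> K"
  shows "antimono_on {- r<..} I \<and>
    (\<forall>lam0 lam1. - r < lam0 \<and> lam0 < lam1 \<longrightarrow>
      (I lam0 = I lam1 \<longleftrightarrow>
        homothetic (parallel_body K E \<Omega> lam0) (parallel_body K E \<Omega> lam1)) \<and>
      (I lam0 = I lam1 \<longleftrightarrow>
        (\<exists>T. tangential_body T E \<and> homothetic (parallel_body K E \<Omega> lam1) T)) \<and>
      (I lam0 = I lam1 \<longleftrightarrow> I constant_on {- r<..lam1}) \<and>
      (lam1 > 0 \<longrightarrow>
        (I lam0 = I lam1 \<longleftrightarrow> homothetic K (form_body E \<Omega>)) \<and>
        (I lam0 = I lam1 \<longleftrightarrow>
          (\<forall>lam>- r.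
            I lam = isoperimetric_quotient (form_body E \<Omega>) E \<and>
            isoperimetric_quotient (form_body E \<Omega>) E =
              real CARD('n) ^ CARD('n) * measure lebesgue (form_body E \<Omega>)))))"
proof -
  interpret parallel_bodies K E \<Omega>
    using assms by unfold_locales (simp_all add: convex_body_def)
  note I = I_def and r = r_def
  have equiv: "(I a = I b \<longleftrightarrow> homothetic (parallel_body K E \<Omega> a) (parallel_body K E \<Omega> b)) \<and>
      (I a = I b \<longleftrightarrow> (\<exists>T. tangential_body T E \<and> homothetic (parallel_body K E \<Omega> b) T)) \<and>
      (I a = I b \<longleftrightarrow> I constant_on {- r<..b}) \<and>
      (b > 0 \<longrightarrow>
        (I a = I b \<longleftrightarrow> homothetic K (form_body E \<Omega>)) \<and>
        (I a = I b \<longleftrightarrow>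
          (\<forall>lam>- r.
            I lam = isoperimetric_quotient (form_body E \<Omega>) E \<and>
            isoperimetric_quotient (form_body E \<Omega>) E =
              real CARD('n) ^ CARD('n) * measure lebesgue (form_body E \<Omega>))))"
    if ra: "- r < a" and ab: "a < b" for a b
  proof -
    have a: "a > - rad" using ra by (simp add: r)
    \<comment> \<open>The digits stand for the conditions: 1 to 4 for (i) to (iv), 5 for the
      homothety of \<open>K\<close> to the form body, 6 for the explicit constant value. Two cycles
      through 1, 2, 3 result, closed by 4 and, for positive \<open>b\<close>, by 5 and 6.\<close>
    have 12: "homothetic (P a) (P b)" if "I a = I b"
      using Iq_eq_imp_homothetic[OF a ab] that by (simp add: I)
    have 23: "\<exists>T. tangential_body T E \<and> homothetic (P b) T" if "homothetic (P a) (P b)"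
      by (rule homothetic_imp_tangential[OF a ab that])
    have 34: "I constant_on {- r<..b}" if "\<exists>T. tangential_body T E \<and> homothetic (P b) T"
    proof -
      from that obtain T where T: "tangential_body T E" "homothetic (P b) T" by blast
      then have "I lam = isoperimetric_quotient T E" if "lam \<in> {- r<..b}" for lam
        using tangential_imp_Iq_eq[OF T] that by (simp add: I r)
      then show ?thesis unfolding constant_on_def by blast
    qed
    have 41: "I a = I b" if "I constant_on {- r<..b}"
    proof -
      have "a \<in> {- r<..b}" "b \<in> {- r<..b}" using ra ab by simp_all
      then show ?thesis using that unfolding constant_on_def by metis
    qed
    have 35: "homothetic K (form_body E \<Omega>)" if "\<exists>T. tangential_body T E \<and> homothetic (P b) T" "b > 0"
      using that tangential_imp_homothetic_form_body by blast
    have 56: "\<forall>lam>- r. I lam = isoperimetric_quotient (form_body E \<Omega>) E \<and>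
        isoperimetric_quotient (form_body E \<Omega>) E = real CARD('n) ^ CARD('n) * measure lebesgue (form_body E \<Omega>)"
      if "homothetic K (form_body E \<Omega>)"
      using homothetic_form_body_imp_Iq[OF that] by (simp add: I r)
    have 61: "I a = I b" if "\<forall>lam>- r. I lam = isoperimetric_quotient (form_body E \<Omega>) E \<and>
        isoperimetric_quotient (form_body E \<Omega>) E = real CARD('n) ^ CARD('n) * measure lebesgue (form_body E \<Omega>)"
      using that ra ab by (metis less_trans)
    show ?thesis
      using 12 23 34 41 35 56 61 by blast
  qed
  moreover have "antimono_on {- r<..} I" using Iq_antimono by (simp add: I r)
  ultimately show ?thesis by blast
qed

end
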